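(* Let $G$ be a group and $k$ a commutative ring. If $\mathcal{C}$ is a $G$-crossed monoidal category, then $\mathcal{C}(G)$ (defined in the context) is a strict $G$-crossed monoidal category equivalent to $\mathcal{C}$ as a $G$-crossed monoidal category. If moreover $\mathcal{C}$ is $k$-linear, then $\mathcal{C}(G)$ is $k$-linear and is equivalent to $\mathcal{C}$ as a $k$-linear category.
   Context: Convention: "monoidal category" means strict monoidal category; the unit object is denoted $\mathbf{1}$. A monoidal functor $(F,F_2,F_0):\mathcal{C}\to\mathcal{D}$ consists of a functor $F$, natural isomorphisms $F_2(X,Y):F(X\otimes Y)\to F(X)\otimes F(Y)$ and an isomorphism $F_0:F(\mathbf{1})\to\mathbf{1}$ satisfying $(F_2(X,Y)\otimes \mathrm{id}_{F(Z)})F_2(X\otimes Y,Z)=(\mathrm{id}_{F(X)}\otimes F_2(Y,Z))F_2(X,Y\otimes Z)$ and $(\mathrm{id}_{F(X)}\otimes F_0)F_2(X,\mathbf{1})=\mathrm{id}_{F(X)}=(F_0\otimes \mathrm{id}_{F(X)})F_2(\mathbf{1},X)$. Monoidal natural transformations are natural transformations compatible with $F_2$ and $F_0$. The composite $GF$ of monoidal functors has $(GF)_2(X,Y)=G_2(F(X),F(Y))\,G(F_2(X,Y))$ and $(GF)_0=G_0\,G(F_0)$. A monoidal $G$-category is a monoidal category $\mathcal{C}$ together with: functors $g_*:\mathcal{C}\to\mathcal{C}$ for $g\in G$; natural isomorphisms $\phi(g,h):(gh)_*\to g_*\circ h_*$ for $g,h\in G$; natural isomorphisms $\psi^g(X,Y):g_*(X\otimes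 Y)\to g_*(X)\otimes g_*(Y)$ for $g\in G$; such that $g_*(\mathbf{1})=\mathbf{1}$, $\psi^g(X,\mathbf{1})=\psi^g(\mathbf{1},X)=\mathrm{id}_{g_*(X)}$, $e_*=\mathrm{Id}_{\mathcal{C}}$, $\phi(e,g)=\phi(g,e)=\mathrm{Id}_{g_*}$, and for all $g,h,k\in G$ and objects $X,Y,Z$: - $\phi(g,h)_{k_*(X)}\circ\phi(gh,k)_X=g_*(\phi(h,k)_X)\circ\phi(g,hk)_X$; - $(\psi^g(X,Y)\otimes \mathrm{id}_{g_*(Z)})\circ\psi^g(X\otimes Y,Z)=(\mathrm{id}_{g_*(X)}\otimes\psi^g(Y,Z))\circ\psi^g(X,Y\otimes Z)$; - $(\phi(g,h)_X\otimes\phi(g,h)_Y)\circ\psi^{gh}(X,Y)=\psi^g(h_*(X),h_*(Y))\circ g_*(\psi^h(X,Y))\circ\phi(g,h)_{X\otimes Y}$. It is strict if all $\psi^g$ and all $\phi(g,h)$ are identities. A monoidal $G$-functor $(F,\eta):\mathcal{C}\to\mathcal{D}$ is a monoidal functor $F$ with monoidal natural isomorphisms $\eta(g):g_*\circ F\to F\circ g_*$ ($g\in G$) such that $\eta(e)=\mathrm{Id}_F$ and $F(\phi(g,h)_X)\circ\eta(gh)_X=\eta(g)_{h_*(X)}\circ g_*(\eta(h)_X)\circ\phi(g,h)_{F(X)}$ for all $g,h\in G$ and all objects $X$. A $G$-graded monoidal category is a monoidal category $\mathcal{C}$ with a decomposition $\mathcal{C}=\coprod_{g\in G}\mathcal{C}_g$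 (coproduct of categories; if $\mathcal{C}$ is a $k$-linear abelian category, the coproduct is taken in the category of $k$-linear abelian categories) such that $\mathbf{1}\in\mathcal{C}_e$ and $\mathcal{C}_g\otimes\mathcal{C}_h\subset\mathcal{C}_{gh}$ for all $g,h$. A $G$-crossed monoidal category is a $G$-graded monoidal category with a structure of monoidal $G$-category such that $g_*(\mathcal{C}_h)\subset\mathcal{C}_{ghg^{-1}}$ for all $g,h\in G$. It is strict if it is strict as a monoidal $G$-category. It is $k$-linear if $\mathcal{C}$ is a $k$-linear category and each functor $g_*$ is $k$-linear. A functor of $G$-crossed monoidal categories is a monoidal $G$-functor $(F,\eta):\mathcal{C}\to\mathcal{D}$ with $F(\mathcal{C}_g)\subset\mathcal{D}_g$ for all $g\in G$; it is an equivalence if $F$ is an equivalence of categories, and $\mathcal{C}$, $\mathcal{D}$ are equivalent if such an equivalence between them exists. The strict monoidal $G$-category $\mathcal{C}(G)$: objects are pairs $(L,\eta)$ with $L=\{L_g\}_{g\in G}$ a family of objects of $\mathcal{C}$ and $\eta=\{\eta_{g,h}:g_*(L_h)\to L_{gh}\}_{(g,h)\in G\times G}$ a family of isomorphisms such that $\eta_{e,g}=\mathrm{id}_{L_g}$ and $\eta_{gh,k}=\eta_{g,hk}\circ g_*(\eta_{h,k})\circ\phi(g,h)_{L_k}$ for all $g,h,k\in G$. A morphism $(L,\eta)\to(T,\chi)$ is a family $f=\{f_g:L_g\to T_g\}_{g\in G}$ of morphisms with $f_{gh}\circ\eta_{g,h}=\chi_{g,h}\circ g_*(f_h)$ for all $g,h$;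 composition is componentwise. The tensor product is $(L,\eta)\otimes(L',\eta')=(LL',\eta\eta')$ with $(LL')_g=L_g\otimes L'_g$, $(\eta\eta')_{g,h}=(\eta_{g,h}\otimes\eta'_{g,h})\circ\psi^g(L_h,L'_h)$, $(f\otimes l)_g=f_g\otimes l_g$, and unit object the constant family $\mathbf{1}$ with identity isomorphisms. The $G$-action is $g_*(L,\eta)=(gL,g\eta)$ with $(gL)_h=L_{hg}$, $(g\eta)_{x,y}=\eta_{x,yg}$, and $g_*(f)_h=f_{hg}$. For a $G$-crossed monoidal category $\mathcal{C}$, the grading on $\mathcal{C}(G)$ is $\mathcal{C}(G)_g=\{(L,\eta):L_e\in\mathcal{C}_g\}$. *)

theory Defs
  imports "HOL-Algebra.Module"
begin

section \<open>Categories, functors, natural isomorphisms\<close>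

text \<open>
  Composition, identities, and later the tensor product and the functors, act on bare morphisms
  and do not mention source and target. The sets \<open>Hom C X Y\<close> are not required to be disjoint: only
  \<open>f \<in> Hom C X Y\<close> with \<open>X, Y \<in> Ob C\<close> says that \<open>f\<close> is a morphism from \<open>X\<close> to \<open>Y\<close>. This lets a
  morphism of the category of families below be just a family of morphisms.
\<close>

record ('o, 'm) category_data =
  Ob :: "'o set"
  Hom :: "'o \<Rightarrow> 'o \<Rightarrow> 'm set"
  Comp :: "'m \<Rightarrow> 'm \<Rightarrow> 'm" (infixl "\<cdot>\<index>" 70)
  Id :: "'o \<Rightarrow> 'm"

locale category =
  fixes C :: "('o, 'm, 'z) category_data_scheme"
  assumes comp_in_Hom:
      "\<lbrakk>X \<in> Ob C; Y \<in> Ob C; Z \<in> Ob C; f \<in> Hom C X Y; g \<in> Hom C Y Z\<rbrakk> \<Longrightarrow> g \<cdot>\<^bsub>C\<^esub> f \<in> Hom C X Z"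
    and Id_in_Hom: "X \<in> Ob C \<Longrightarrow> Id C X \<in> Hom C X X"
    and comp_assoc:
      "\<lbrakk>W \<in> Ob C; X \<in> Ob C; Y \<in> Ob C; Z \<in> Ob C; f \<in> Hom C W X; g \<in> Hom C X Y; h \<in> Hom C Y Z\<rbrakk>
        \<Longrightarrow> (h \<cdot>\<^bsub>C\<^esub> g) \<cdot>\<^bsub>C\<^esub> f = h \<cdot>\<^bsub>C\<^esub> (g \<cdot>\<^bsub>C\<^esub> f)"
    and comp_Id_right: "\<lbrakk>X \<in> Ob C; Y \<in> Ob C; f \<in> Hom C X Y\<rbrakk> \<Longrightarrow> f \<cdot>\<^bsub>C\<^esub> Id C X = f"
    and comp_Id_left: "\<lbrakk>X \<in> Ob C; Y \<in> Ob C; f \<in> Hom C X Y\<rbrakk> \<Longrightarrow> Id C Y \<cdot>\<^bsub>C\<^esub> f = f"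

definition is_iso :: "('o, 'm, 'z) category_data_scheme \<Rightarrow> 'o \<Rightarrow> 'o \<Rightarrow> 'm \<Rightarrow> bool" where
  "is_iso C X Y f \<longleftrightarrow>
    f \<in> Hom C X Y \<and> (\<exists>g \<in> Hom C Y X. g \<cdot>\<^bsub>C\<^esub> f = Id C X \<and> f \<cdot>\<^bsub>C\<^esub> g = Id C Y)"

record ('o, 'm, 'p, 'n) functor_data =
  obmap :: "'o \<Rightarrow> 'p"
  mormap :: "'m \<Rightarrow> 'n"

definition is_functor ::
  "('o, 'm, 'y) category_data_scheme \<Rightarrow> ('p, 'n, 'z) category_data_scheme
    \<Rightarrow> ('o, 'm, 'p, 'n, 'x) functor_data_scheme \<Rightarrow> bool" where
  "is_functor C D F \<longleftrightarrow>
    (\<forall>X \<in> Ob C. obmap F X \<in> Ob D) \<and>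
    (\<forall>X \<in> Ob C. \<forall>Y \<in> Ob C. \<forall>f \<in> Hom C X Y. mormap F f \<in> Hom D (obmap F X) (obmap F Y)) \<and>
    (\<forall>X \<in> Ob C. mormap F (Id C X) = Id D (obmap F X)) \<and>
    (\<forall>X \<in> Ob C. \<forall>Y \<in> Ob C. \<forall>Z \<in> Ob C. \<forall>f \<in> Hom C X Y. \<forall>g \<in> Hom C Y Z.
      mormap F (g \<cdot>\<^bsub>C\<^esub> f) = mormap F g \<cdot>\<^bsub>D\<^esub> mormap F f)"

definition id_functor :: "('o, 'm, 'o, 'm) functor_data" where
  "id_functor = \<lparr>obmap = (\<lambda>X. X), mormap = (\<lambda>f. f)\<rparr>"

definition comp_functor ::
  "('p, 'n, 'q, 'l, 'y) functor_data_scheme \<Rightarrow> ('o, 'm, 'p, 'n, 'z) functor_data_scheme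
    \<Rightarrow> ('o, 'm, 'q, 'l) functor_data" where
  "comp_functor H F = \<lparr>obmap = obmap H \<circ> obmap F, mormap = mormap H \<circ> mormap F\<rparr>"

definition natural_iso ::
  "('o, 'm, 'y) category_data_scheme \<Rightarrow> ('p, 'n, 'z) category_data_scheme
    \<Rightarrow> ('o, 'm, 'p, 'n, 'w) functor_data_scheme \<Rightarrow> ('o, 'm, 'p, 'n, 'x) functor_data_scheme
    \<Rightarrow> ('o \<Rightarrow> 'n) \<Rightarrow> bool" where
  "natural_iso C D F H \<tau> \<longleftrightarrow>
    (\<forall>X \<in> Ob C. is_iso D (obmap F X) (obmap H X) (\<tau> X)) \<and>
    (\<forall>X \<in> Ob C. \<forall>Y \<in> Ob C. \<forall>f \<in> Hom C X Y. \<tau> Y \<cdot>\<^bsub>D\<^esub> mormap F f = mormap H f \<cdot>\<^bsub>D\<^esub> \<tau> X)"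

definition category_equivalence ::
  "('o, 'm, 'y) category_data_scheme \<Rightarrow> ('p, 'n, 'z) category_data_scheme
    \<Rightarrow> ('o, 'm, 'p, 'n, 'x) functor_data_scheme \<Rightarrow> bool" where
  "category_equivalence C D F \<longleftrightarrow>
    is_functor C D F \<and>
    (\<exists>H :: ('p, 'n, 'o, 'm) functor_data.
      is_functor D C H \<and>
      (\<exists>\<tau>. natural_iso C C id_functor (comp_functor H F) \<tau>) \<and>
      (\<exists>\<tau>. natural_iso D D (comp_functor F H) id_functor \<tau>))"


section \<open>Strict monoidal categories and monoidal functors\<close>

record ('o, 'm) monoidal_data = "('o, 'm) category_data" +
  tensor_ob :: "'o \<Rightarrow> 'o \<Rightarrow> 'o" (infixl "\<otimes>\<^sub>o\<index>" 75)
  tensor_mor :: "'m \<Rightarrow> 'm \<Rightarrow> 'm" (infixl "\<otimes>\<^sub>m\<index>" 75)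
  unit_ob :: "'o"

locale monoidal_category = category C
  for C :: "('o, 'm, 'z) monoidal_data_scheme" +
  assumes tensor_Ob: "\<lbrakk>X \<in> Ob C; Y \<in> Ob C\<rbrakk> \<Longrightarrow> X \<otimes>\<^sub>o\<^bsub>C\<^esub> Y \<in> Ob C"
    and unit_Ob: "unit_ob C \<in> Ob C"
    and tensor_Hom:
      "\<lbrakk>X \<in> Ob C; Y \<in> Ob C; X' \<in> Ob C; Y' \<in> Ob C; f \<in> Hom C X Y; f' \<in> Hom C X' Y'\<rbrakk>
        \<Longrightarrow> f \<otimes>\<^sub>m\<^bsub>C\<^esub> f' \<in> Hom C (X \<otimes>\<^sub>o\<^bsub>C\<^esub> X') (Y \<otimes>\<^sub>o\<^bsub>C\<^esub> Y')"
    and tensor_Id: "\<lbrakk>X \<in> Ob C; Y \<in> Ob C\<rbrakk> \<Longrightarrow> Id C X \<otimes>\<^sub>m\<^bsub>C\<^esub> Id C Y = Id C (X \<otimes>\<^sub>o\<^bsub>C\<^esub> Y)"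
    and tensor_comp:
      "\<lbrakk>X \<in> Ob C; Y \<in> Ob C; Z \<in> Ob C; X' \<in> Ob C; Y' \<in> Ob C; Z' \<in> Ob C;
        f \<in> Hom C X Y; g \<in> Hom C Y Z; f' \<in> Hom C X' Y'; g' \<in> Hom C Y' Z'\<rbrakk>
        \<Longrightarrow> (g \<cdot>\<^bsub>C\<^esub> f) \<otimes>\<^sub>m\<^bsub>C\<^esub> (g' \<cdot>\<^bsub>C\<^esub> f') = (g \<otimes>\<^sub>m\<^bsub>C\<^esub> g') \<cdot>\<^bsub>C\<^esub> (f \<otimes>\<^sub>m\<^bsub>C\<^esub> f')"
    and tensor_ob_assoc:
      "\<lbrakk>X \<in> Ob C; Y \<in> Ob C; Z \<in> Ob C\<rbrakk> \<Longrightarrow> (X \<otimes>\<^sub>o\<^bsub>C\<^esub> Y) \<otimes>\<^sub>o\<^bsub>C\<^esub> Z = X \<otimes>\<^sub>o\<^bsub>C\<^esub> (Y \<otimes>\<^sub>o\<^bsub>C\<^esub> Z)"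
    and tensor_ob_unit_left: "X \<in> Ob C \<Longrightarrow> unit_ob C \<otimes>\<^sub>o\<^bsub>C\<^esub> X = X"
    and tensor_ob_unit_right: "X \<in> Ob C \<Longrightarrow> X \<otimes>\<^sub>o\<^bsub>C\<^esub> unit_ob C = X"
    and tensor_mor_assoc:
      "\<lbrakk>X \<in> Ob C; Y \<in> Ob C; X' \<in> Ob C; Y' \<in> Ob C; X'' \<in> Ob C; Y'' \<in> Ob C;
        f \<in> Hom C X Y; f' \<in> Hom C X' Y'; f'' \<in> Hom C X'' Y''\<rbrakk>
        \<Longrightarrow> (f \<otimes>\<^sub>m\<^bsub>C\<^esub> f') \<otimes>\<^sub>m\<^bsub>C\<^esub> f'' = f \<otimes>\<^sub>m\<^bsub>C\<^esub> (f' \<otimes>\<^sub>m\<^bsub>C\<^esub> f'')"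
    and tensor_mor_unit_left:
      "\<lbrakk>X \<in> Ob C; Y \<in> Ob C; f \<in> Hom C X Y\<rbrakk> \<Longrightarrow> Id C (unit_ob C) \<otimes>\<^sub>m\<^bsub>C\<^esub> f = f"
    and tensor_mor_unit_right:
      "\<lbrakk>X \<in> Ob C; Y \<in> Ob C; f \<in> Hom C X Y\<rbrakk> \<Longrightarrow> f \<otimes>\<^sub>m\<^bsub>C\<^esub> Id C (unit_ob C) = f"

record ('o, 'm, 'p, 'n) monoidal_functor_data = "('o, 'm, 'p, 'n) functor_data" +
  mult_iso :: "'o \<Rightarrow> 'o \<Rightarrow> 'n"
  unit_iso :: "'n"

definition monoidal_functor ::
  "('o, 'm, 'y) monoidal_data_scheme \<Rightarrow> ('p, 'n, 'z) monoidal_data_scheme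
    \<Rightarrow> ('o, 'm, 'p, 'n) monoidal_functor_data \<Rightarrow> bool" where
  "monoidal_functor C D F \<longleftrightarrow>
    is_functor C D F \<and>
    (\<forall>X \<in> Ob C. \<forall>Y \<in> Ob C.
      is_iso D (obmap F (X \<otimes>\<^sub>o\<^bsub>C\<^esub> Y)) (obmap F X \<otimes>\<^sub>o\<^bsub>D\<^esub> obmap F Y) (mult_iso F X Y)) \<and>
    (\<forall>X \<in> Ob C. \<forall>X' \<in> Ob C. \<forall>Y \<in> Ob C. \<forall>Y' \<in> Ob C. \<forall>f \<in> Hom C X X'. \<forall>g \<in> Hom C Y Y'.
      mult_iso F X' Y' \<cdot>\<^bsub>D\<^esub> mormap F (f \<otimes>\<^sub>m\<^bsub>C\<^esub> g)
        = (mormap F f \<otimes>\<^sub>m\<^bsub>D\<^esub> mormap F g) \<cdot>\<^bsub>D\<^esub> mult_iso F X Y) \<and>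
    is_iso D (obmap F (unit_ob C)) (unit_ob D) (unit_iso F) \<and>
    (\<forall>X \<in> Ob C. \<forall>Y \<in> Ob C. \<forall>Z \<in> Ob C.
      (mult_iso F X Y \<otimes>\<^sub>m\<^bsub>D\<^esub> Id D (obmap F Z)) \<cdot>\<^bsub>D\<^esub> mult_iso F (X \<otimes>\<^sub>o\<^bsub>C\<^esub> Y) Z
        = (Id D (obmap F X) \<otimes>\<^sub>m\<^bsub>D\<^esub> mult_iso F Y Z) \<cdot>\<^bsub>D\<^esub> mult_iso F X (Y \<otimes>\<^sub>o\<^bsub>C\<^esub> Z)) \<and>
    (\<forall>X \<in> Ob C.
      (Id D (obmap F X) \<otimes>\<^sub>m\<^bsub>D\<^esub> unit_iso F) \<cdot>\<^bsub>D\<^esub> mult_iso F X (unit_ob C) = Id D (obmap F X) \<and>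
      (unit_iso F \<otimes>\<^sub>m\<^bsub>D\<^esub> Id D (obmap F X)) \<cdot>\<^bsub>D\<^esub> mult_iso F (unit_ob C) X = Id D (obmap F X))"

text \<open>In \<open>comp_monoidal_functor E H F\<close>, the category \<open>E\<close> is the target of \<open>H\<close>.\<close>

definition comp_monoidal_functor ::
  "('q, 'l, 'y) category_data_scheme \<Rightarrow> ('p, 'n, 'q, 'l) monoidal_functor_data
    \<Rightarrow> ('o, 'm, 'p, 'n) monoidal_functor_data \<Rightarrow> ('o, 'm, 'q, 'l) monoidal_functor_data" where
  "comp_monoidal_functor E H F =
    \<lparr>obmap = obmap H \<circ> obmap F,
     mormap = mormap H \<circ> mormap F,
     mult_iso = (\<lambda>X Y. mult_iso H (obmap F X) (obmap F Y) \<cdot>\<^bsub>E\<^esub> mormap H (mult_iso F X Y)),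
     unit_iso = unit_iso H \<cdot>\<^bsub>E\<^esub> mormap H (unit_iso F)\<rparr>"

definition monoidal_natural_iso ::
  "('o, 'm, 'y) monoidal_data_scheme \<Rightarrow> ('p, 'n, 'z) monoidal_data_scheme
    \<Rightarrow> ('o, 'm, 'p, 'n) monoidal_functor_data \<Rightarrow> ('o, 'm, 'p, 'n) monoidal_functor_data
    \<Rightarrow> ('o \<Rightarrow> 'n) \<Rightarrow> bool" where
  "monoidal_natural_iso C D F H \<tau> \<longleftrightarrow>
    natural_iso C D F H \<tau> \<and>
    (\<forall>X \<in> Ob C. \<forall>Y \<in> Ob C.
      (\<tau> X \<otimes>\<^sub>m\<^bsub>D\<^esub> \<tau> Y) \<cdot>\<^bsub>D\<^esub> mult_iso F X Y = mult_iso H X Y \<cdot>\<^bsub>D\<^esub> \<tau> (X \<otimes>\<^sub>o\<^bsub>C\<^esub> Y)) \<and>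
    unit_iso H \<cdot>\<^bsub>D\<^esub> \<tau> (unit_ob C) = unit_iso F"


section \<open>Monoidal \<open>G\<close>-categories and monoidal \<open>G\<close>-functors\<close>

text \<open>
  \<open>component C g\<close> is the set of objects of \<open>C\<^sub>g\<close>; it plays no role for monoidal \<open>G\<close>-categories.
\<close>

record ('o, 'm, 'g) crossed_data = "('o, 'm) monoidal_data" +
  act_ob :: "'g \<Rightarrow> 'o \<Rightarrow> 'o"
  act_mor :: "'g \<Rightarrow> 'm \<Rightarrow> 'm"
  phi :: "'g \<Rightarrow> 'g \<Rightarrow> 'o \<Rightarrow> 'm"
  psi :: "'g \<Rightarrow> 'o \<Rightarrow> 'o \<Rightarrow> 'm"
  component :: "'g \<Rightarrow> 'o set"

definition act :: "('o, 'm, 'g, 'z) crossed_data_scheme \<Rightarrow> 'g \<Rightarrow> ('o, 'm, 'o, 'm) functor_data"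
  where "act C g = \<lparr>obmap = act_ob C g, mormap = act_mor C g\<rparr>"

locale monoidal_G_category = group G + monoidal_category C
  for G :: "('g, 'b) monoid_scheme" and C :: "('o, 'm, 'g, 'z) crossed_data_scheme" +
  assumes act_functor: "g \<in> carrier G \<Longrightarrow> is_functor C C (act C g)"
    and phi_natural_iso:
      "\<lbrakk>g \<in> carrier G; h \<in> carrier G\<rbrakk>
        \<Longrightarrow> natural_iso C C (act C (g \<otimes>\<^bsub>G\<^esub> h)) (comp_functor (act C g) (act C h)) (phi C g h)"
    and psi_iso:
      "\<lbrakk>g \<in> carrier G; X \<in> Ob C; Y \<in> Ob C\<rbrakk>
        \<Longrightarrow> is_iso C (act_ob C g (X \<otimes>\<^sub>o\<^bsub>C\<^esub> Y)) (act_ob C g X \<otimes>\<^sub>o\<^bsub>C\<^esub> act_ob C g Y) (psi C g X Y)"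
    and psi_natural:
      "\<lbrakk>g \<in> carrier G; X \<in> Ob C; X' \<in> Ob C; Y \<in> Ob C; Y' \<in> Ob C; f \<in> Hom C X X'; f' \<in> Hom C Y Y'\<rbrakk>
        \<Longrightarrow> psi C g X' Y' \<cdot>\<^bsub>C\<^esub> act_mor C g (f \<otimes>\<^sub>m\<^bsub>C\<^esub> f')
          = (act_mor C g f \<otimes>\<^sub>m\<^bsub>C\<^esub> act_mor C g f') \<cdot>\<^bsub>C\<^esub> psi C g X Y"
    and act_unit: "g \<in> carrier G \<Longrightarrow> act_ob C g (unit_ob C) = unit_ob C"
    and psi_unit_right:
      "\<lbrakk>g \<in> carrier G; X \<in> Ob C\<rbrakk> \<Longrightarrow> psi C g X (unit_ob C) = Id C (act_ob C g X)"
    and psi_unit_left: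
      "\<lbrakk>g \<in> carrier G; X \<in> Ob C\<rbrakk> \<Longrightarrow> psi C g (unit_ob C) X = Id C (act_ob C g X)"
    and act_one_ob: "X \<in> Ob C \<Longrightarrow> act_ob C \<one>\<^bsub>G\<^esub> X = X"
    and act_one_mor: "\<lbrakk>X \<in> Ob C; Y \<in> Ob C; f \<in> Hom C X Y\<rbrakk> \<Longrightarrow> act_mor C \<one>\<^bsub>G\<^esub> f = f"
    and phi_one_left:
      "\<lbrakk>g \<in> carrier G; X \<in> Ob C\<rbrakk> \<Longrightarrow> phi C \<one>\<^bsub>G\<^esub> g X = Id C (act_ob C g X)"
    and phi_one_right:
      "\<lbrakk>g \<in> carrier G; X \<in> Ob C\<rbrakk> \<Longrightarrow> phi C g \<one>\<^bsub>G\<^esub> X = Id C (act_ob C g X)"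
    and phi_coherence:
      "\<lbrakk>g \<in> carrier G; h \<in> carrier G; k \<in> carrier G; X \<in> Ob C\<rbrakk>
        \<Longrightarrow> phi C g h (act_ob C k X) \<cdot>\<^bsub>C\<^esub> phi C (g \<otimes>\<^bsub>G\<^esub> h) k X
          = act_mor C g (phi C h k X) \<cdot>\<^bsub>C\<^esub> phi C g (h \<otimes>\<^bsub>G\<^esub> k) X"
    and psi_coherence:
      "\<lbrakk>g \<in> carrier G; X \<in> Ob C; Y \<in> Ob C; Z \<in> Ob C\<rbrakk>
        \<Longrightarrow> (psi C g X Y \<otimes>\<^sub>m\<^bsub>C\<^esub> Id C (act_ob C g Z)) \<cdot>\<^bsub>C\<^esub> psi C g (X \<otimes>\<^sub>o\<^bsub>C\<^esub> Y) Z
          = (Id C (act_ob C g X) \<otimes>\<^sub>m\<^bsub>C\<^esub> psi C g Y Z) \<cdot>\<^bsub>C\<^esub> psi C g X (Y \<otimes>\<^sub>o\<^bsub>C\<^esub> Z)"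
    and phi_psi_coherence:
      "\<lbrakk>g \<in> carrier G; h \<in> carrier G; X \<in> Ob C; Y \<in> Ob C\<rbrakk>
        \<Longrightarrow> (phi C g h X \<otimes>\<^sub>m\<^bsub>C\<^esub> phi C g h Y) \<cdot>\<^bsub>C\<^esub> psi C (g \<otimes>\<^bsub>G\<^esub> h) X Y
          = psi C g (act_ob C h X) (act_ob C h Y) \<cdot>\<^bsub>C\<^esub> act_mor C g (psi C h X Y)
              \<cdot>\<^bsub>C\<^esub> phi C g h (X \<otimes>\<^sub>o\<^bsub>C\<^esub> Y)"

text \<open>
  Since Hom-sets may overlap, that an isomorphism is an identity has to include that its source and
  target are equal.
\<close>

definition strict_action ::
  "('g, 'b) monoid_scheme \<Rightarrow> ('o, 'm, 'g, 'z) crossed_data_scheme \<Rightarrow> bool" where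
  "strict_action G C \<longleftrightarrow>
    (\<forall>g \<in> carrier G. \<forall>X \<in> Ob C. \<forall>Y \<in> Ob C.
      act_ob C g (X \<otimes>\<^sub>o\<^bsub>C\<^esub> Y) = act_ob C g X \<otimes>\<^sub>o\<^bsub>C\<^esub> act_ob C g Y \<and>
      psi C g X Y = Id C (act_ob C g (X \<otimes>\<^sub>o\<^bsub>C\<^esub> Y))) \<and>
    (\<forall>g \<in> carrier G. \<forall>h \<in> carrier G. \<forall>X \<in> Ob C.
      act_ob C (g \<otimes>\<^bsub>G\<^esub> h) X = act_ob C g (act_ob C h X) \<and>
      phi C g h X = Id C (act_ob C (g \<otimes>\<^bsub>G\<^esub> h) X))"

text \<open>\<open>g\<^sub>*\<close> as a monoidal functor; \<open>unit_iso\<close> is well typed because \<open>g\<^sub>*(\<one>) = \<one>\<close>.\<close>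

definition monoidal_act ::
  "('o, 'm, 'g, 'z) crossed_data_scheme \<Rightarrow> 'g \<Rightarrow> ('o, 'm, 'o, 'm) monoidal_functor_data" where
  "monoidal_act C g =
    \<lparr>obmap = act_ob C g, mormap = act_mor C g, mult_iso = psi C g, unit_iso = Id C (unit_ob C)\<rparr>"

definition monoidal_G_functor ::
  "('g, 'b) monoid_scheme \<Rightarrow> ('o, 'm, 'g, 'y) crossed_data_scheme
    \<Rightarrow> ('p, 'n, 'g, 'z) crossed_data_scheme \<Rightarrow> ('o, 'm, 'p, 'n) monoidal_functor_data
    \<Rightarrow> ('g \<Rightarrow> 'o \<Rightarrow> 'n) \<Rightarrow> bool" where
  "monoidal_G_functor G C D F \<eta> \<longleftrightarrow>
    monoidal_functor C D F \<and>
    (\<forall>g \<in> carrier G.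
      monoidal_natural_iso C D (comp_monoidal_functor D (monoidal_act D g) F)
        (comp_monoidal_functor D F (monoidal_act C g)) (\<eta> g)) \<and>
    (\<forall>X \<in> Ob C. \<eta> \<one>\<^bsub>G\<^esub> X = Id D (obmap F X)) \<and>
    (\<forall>g \<in> carrier G. \<forall>h \<in> carrier G. \<forall>X \<in> Ob C.
      mormap F (phi C g h X) \<cdot>\<^bsub>D\<^esub> \<eta> (g \<otimes>\<^bsub>G\<^esub> h) X
        = \<eta> g (act_ob C h X) \<cdot>\<^bsub>D\<^esub> act_mor D g (\<eta> h X) \<cdot>\<^bsub>D\<^esub> phi D g h (obmap F X))"


section \<open>Abelian categories and decompositions of categories\<close>

definition zero_object :: "('o, 'm, 'z) category_data_scheme \<Rightarrow> 'o \<Rightarrow> bool" where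
  "zero_object C Z \<longleftrightarrow>
    Z \<in> Ob C \<and> (\<forall>X \<in> Ob C. (\<exists>!f. f \<in> Hom C X Z) \<and> (\<exists>!f. f \<in> Hom C Z X))"

definition zero_morphism :: "('o, 'm, 'z) category_data_scheme \<Rightarrow> 'o \<Rightarrow> 'o \<Rightarrow> 'm \<Rightarrow> bool" where
  "zero_morphism C X Y f \<longleftrightarrow>
    (\<exists>Z u v. zero_object C Z \<and> u \<in> Hom C X Z \<and> v \<in> Hom C Z Y \<and> f = v \<cdot>\<^bsub>C\<^esub> u)"

definition is_product ::
  "('o, 'm, 'z) category_data_scheme \<Rightarrow> 'i set \<Rightarrow> ('i \<Rightarrow> 'o) \<Rightarrow> 'o \<Rightarrow> ('i \<Rightarrow> 'm) \<Rightarrow> bool" where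
  "is_product C I Y X p \<longleftrightarrow>
    X \<in> Ob C \<and> (\<forall>i \<in> I. Y i \<in> Ob C \<and> p i \<in> Hom C X (Y i)) \<and>
    (\<forall>W \<in> Ob C. \<forall>f. (\<forall>i \<in> I. f i \<in> Hom C W (Y i)) \<longrightarrow>
      (\<exists>!u. u \<in> Hom C W X \<and> (\<forall>i \<in> I. p i \<cdot>\<^bsub>C\<^esub> u = f i)))"

definition is_coproduct ::
  "('o, 'm, 'z) category_data_scheme \<Rightarrow> 'i set \<Rightarrow> ('i \<Rightarrow> 'o) \<Rightarrow> 'o \<Rightarrow> ('i \<Rightarrow> 'm) \<Rightarrow> bool" where
  "is_coproduct C I Y X j \<longleftrightarrow>
    X \<in> Ob C \<and> (\<forall>i \<in> I. Y i \<in> Ob C \<and> j i \<in> Hom C (Y i) X) \<and>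
    (\<forall>W \<in> Ob C. \<forall>f. (\<forall>i \<in> I. f i \<in> Hom C (Y i) W) \<longrightarrow>
      (\<exists>!u. u \<in> Hom C X W \<and> (\<forall>i \<in> I. u \<cdot>\<^bsub>C\<^esub> j i = f i)))"

definition is_direct_sum ::
  "('o, 'm, 'z) category_data_scheme \<Rightarrow> 'i set \<Rightarrow> ('i \<Rightarrow> 'o) \<Rightarrow> 'o
    \<Rightarrow> ('i \<Rightarrow> 'm) \<Rightarrow> ('i \<Rightarrow> 'm) \<Rightarrow> bool" where
  "is_direct_sum C I Y X p j \<longleftrightarrow>
    is_product C I Y X p \<and> is_coproduct C I Y X j \<and>
    (\<forall>i \<in> I. p i \<cdot>\<^bsub>C\<^esub> j i = Id C (Y i)) \<and>
    (\<forall>i \<in> I. \<forall>i' \<in> I. i \<noteq> i' \<longrightarrow> zero_morphism C (Y i) (Y i') (p i' \<cdot>\<^bsub>C\<^esub> j i))"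

definition is_kernel ::
  "('o, 'm, 'z) category_data_scheme \<Rightarrow> 'o \<Rightarrow> 'o \<Rightarrow> 'm \<Rightarrow> 'o \<Rightarrow> 'm \<Rightarrow> bool" where
  "is_kernel C X Y f K i \<longleftrightarrow>
    K \<in> Ob C \<and> i \<in> Hom C K X \<and> zero_morphism C K Y (f \<cdot>\<^bsub>C\<^esub> i) \<and>
    (\<forall>W \<in> Ob C. \<forall>t \<in> Hom C W X. zero_morphism C W Y (f \<cdot>\<^bsub>C\<^esub> t) \<longrightarrow>
      (\<exists>!u. u \<in> Hom C W K \<and> i \<cdot>\<^bsub>C\<^esub> u = t))"

definition is_cokernel ::
  "('o, 'm, 'z) category_data_scheme \<Rightarrow> 'o \<Rightarrow> 'o \<Rightarrow> 'm \<Rightarrow> 'o \<Rightarrow> 'm \<Rightarrow> bool" where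
  "is_cokernel C X Y f Q q \<longleftrightarrow>
    Q \<in> Ob C \<and> q \<in> Hom C Y Q \<and> zero_morphism C X Q (q \<cdot>\<^bsub>C\<^esub> f) \<and>
    (\<forall>W \<in> Ob C. \<forall>t \<in> Hom C Y W. zero_morphism C X W (t \<cdot>\<^bsub>C\<^esub> f) \<longrightarrow>
      (\<exists>!u. u \<in> Hom C Q W \<and> u \<cdot>\<^bsub>C\<^esub> q = t))"

definition is_mono :: "('o, 'm, 'z) category_data_scheme \<Rightarrow> 'o \<Rightarrow> 'o \<Rightarrow> 'm \<Rightarrow> bool" where
  "is_mono C X Y f \<longleftrightarrow>
    f \<in> Hom C X Y \<and>
    (\<forall>W \<in> Ob C. \<forall>u \<in> Hom C W X. \<forall>v \<in> Hom C W X. f \<cdot>\<^bsub>C\<^esub> u = f \<cdot>\<^bsub>C\<^esub> v \<longrightarrow> u = v)"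

definition is_epi :: "('o, 'm, 'z) category_data_scheme \<Rightarrow> 'o \<Rightarrow> 'o \<Rightarrow> 'm \<Rightarrow> bool" where
  "is_epi C X Y f \<longleftrightarrow>
    f \<in> Hom C X Y \<and>
    (\<forall>W \<in> Ob C. \<forall>u \<in> Hom C Y W. \<forall>v \<in> Hom C Y W. u \<cdot>\<^bsub>C\<^esub> f = v \<cdot>\<^bsub>C\<^esub> f \<longrightarrow> u = v)"

text \<open>
  Freyd's definition: being abelian is a property of the category, and the additive structure is
  determined by it. A \<open>k\<close>-linear abelian category is an abelian category that is \<open>k\<close>-linear.
\<close>

definition abelian_category :: "('o, 'm, 'z) category_data_scheme \<Rightarrow> bool" where
  "abelian_category C \<longleftrightarrow>
    category C \<and>
    (\<exists>Z. zero_object C Z) \<and>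
    (\<forall>X \<in> Ob C. \<forall>Y \<in> Ob C. \<exists>P p. is_product C UNIV (\<lambda>b::bool. if b then X else Y) P p) \<and>
    (\<forall>X \<in> Ob C. \<forall>Y \<in> Ob C. \<exists>S j. is_coproduct C UNIV (\<lambda>b::bool. if b then X else Y) S j) \<and>
    (\<forall>X \<in> Ob C. \<forall>Y \<in> Ob C. \<forall>f \<in> Hom C X Y.
      (\<exists>K i. is_kernel C X Y f K i) \<and> (\<exists>Q q. is_cokernel C X Y f Q q)) \<and>
    (\<forall>X \<in> Ob C. \<forall>Y \<in> Ob C. \<forall>f. is_mono C X Y f \<longrightarrow>
      (\<exists>Z \<in> Ob C. \<exists>g \<in> Hom C Y Z. is_kernel C Y Z g X f)) \<and>
    (\<forall>X \<in> Ob C. \<forall>Y \<in> Ob C. \<forall>f. is_epi C X Y f \<longrightarrow>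
      (\<exists>Z \<in> Ob C. \<exists>g \<in> Hom C Z X. is_cokernel C Z X g Y f))"

definition full_subcategory ::
  "('o, 'm, 'z) category_data_scheme \<Rightarrow> 'o set \<Rightarrow> ('o, 'm, 'z) category_data_scheme" where
  "full_subcategory C A = C\<lparr>Ob := A\<rparr>"

definition coproduct_decomposition ::
  "'g set \<Rightarrow> ('o, 'm, 'z) category_data_scheme \<Rightarrow> ('g \<Rightarrow> 'o set) \<Rightarrow> bool" where
  "coproduct_decomposition I C A \<longleftrightarrow>
    Ob C = (\<Union>g \<in> I. A g) \<and>
    (\<forall>g \<in> I. \<forall>h \<in> I. g \<noteq> h \<longrightarrow>
      A g \<inter> A h = {} \<and> (\<forall>X \<in> A g. \<forall>Y \<in> A h. Hom C X Y = {}))"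

text \<open>
  The coproduct of (\<open>k\<close>-linear) abelian categories \<open>C\<^sub>g\<close> consists of the finitely supported families
  of objects. Internally: full abelian subcategories \<open>C\<^sub>g\<close> of \<open>C\<close>, with only zero morphisms between
  different ones, such that every object of \<open>C\<close> is a finite direct sum of objects \<open>Y\<^sub>g \<in> C\<^sub>g\<close>. The
  \<open>C\<^sub>g\<close> are closed under isomorphism, as they automatically are in the preceding case; here every
  zero object lies in all of them. If \<open>C\<close> is \<open>k\<close>-linear, the \<open>C\<^sub>g\<close> inherit this structure.
\<close>

definition abelian_coproduct_decomposition ::
  "'g set \<Rightarrow> ('o, 'm, 'z) category_data_scheme \<Rightarrow> ('g \<Rightarrow> 'o set) \<Rightarrow> bool" where
  "abelian_coproduct_decomposition I C A \<longleftrightarrow>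
    abelian_category C \<and>
    (\<forall>g \<in> I. A g \<subseteq> Ob C \<and> abelian_category (full_subcategory C (A g)) \<and>
      (\<forall>X \<in> A g. \<forall>Y \<in> Ob C. \<forall>f. is_iso C X Y f \<longrightarrow> Y \<in> A g)) \<and>
    (\<forall>g \<in> I. \<forall>h \<in> I. g \<noteq> h \<longrightarrow>
      (\<forall>X \<in> A g. \<forall>Y \<in> A h. \<forall>f \<in> Hom C X Y. zero_morphism C X Y f)) \<and>
    (\<forall>X \<in> Ob C. \<exists>S Y p j. finite S \<and> S \<subseteq> I \<and> (\<forall>g \<in> S. Y g \<in> A g) \<and>
      is_direct_sum C S Y X p j)"


section \<open>\<open>G\<close>-crossed monoidal categories\<close>

text \<open>
  The flag \<open>ab\<close> says in which sense the grading is a coproduct: of (\<open>k\<close>-linear) abelian categories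
  if \<open>ab\<close> is true, of plain categories if \<open>ab\<close> is false.
\<close>

locale graded_monoidal_category = group G + monoidal_category C
  for ab :: bool and G :: "('g, 'b) monoid_scheme" and C :: "('o, 'm, 'g, 'z) crossed_data_scheme" +
  assumes decomposition:
      "if ab then abelian_coproduct_decomposition (carrier G) C (component C)
       else coproduct_decomposition (carrier G) C (component C)"
    and unit_component: "unit_ob C \<in> component C \<one>\<^bsub>G\<^esub>"
    and tensor_component:
      "\<lbrakk>g \<in> carrier G; h \<in> carrier G; X \<in> component C g; Y \<in> component C h\<rbrakk>
        \<Longrightarrow> X \<otimes>\<^sub>o\<^bsub>C\<^esub> Y \<in> component C (g \<otimes>\<^bsub>G\<^esub> h)"

locale crossed_monoidal_category =
  graded_monoidal_category ab G C + monoidal_G_category G C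
  for ab :: bool and G :: "('g, 'b) monoid_scheme" and C :: "('o, 'm, 'g, 'z) crossed_data_scheme" +
  assumes act_component:
    "\<lbrakk>g \<in> carrier G; h \<in> carrier G; X \<in> component C h\<rbrakk>
      \<Longrightarrow> act_ob C g X \<in> component C (g \<otimes>\<^bsub>G\<^esub> h \<otimes>\<^bsub>G\<^esub> inv\<^bsub>G\<^esub> g)"

definition strict_crossed_monoidal_category ::
  "bool \<Rightarrow> ('g, 'b) monoid_scheme \<Rightarrow> ('o, 'm, 'g, 'z) crossed_data_scheme \<Rightarrow> bool" where
  "strict_crossed_monoidal_category ab G C \<longleftrightarrow>
    crossed_monoidal_category ab G C \<and> strict_action G C"

definition crossed_functor ::
  "('g, 'b) monoid_scheme \<Rightarrow> ('o, 'm, 'g, 'y) crossed_data_scheme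
    \<Rightarrow> ('p, 'n, 'g, 'z) crossed_data_scheme \<Rightarrow> ('o, 'm, 'p, 'n) monoidal_functor_data
    \<Rightarrow> ('g \<Rightarrow> 'o \<Rightarrow> 'n) \<Rightarrow> bool" where
  "crossed_functor G C D F \<eta> \<longleftrightarrow>
    monoidal_G_functor G C D F \<eta> \<and>
    (\<forall>g \<in> carrier G. \<forall>X \<in> component C g. obmap F X \<in> component D g)"

definition crossed_equivalence ::
  "('g, 'b) monoid_scheme \<Rightarrow> ('o, 'm, 'g, 'y) crossed_data_scheme
    \<Rightarrow> ('p, 'n, 'g, 'z) crossed_data_scheme \<Rightarrow> ('o, 'm, 'p, 'n) monoidal_functor_data
    \<Rightarrow> ('g \<Rightarrow> 'o \<Rightarrow> 'n) \<Rightarrow> bool" where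
  "crossed_equivalence G C D F \<eta> \<longleftrightarrow> crossed_functor G C D F \<eta> \<and> category_equivalence C D F"

definition crossed_equivalent ::
  "('g, 'b) monoid_scheme \<Rightarrow> ('o, 'm, 'g, 'y) crossed_data_scheme
    \<Rightarrow> ('p, 'n, 'g, 'z) crossed_data_scheme \<Rightarrow> bool" where
  "crossed_equivalent G C D \<longleftrightarrow> (\<exists>F \<eta>. crossed_equivalence G C D F \<eta>)"


section \<open>Linear structures\<close>

text \<open>A \<open>k\<close>-linear structure \<open>V\<close> on \<open>C\<close> makes each \<open>Hom C X Y\<close> the carrier of a \<open>k\<close>-module \<open>V X Y\<close>.\<close>

locale k_linear_category = cring K + category C
  for K :: "('k, 'b) ring_scheme" and V :: "'o \<Rightarrow> 'o \<Rightarrow> ('k, 'm, 'v) module_scheme"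
    and C :: "('o, 'm, 'z) category_data_scheme" +
  assumes Hom_module: "\<lbrakk>X \<in> Ob C; Y \<in> Ob C\<rbrakk> \<Longrightarrow> module K (V X Y) \<and> carrier (V X Y) = Hom C X Y"
    and comp_add_left:
      "\<lbrakk>X \<in> Ob C; Y \<in> Ob C; Z \<in> Ob C; f \<in> Hom C X Y; g \<in> Hom C Y Z; g' \<in> Hom C Y Z\<rbrakk>
        \<Longrightarrow> (g \<oplus>\<^bsub>V Y Z\<^esub> g') \<cdot>\<^bsub>C\<^esub> f = (g \<cdot>\<^bsub>C\<^esub> f) \<oplus>\<^bsub>V X Z\<^esub> (g' \<cdot>\<^bsub>C\<^esub> f)"
    and comp_add_right:
      "\<lbrakk>X \<in> Ob C; Y \<in> Ob C; Z \<in> Ob C; f \<in> Hom C X Y; f' \<in> Hom C X Y; g \<in> Hom C Y Z\<rbrakk>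
        \<Longrightarrow> g \<cdot>\<^bsub>C\<^esub> (f \<oplus>\<^bsub>V X Y\<^esub> f') = (g \<cdot>\<^bsub>C\<^esub> f) \<oplus>\<^bsub>V X Z\<^esub> (g \<cdot>\<^bsub>C\<^esub> f')"
    and comp_smult_left:
      "\<lbrakk>a \<in> carrier K; X \<in> Ob C; Y \<in> Ob C; Z \<in> Ob C; f \<in> Hom C X Y; g \<in> Hom C Y Z\<rbrakk>
        \<Longrightarrow> (a \<odot>\<^bsub>V Y Z\<^esub> g) \<cdot>\<^bsub>C\<^esub> f = a \<odot>\<^bsub>V X Z\<^esub> (g \<cdot>\<^bsub>C\<^esub> f)"
    and comp_smult_right:
      "\<lbrakk>a \<in> carrier K; X \<in> Ob C; Y \<in> Ob C; Z \<in> Ob C; f \<in> Hom C X Y; g \<in> Hom C Y Z\<rbrakk>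
        \<Longrightarrow> g \<cdot>\<^bsub>C\<^esub> (a \<odot>\<^bsub>V X Y\<^esub> f) = a \<odot>\<^bsub>V X Z\<^esub> (g \<cdot>\<^bsub>C\<^esub> f)"

definition k_linear_functor ::
  "('k, 'b) ring_scheme \<Rightarrow> ('o \<Rightarrow> 'o \<Rightarrow> ('k, 'm, 'v) module_scheme)
    \<Rightarrow> ('o, 'm, 'y) category_data_scheme \<Rightarrow> ('p \<Rightarrow> 'p \<Rightarrow> ('k, 'n, 'w) module_scheme)
    \<Rightarrow> ('p, 'n, 'z) category_data_scheme \<Rightarrow> ('o, 'm, 'p, 'n, 'x) functor_data_scheme \<Rightarrow> bool" where
  "k_linear_functor K V C W D F \<longleftrightarrow>
    is_functor C D F \<and>
    (\<forall>X \<in> Ob C. \<forall>Y \<in> Ob C. \<forall>f \<in> Hom C X Y.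
      (\<forall>f' \<in> Hom C X Y. mormap F (f \<oplus>\<^bsub>V X Y\<^esub> f')
        = mormap F f \<oplus>\<^bsub>W (obmap F X) (obmap F Y)\<^esub> mormap F f') \<and>
      (\<forall>a \<in> carrier K. mormap F (a \<odot>\<^bsub>V X Y\<^esub> f)
        = a \<odot>\<^bsub>W (obmap F X) (obmap F Y)\<^esub> mormap F f))"

definition k_linear_action ::
  "('k, 'a) ring_scheme \<Rightarrow> ('o \<Rightarrow> 'o \<Rightarrow> ('k, 'm, 'v) module_scheme) \<Rightarrow> ('g, 'b) monoid_scheme
    \<Rightarrow> ('o, 'm, 'g, 'z) crossed_data_scheme \<Rightarrow> bool" where
  "k_linear_action K V G C \<longleftrightarrow>
    k_linear_category K V C \<and> (\<forall>g \<in> carrier G. k_linear_functor K V C V C (act C g))"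

definition k_linear_crossed_equivalent ::
  "('k, 'a) ring_scheme \<Rightarrow> ('g, 'b) monoid_scheme
    \<Rightarrow> ('o \<Rightarrow> 'o \<Rightarrow> ('k, 'm, 'v) module_scheme) \<Rightarrow> ('o, 'm, 'g, 'y) crossed_data_scheme
    \<Rightarrow> ('p \<Rightarrow> 'p \<Rightarrow> ('k, 'n, 'w) module_scheme) \<Rightarrow> ('p, 'n, 'g, 'z) crossed_data_scheme \<Rightarrow> bool" where
  "k_linear_crossed_equivalent K G V C W D \<longleftrightarrow>
    (\<exists>F \<eta>. crossed_equivalence G C D F \<eta> \<and> k_linear_functor K V C W D F)"


section \<open>The category \<open>C(G)\<close>\<close>

text \<open>Families indexed by \<open>G\<close> are extensional functions, so that equal families are equal functions.\<close>

type_synonym ('g, 'o, 'm) family_ob = "('g \<Rightarrow> 'o) \<times> ('g \<times> 'g \<Rightarrow> 'm)"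

definition family_obs ::
  "('g, 'b) monoid_scheme \<Rightarrow> ('o, 'm, 'g, 'z) crossed_data_scheme \<Rightarrow> ('g, 'o, 'm) family_ob set" where
  "family_obs G C = {(L, \<eta>).
    L \<in> carrier G \<rightarrow>\<^sub>E Ob C \<and> \<eta> \<in> extensional (carrier G \<times> carrier G) \<and>
    (\<forall>g \<in> carrier G. \<forall>h \<in> carrier G. is_iso C (act_ob C g (L h)) (L (g \<otimes>\<^bsub>G\<^esub> h)) (\<eta> (g, h))) \<and>
    (\<forall>g \<in> carrier G. \<eta> (\<one>\<^bsub>G\<^esub>, g) = Id C (L g)) \<and>
    (\<forall>g \<in> carrier G. \<forall>h \<in> carrier G. \<forall>k \<in> carrier G.
      \<eta> (g \<otimes>\<^bsub>G\<^esub> h, k) = \<eta> (g, h \<otimes>\<^bsub>G\<^esub> k) \<cdot>\<^bsub>C\<^esub> act_mor C g (\<eta> (h, k)) \<cdot>\<^bsub>C\<^esub> phi C g h (L k))}"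

definition family_hom ::
  "('g, 'b) monoid_scheme \<Rightarrow> ('o, 'm, 'g, 'z) crossed_data_scheme
    \<Rightarrow> ('g, 'o, 'm) family_ob \<Rightarrow> ('g, 'o, 'm) family_ob \<Rightarrow> ('g \<Rightarrow> 'm) set" where
  "family_hom G C = (\<lambda>(L, \<eta>) (T, \<chi>).
    {f \<in> (\<Pi>\<^sub>E g \<in> carrier G. Hom C (L g) (T g)).
      \<forall>g \<in> carrier G. \<forall>h \<in> carrier G.
        f (g \<otimes>\<^bsub>G\<^esub> h) \<cdot>\<^bsub>C\<^esub> \<eta> (g, h) = \<chi> (g, h) \<cdot>\<^bsub>C\<^esub> act_mor C g (f h)})"

definition family_id ::
  "('g, 'b) monoid_scheme \<Rightarrow> ('o, 'm, 'g, 'z) crossed_data_scheme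
    \<Rightarrow> ('g, 'o, 'm) family_ob \<Rightarrow> 'g \<Rightarrow> 'm" where
  "family_id G C = (\<lambda>(L, \<eta>). \<lambda>g \<in> carrier G. Id C (L g))"

definition family_tensor ::
  "('g, 'b) monoid_scheme \<Rightarrow> ('o, 'm, 'g, 'z) crossed_data_scheme
    \<Rightarrow> ('g, 'o, 'm) family_ob \<Rightarrow> ('g, 'o, 'm) family_ob \<Rightarrow> ('g, 'o, 'm) family_ob" where
  "family_tensor G C = (\<lambda>(L, \<eta>) (L', \<eta>').
    (\<lambda>g \<in> carrier G. L g \<otimes>\<^sub>o\<^bsub>C\<^esub> L' g,
     \<lambda>(g, h) \<in> carrier G \<times> carrier G.
       (\<eta> (g, h) \<otimes>\<^sub>m\<^bsub>C\<^esub> \<eta>' (g, h)) \<cdot>\<^bsub>C\<^esub> psi C g (L h) (L' h)))"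

definition family_act ::
  "('g, 'b) monoid_scheme \<Rightarrow> 'g \<Rightarrow> ('g, 'o, 'm) family_ob \<Rightarrow> ('g, 'o, 'm) family_ob" where
  "family_act G g = (\<lambda>(L, \<eta>).
    (\<lambda>h \<in> carrier G. L (h \<otimes>\<^bsub>G\<^esub> g),
     \<lambda>(x, y) \<in> carrier G \<times> carrier G. \<eta> (x, y \<otimes>\<^bsub>G\<^esub> g)))"

definition family_category ::
  "('g, 'b) monoid_scheme \<Rightarrow> ('o, 'm, 'g, 'z) crossed_data_scheme
    \<Rightarrow> (('g, 'o, 'm) family_ob, 'g \<Rightarrow> 'm, 'g) crossed_data" where
  "family_category G C =
    \<lparr>Ob = family_obs G C,
     Hom = family_hom G C,
     Comp = (\<lambda>f' f. \<lambda>g \<in> carrier G. f' g \<cdot>\<^bsub>C\<^esub> f g),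
     Id = family_id G C,
     tensor_ob = family_tensor G C,
     tensor_mor = (\<lambda>f l. \<lambda>g \<in> carrier G. f g \<otimes>\<^sub>m\<^bsub>C\<^esub> l g),
     unit_ob = (\<lambda>g \<in> carrier G. unit_ob C, \<lambda>(g, h) \<in> carrier G \<times> carrier G. Id C (unit_ob C)),
     act_ob = family_act G,
     act_mor = (\<lambda>g f. \<lambda>h \<in> carrier G. f (h \<otimes>\<^bsub>G\<^esub> g)),
     phi = (\<lambda>g h X. family_id G C (family_act G (g \<otimes>\<^bsub>G\<^esub> h) X)),
     psi = (\<lambda>g X Y. family_id G C (family_act G g (family_tensor G C X Y))),
     component = (\<lambda>g. {(L, \<eta>) \<in> family_obs G C. L \<one>\<^bsub>G\<^esub> \<in> component C g})\<rparr>"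

text \<open>
  The componentwise \<open>k\<close>-linear structure. The fields \<open>mult\<close> and \<open>one\<close> of the library's module record
  play no role.
\<close>

definition family_linear ::
  "('g, 'b) monoid_scheme \<Rightarrow> ('o \<Rightarrow> 'o \<Rightarrow> ('k, 'm, 'v) module_scheme)
    \<Rightarrow> ('o, 'm, 'g, 'z) crossed_data_scheme
    \<Rightarrow> ('g, 'o, 'm) family_ob \<Rightarrow> ('g, 'o, 'm) family_ob \<Rightarrow> ('k, 'g \<Rightarrow> 'm) module" where
  "family_linear G V C = (\<lambda>(L, \<eta>) (T, \<chi>).
    \<lparr>carrier = family_hom G C (L, \<eta>) (T, \<chi>),
     mult = undefined,
     one = undefined,
     zero = (\<lambda>g \<in> carrier G. \<zero>\<^bsub>V (L g) (T g)\<^esub>),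
     add = (\<lambda>f f'. \<lambda>g \<in> carrier G. f g \<oplus>\<^bsub>V (L g) (T g)\<^esub> f' g),
     smult = (\<lambda>a f. \<lambda>g \<in> carrier G. a \<odot>\<^bsub>V (L g) (T g)\<^esub> f g)\<rparr>)"

end

theory Submission
  imports Defs
begin

text \<open>
  The equivalence from the category of families to \<open>C\<close> evaluates a family at the unit \<open>e\<close> of the
  group. A family \<open>(L, \<eta>)\<close> is an object \<open>L\<^sub>e\<close> together with a coherent choice of models \<open>L\<^sub>g\<close> of
  its translates \<open>g\<^sub>*(L\<^sub>e)\<close>, the identification being \<open>\<eta>\<^sub>g\<^sub>,\<^sub>e\<close>. Such a choice carries no
  information: an arrow between families is determined by its component at \<open>e\<close>, and every
  arrow between the values at \<open>e\<close> extends by \<open>f\<^sub>g = \<chi>\<^sub>g\<^sub>,\<^sub>e \<cdot> g\<^sub>*(f\<^sub>e) \<cdot> \<eta>\<^sub>g\<^sub>,\<^sub>e\<^sup>-\<^sup>1\<close> (\<open>eval_faithful\<close>,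
  \<open>eval_full\<close>). Evaluation is also surjective on objects: an object \<open>X\<close> is the value of
  its orbit \<open>g \<mapsto> g\<^sub>*(X)\<close>, where \<open>\<eta>\<^sub>g\<^sub>,\<^sub>h\<close> is the inverse of \<open>\<phi>(g, h)\<close> (\<open>orbit_obs\<close>).

  The choice buys strictness. On families, \<open>g\<close> acts by right translation of the index, which
  is strictly associative and strictly compatible with the componentwise tensor product
  (\<open>strict_action_family\<close>); the isomorphisms \<open>\<phi>\<close> and \<open>\<psi>\<close> of \<open>C\<close> only enter the definition of
  the objects. That these objects are closed under tensor products amounts to the coherence of
  \<open>\<phi>\<close> and \<open>\<psi>\<close> (\<open>family_tensor_obs\<close>, \<open>family_tensor_assoc\<close>), together with the triviality of
  \<open>\<psi>\<^sup>e\<close> and of \<open>\<phi>(g, h)\<close> at the unit object, which follows because these isomorphisms are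
  idempotent (\<open>psi_one\<close>, \<open>phi_unit\<close>). Evaluation is compatible with the actions through
  \<open>\<eta>\<^sub>g\<^sub>,\<^sub>e\<close> (\<open>eval_monoidal_G_functor\<close>).

  The grading of families is the preimage of the grading of \<open>C\<close> under evaluation. Since evaluation
  is fully faithful and surjective on objects, all categorical structure expressed by universal
  properties, in particular being abelian and being a coproduct of abelian subcategories, lifts
  along it (\<open>abelian_coproduct_decomposition_lift\<close>). The linear structure is
  componentwise; conditions on arrows of families are linear because composition and each \<open>g\<^sub>*\<close> are
  (\<open>k_linear_category_family\<close>).
\<close>


section \<open>Arrows and isomorphisms\<close>

text \<open>
  Membership in a Hom-set says nothing about the objects. Bundling both is what makes the rules for
  composition usable without repeating six or more side conditions.
\<close>
definition arr :: "('o, 'm, 'z) category_data_scheme \<Rightarrow> 'o \<Rightarrow> 'o \<Rightarrow> 'm \<Rightarrow> bool" where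
  "arr C X Y f \<longleftrightarrow> X \<in> Ob C \<and> Y \<in> Ob C \<and> f \<in> Hom C X Y"

text \<open>
  A chosen inverse of \<open>f\<close>, meaningful if \<open>f\<close> is an isomorphism from \<open>X\<close> to \<open>Y\<close>; as Hom-sets
  may overlap, it depends on the source and target, which are therefore arguments.
\<close>
definition inverse_arrow :: "('o, 'm, 'z) category_data_scheme \<Rightarrow> 'o \<Rightarrow> 'o \<Rightarrow> 'm \<Rightarrow> 'm" where
  "inverse_arrow C X Y f =
    (SOME g. g \<in> Hom C Y X \<and> g \<cdot>\<^bsub>C\<^esub> f = Id C X \<and> f \<cdot>\<^bsub>C\<^esub> g = Id C Y)"

lemma arr_Hom: "arr C X Y f \<Longrightarrow> f \<in> Hom C X Y"
  by (simp add: arr_def)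

lemma arr_source: "arr C X Y f \<Longrightarrow> X \<in> Ob C"
  by (simp add: arr_def)

lemma arr_target: "arr C X Y f \<Longrightarrow> Y \<in> Ob C"
  by (simp add: arr_def)

lemma is_iso_Hom: "is_iso C X Y f \<Longrightarrow> f \<in> Hom C X Y"
  by (simp add: is_iso_def)

lemma is_iso_arr: "\<lbrakk>is_iso C X Y f; X \<in> Ob C; Y \<in> Ob C\<rbrakk> \<Longrightarrow> arr C X Y f"
  by (simp add: arr_def is_iso_Hom)

lemma
  assumes "is_iso C X Y f"
  shows inverse_arrow_Hom: "inverse_arrow C X Y f \<in> Hom C Y X"
    and inverse_arrow_left: "inverse_arrow C X Y f \<cdot>\<^bsub>C\<^esub> f = Id C X"
    and inverse_arrow_right: "f \<cdot>\<^bsub>C\<^esub> inverse_arrow C X Y f = Id C Y"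
proof -
  have "\<exists>g. g \<in> Hom C Y X \<and> g \<cdot>\<^bsub>C\<^esub> f = Id C X \<and> f \<cdot>\<^bsub>C\<^esub> g = Id C Y"
    using assms by (auto simp: is_iso_def)
  from someI_ex[OF this]
  show "inverse_arrow C X Y f \<in> Hom C Y X" "inverse_arrow C X Y f \<cdot>\<^bsub>C\<^esub> f = Id C X"
    "f \<cdot>\<^bsub>C\<^esub> inverse_arrow C X Y f = Id C Y"
    by (auto simp: inverse_arrow_def)
qed

lemma is_iso_inverse_arrow: "is_iso C X Y f \<Longrightarrow> is_iso C Y X (inverse_arrow C X Y f)"
  unfolding is_iso_def[of C Y X]
  using inverse_arrow_Hom inverse_arrow_left inverse_arrow_right is_iso_Hom by metis

lemma inverse_arrow_arr:
  "\<lbrakk>is_iso C X Y f; X \<in> Ob C; Y \<in> Ob C\<rbrakk> \<Longrightarrow> arr C Y X (inverse_arrow C X Y f)"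
  by (simp add: arr_def inverse_arrow_Hom)

context category
begin

lemma arr_Id: "X \<in> Ob C \<Longrightarrow> arr C X X (Id C X)"
  by (simp add: arr_def Id_in_Hom)

lemma arr_comp: "\<lbrakk>arr C X Y f; arr C Y Z g\<rbrakk> \<Longrightarrow> arr C X Z (g \<cdot>\<^bsub>C\<^esub> f)"
  unfolding arr_def using comp_in_Hom by blast

lemma assoc:
  "\<lbrakk>arr C W X f; arr C X Y g; arr C Y Z h\<rbrakk> \<Longrightarrow> (h \<cdot>\<^bsub>C\<^esub> g) \<cdot>\<^bsub>C\<^esub> f = h \<cdot>\<^bsub>C\<^esub> (g \<cdot>\<^bsub>C\<^esub> f)"
  unfolding arr_def using comp_assoc by blast

lemma Id_right: "arr C X Y f \<Longrightarrow> f \<cdot>\<^bsub>C\<^esub> Id C X = f"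
  unfolding arr_def using comp_Id_right by blast

lemma Id_left: "arr C X Y f \<Longrightarrow> Id C Y \<cdot>\<^bsub>C\<^esub> f = f"
  unfolding arr_def using comp_Id_left by blast

lemma is_iso_Id: "X \<in> Ob C \<Longrightarrow> is_iso C X X (Id C X)"
  unfolding is_iso_def using Id_in_Hom Id_left[OF arr_Id] by blast

text \<open>
  Composition is total on bare morphisms, so that cancellation needs both sides of the equation to
  be composites of arrows with the same source and target.
\<close>
lemma iso_cancel_right:
  assumes "is_iso C X Y f" "X \<in> Ob C" "arr C Y Z u" "arr C Y Z v" "u \<cdot>\<^bsub>C\<^esub> f = v \<cdot>\<^bsub>C\<^esub> f"
  shows "u = v"
proof -
  let ?i = "inverse_arrow C X Y f"
  have f: "arr C X Y f" and i: "arr C Y X ?i"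
    using assms is_iso_arr inverse_arrow_arr arr_source by metis+
  have "w = (w \<cdot>\<^bsub>C\<^esub> f) \<cdot>\<^bsub>C\<^esub> ?i" if "arr C Y Z w" for w
    using assoc[OF i f that] inverse_arrow_right[OF assms(1)] Id_right[OF that] by simp
  then show ?thesis using assms by metis
qed

lemma is_iso_comp:
  assumes f: "is_iso C X Y f" and g: "is_iso C Y Z g" and ob: "X \<in> Ob C" "Y \<in> Ob C" "Z \<in> Ob C"
  shows "is_iso C X Z (g \<cdot>\<^bsub>C\<^esub> f)"
proof -
  let ?f = "inverse_arrow C X Y f" and ?g = "inverse_arrow C Y Z g"
  note a = is_iso_arr[OF f ob(1,2)] is_iso_arr[OF g ob(2,3)]
    inverse_arrow_arr[OF f ob(1,2)] inverse_arrow_arr[OF g ob(2,3)]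
  have "(?f \<cdot>\<^bsub>C\<^esub> ?g) \<cdot>\<^bsub>C\<^esub> (g \<cdot>\<^bsub>C\<^esub> f) = ?f \<cdot>\<^bsub>C\<^esub> ((?g \<cdot>\<^bsub>C\<^esub> g) \<cdot>\<^bsub>C\<^esub> f)"
    using assoc[OF arr_comp[OF a(1,2)] a(4,3)] assoc[OF a(1,2,4)] by simp
  moreover have "(g \<cdot>\<^bsub>C\<^esub> f) \<cdot>\<^bsub>C\<^esub> (?f \<cdot>\<^bsub>C\<^esub> ?g) = g \<cdot>\<^bsub>C\<^esub> ((f \<cdot>\<^bsub>C\<^esub> ?f) \<cdot>\<^bsub>C\<^esub> ?g)"
    using assoc[OF arr_comp[OF a(4,3)] a(1,2)] assoc[OF a(4,3,1)] by simp
  ultimately show ?thesis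
    unfolding is_iso_def
    using arr_comp[OF a(1,2)] arr_comp[OF a(4,3)] Id_left[OF a(1)] Id_left[OF a(4)]
      inverse_arrow_left[OF f] inverse_arrow_left[OF g]
      inverse_arrow_right[OF f] inverse_arrow_right[OF g]
    by (auto simp: arr_def)
qed

text \<open>
  This turns coherence axioms with trivial group elements or trivial objects into
  normalizations: such an axiom typically says that a structure isomorphism is idempotent.
\<close>
lemma idempotent_iso_is_Id:
  assumes "is_iso C X X f" "X \<in> Ob C" "f \<cdot>\<^bsub>C\<^esub> f = f"
  shows "f = Id C X"
  using iso_cancel_right[OF assms(1,2), of X f "Id C X"] assms
  by (simp add: is_iso_arr arr_Id Id_left[OF is_iso_arr])

text \<open>
  Most identities about families of arrows say that a square commutes: those for a composite arrow
  and for a tensor product are obtained by putting two such squares side by side.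
\<close>
lemma paste_squares:
  assumes "arr C A B f" "arr C B E g" "arr C A A' a" "arr C B B' b" "arr C E E' c"
    and "arr C A' B' f'" "arr C B' E' g'"
    and "b \<cdot>\<^bsub>C\<^esub> f = f' \<cdot>\<^bsub>C\<^esub> a" "c \<cdot>\<^bsub>C\<^esub> g = g' \<cdot>\<^bsub>C\<^esub> b"
  shows "c \<cdot>\<^bsub>C\<^esub> (g \<cdot>\<^bsub>C\<^esub> f) = (g' \<cdot>\<^bsub>C\<^esub> f') \<cdot>\<^bsub>C\<^esub> a"
proof -
  have "c \<cdot>\<^bsub>C\<^esub> (g \<cdot>\<^bsub>C\<^esub> f) = (g' \<cdot>\<^bsub>C\<^esub> b) \<cdot>\<^bsub>C\<^esub> f"
    using assoc[OF assms(1,2,5)] assms by simp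
  also have "\<dots> = g' \<cdot>\<^bsub>C\<^esub> (f' \<cdot>\<^bsub>C\<^esub> a)"
    using assoc[OF assms(1,4,7)] assms by simp
  also have "\<dots> = (g' \<cdot>\<^bsub>C\<^esub> f') \<cdot>\<^bsub>C\<^esub> a"
    using assoc[OF assms(3,6,7)] by simp
  finally show ?thesis .
qed

end

lemma functor_Ob: "\<lbrakk>is_functor C D F; X \<in> Ob C\<rbrakk> \<Longrightarrow> obmap F X \<in> Ob D"
  by (simp add: is_functor_def)

lemma functor_arr: "\<lbrakk>is_functor C D F; arr C X Y f\<rbrakk> \<Longrightarrow> arr D (obmap F X) (obmap F Y) (mormap F f)"
  by (simp add: is_functor_def arr_def)

lemma functor_Id: "\<lbrakk>is_functor C D F; X \<in> Ob C\<rbrakk> \<Longrightarrow> mormap F (Id C X) = Id D (obmap F X)"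
  by (simp add: is_functor_def)

lemma functor_comp:
  "\<lbrakk>is_functor C D F; arr C X Y f; arr C Y Z g\<rbrakk>
    \<Longrightarrow> mormap F (g \<cdot>\<^bsub>C\<^esub> f) = mormap F g \<cdot>\<^bsub>D\<^esub> mormap F f"
  unfolding is_functor_def arr_def by blast

lemma functor_iso:
  assumes F: "is_functor C D F" and f: "is_iso C X Y f" and ob: "X \<in> Ob C" "Y \<in> Ob C"
  shows "is_iso D (obmap F X) (obmap F Y) (mormap F f)"
proof -
  note a = is_iso_arr[OF f ob] inverse_arrow_arr[OF f ob]
  show ?thesis
    unfolding is_iso_def
    using functor_arr[OF F a(1)] functor_arr[OF F a(2)] functor_comp[OF F a] functor_comp[OF F a(2,1)]
      functor_Id[OF F ob(1)] functor_Id[OF F ob(2)] inverse_arrow_left[OF f] inverse_arrow_right[OF f]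
    by (auto simp: arr_def)
qed

context monoidal_category
begin

lemma arr_tensor:
  "\<lbrakk>arr C X Y f; arr C X' Y' f'\<rbrakk> \<Longrightarrow> arr C (X \<otimes>\<^sub>o\<^bsub>C\<^esub> X') (Y \<otimes>\<^sub>o\<^bsub>C\<^esub> Y') (f \<otimes>\<^sub>m\<^bsub>C\<^esub> f')"
  by (simp add: arr_def tensor_Ob tensor_Hom)

lemma interchange:
  "\<lbrakk>arr C X Y f; arr C Y Z g; arr C X' Y' f'; arr C Y' Z' g'\<rbrakk>
    \<Longrightarrow> (g \<cdot>\<^bsub>C\<^esub> f) \<otimes>\<^sub>m\<^bsub>C\<^esub> (g' \<cdot>\<^bsub>C\<^esub> f') = (g \<otimes>\<^sub>m\<^bsub>C\<^esub> g') \<cdot>\<^bsub>C\<^esub> (f \<otimes>\<^sub>m\<^bsub>C\<^esub> f')"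
  unfolding arr_def using tensor_comp by blast

lemma tensor_assoc:
  "\<lbrakk>arr C X Y f; arr C X' Y' f'; arr C X'' Y'' f''\<rbrakk>
    \<Longrightarrow> (f \<otimes>\<^sub>m\<^bsub>C\<^esub> f') \<otimes>\<^sub>m\<^bsub>C\<^esub> f'' = f \<otimes>\<^sub>m\<^bsub>C\<^esub> (f' \<otimes>\<^sub>m\<^bsub>C\<^esub> f'')"
  unfolding arr_def using tensor_mor_assoc by blast

lemma tensor_unit_left: "arr C X Y f \<Longrightarrow> Id C (unit_ob C) \<otimes>\<^sub>m\<^bsub>C\<^esub> f = f"
  unfolding arr_def using tensor_mor_unit_left by blast

lemma tensor_unit_right: "arr C X Y f \<Longrightarrow> f \<otimes>\<^sub>m\<^bsub>C\<^esub> Id C (unit_ob C) = f"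
  unfolding arr_def using tensor_mor_unit_right by blast

lemma is_iso_tensor:
  assumes f: "is_iso C X Y f" "X \<in> Ob C" "Y \<in> Ob C"
    and f': "is_iso C X' Y' f'" "X' \<in> Ob C" "Y' \<in> Ob C"
  shows "is_iso C (X \<otimes>\<^sub>o\<^bsub>C\<^esub> X') (Y \<otimes>\<^sub>o\<^bsub>C\<^esub> Y') (f \<otimes>\<^sub>m\<^bsub>C\<^esub> f')"
proof -
  note a = is_iso_arr[OF f] inverse_arrow_arr[OF f]
  note a' = is_iso_arr[OF f'] inverse_arrow_arr[OF f']
  show ?thesis
    unfolding is_iso_def
    using arr_tensor[OF a(1) a'(1)] arr_tensor[OF a(2) a'(2)]
      interchange[OF a a'] interchange[OF a(2,1) a'(2,1)] tensor_Id[OF f(2) f'(2)]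
      tensor_Id[OF f(3) f'(3)] inverse_arrow_left[OF f(1)] inverse_arrow_right[OF f(1)]
      inverse_arrow_left[OF f'(1)] inverse_arrow_right[OF f'(1)]
    by (metis arr_Hom)
qed

text \<open>
  The interchange law applied to \<open>f = f \<cdot> 1\<close> and \<open>g = 1 \<cdot> g\<close>, the first half of the
  Eckmann-Hilton argument.
\<close>
lemma tensor_endo_unit:
  assumes "arr C (unit_ob C) (unit_ob C) f" "arr C (unit_ob C) (unit_ob C) g"
  shows "f \<otimes>\<^sub>m\<^bsub>C\<^esub> g = f \<cdot>\<^bsub>C\<^esub> g"
  using interchange[OF arr_Id[OF unit_Ob] assms(1) assms(2) arr_Id[OF unit_Ob]]
  by (simp add: Id_right[OF assms(1)] Id_left[OF assms(2)]
      tensor_unit_right[OF assms(1)] tensor_unit_left[OF assms(2)])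

end


section \<open>Lifting structure along a surjective equivalence\<close>

lemma (in category) category_full_subcategory:
  assumes "A \<subseteq> Ob C"
  shows "category (full_subcategory C A)"
proof -
  have A: "X \<in> Ob C" if "X \<in> A" for X using that assms by blast
  show ?thesis
  proof (unfold_locales, simp_all add: full_subcategory_def)
    show "g \<cdot>\<^bsub>C\<^esub> f \<in> Hom C X Z"
      if "X \<in> A" "Y \<in> A" "Z \<in> A" "f \<in> Hom C X Y" "g \<in> Hom C Y Z" for X Y Z f g
      using comp_in_Hom[OF A A A] that by blast
    show "(h \<cdot>\<^bsub>C\<^esub> g) \<cdot>\<^bsub>C\<^esub> f = h \<cdot>\<^bsub>C\<^esub> (g \<cdot>\<^bsub>C\<^esub> f)"
      if "W \<in> A" "X \<in> A" "Y \<in> A" "Z \<in> A" "f \<in> Hom C W X" "g \<in> Hom C X Y" "h \<in> Hom C Y Z"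
      for W X Y Z f g h
      using comp_assoc[OF A A A A] that by blast
    show "Id C X \<in> Hom C X X" if "X \<in> A" for X
      using Id_in_Hom[OF A] that by blast
    show "f \<cdot>\<^bsub>C\<^esub> Id C X = f" "Id C Y \<cdot>\<^bsub>C\<^esub> f = f" if "X \<in> A" "Y \<in> A" "f \<in> Hom C X Y" for X Y f
      using comp_Id_right[OF A A] comp_Id_left[OF A A] that by blast+
  qed
qed

text \<open>
  Because objects of \<open>C\<close> are hit on the nose, and not only up to isomorphism, a universal
  property in \<open>C\<close> translates literally into one in \<open>D\<close>:
  a quantifier over objects of \<open>C\<close> runs over images, a quantifier over arrows runs over a Hom-set
  in bijection with one of \<open>D\<close>, and no isomorphisms have to be carried along.
\<close>
locale surjective_equivalence = source: category D + target: category C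
  for D :: "('p, 'n, 'y) category_data_scheme" and C :: "('o, 'm, 'z) category_data_scheme" +
  fixes F :: "('p, 'n, 'o, 'm, 'x) functor_data_scheme"
  assumes is_functor: "is_functor D C F"
    and surjective: "Z \<in> Ob C \<Longrightarrow> \<exists>X \<in> Ob D. obmap F X = Z"
    and fully_faithful:
      "\<lbrakk>X \<in> Ob D; Y \<in> Ob D\<rbrakk>
        \<Longrightarrow> bij_betw (mormap F) (Hom D X Y) (Hom C (obmap F X) (obmap F Y))"
begin

lemma F_Ob: "X \<in> Ob D \<Longrightarrow> obmap F X \<in> Ob C"
  using is_functor by (rule functor_Ob)

lemma F_Hom: "\<lbrakk>X \<in> Ob D; Y \<in> Ob D; f \<in> Hom D X Y\<rbrakk> \<Longrightarrow> mormap F f \<in> Hom C (obmap F X) (obmap F Y)"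
  using fully_faithful bij_betwE by blast

lemma F_comp:
  "\<lbrakk>X \<in> Ob D; Y \<in> Ob D; Z \<in> Ob D; f \<in> Hom D X Y; g \<in> Hom D Y Z\<rbrakk>
    \<Longrightarrow> mormap F (g \<cdot>\<^bsub>D\<^esub> f) = mormap F g \<cdot>\<^bsub>C\<^esub> mormap F f"
  using functor_comp[OF is_functor] by (simp add: arr_def)

lemma F_Id: "X \<in> Ob D \<Longrightarrow> mormap F (Id D X) = Id C (obmap F X)"
  using is_functor by (rule functor_Id)

lemma faithful:
  "\<lbrakk>X \<in> Ob D; Y \<in> Ob D; f \<in> Hom D X Y; g \<in> Hom D X Y\<rbrakk> \<Longrightarrow> mormap F f = mormap F g \<longleftrightarrow> f = g"
  using fully_faithful bij_betw_imp_inj_on inj_on_eq_iff by metis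

lemma comp_eq_iff:
  assumes "X \<in> Ob D" "Y \<in> Ob D" "Z \<in> Ob D" "f \<in> Hom D X Y" "g \<in> Hom D Y Z" "h \<in> Hom D X Z"
  shows "g \<cdot>\<^bsub>D\<^esub> f = h \<longleftrightarrow> mormap F g \<cdot>\<^bsub>C\<^esub> mormap F f = mormap F h"
  using faithful[OF assms(1,3) source.comp_in_Hom[OF assms(1-5)] assms(6)] F_comp[OF assms(1-5)]
  by simp

lemma full:
  assumes "X \<in> Ob D" "Y \<in> Ob D" "u \<in> Hom C (obmap F X) (obmap F Y)"
  obtains f where "f \<in> Hom D X Y" "mormap F f = u"
proof -
  have "u \<in> mormap F ` Hom D X Y"
    using fully_faithful[OF assms(1,2)] assms(3) by (simp add: bij_betw_def)
  then show thesis using that by blast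
qed

lemma all_Ob_iff: "(\<forall>Z \<in> Ob C. P Z) \<longleftrightarrow> (\<forall>X \<in> Ob D. P (obmap F X))"
  using F_Ob surjective by blast

lemma lift_family:
  assumes "\<forall>i \<in> I. X i \<in> Ob C"
  obtains X' where "\<forall>i \<in> I. X' i \<in> Ob D \<and> obmap F (X' i) = X i"
proof -
  have "\<forall>i \<in> I. \<exists>X'. X' \<in> Ob D \<and> obmap F X' = X i"
    using assms surjective by blast
  from bchoice[OF this] show thesis using that by blast
qed

lemma lift_Hom_family:
  assumes "\<forall>i \<in> I. X i \<in> Ob D \<and> Y i \<in> Ob D \<and> u i \<in> Hom C (obmap F (X i)) (obmap F (Y i))"
  obtains f where "\<forall>i \<in> I. f i \<in> Hom D (X i) (Y i) \<and> mormap F (f i) = u i"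
proof -
  have "\<forall>i \<in> I. \<exists>f. f \<in> Hom D (X i) (Y i) \<and> mormap F f = u i"
    using assms full by metis
  from bchoice[OF this] show thesis using that by blast
qed

text \<open>
  All universal properties below end with the existence of a unique arrow satisfying an equation,
  and a bijection of Hom-sets transports that.
\<close>
lemma unique_arrow_iff:
  assumes "X \<in> Ob D" "Y \<in> Ob D" "\<And>f. f \<in> Hom D X Y \<Longrightarrow> P f \<longleftrightarrow> Q (mormap F f)"
  shows "(\<exists>!f. f \<in> Hom D X Y \<and> P f) \<longleftrightarrow> (\<exists>!u. u \<in> Hom C (obmap F X) (obmap F Y) \<and> Q u)"
  (is "?L \<longleftrightarrow> ?R")
proof
  assume ?L
  then obtain f where f: "f \<in> Hom D X Y" "P f" and uni: "\<And>f'. f' \<in> Hom D X Y \<Longrightarrow> P f' \<Longrightarrow> f' = f"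
    by blast
  show ?R
  proof (rule ex1I)
    show "mormap F f \<in> Hom C (obmap F X) (obmap F Y) \<and> Q (mormap F f)"
      using f assms F_Hom by blast
    show "u = mormap F f" if "u \<in> Hom C (obmap F X) (obmap F Y) \<and> Q u" for u
      using that full[OF assms(1,2)] uni assms(3) by metis
  qed
next
  assume ?R
  then obtain u where u: "u \<in> Hom C (obmap F X) (obmap F Y)" "Q u"
    and uni: "\<And>v. v \<in> Hom C (obmap F X) (obmap F Y) \<Longrightarrow> Q v \<Longrightarrow> v = u"
    by blast
  obtain f where f: "f \<in> Hom D X Y" "mormap F f = u" using full[OF assms(1,2) u(1)] .
  show ?L
  proof (rule ex1I)
    show "f \<in> Hom D X Y \<and> P f" using f u assms(3) by blast
    show "f' = f" if "f' \<in> Hom D X Y \<and> P f'" for f'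
      using that f uni assms F_Hom faithful by metis
  qed
qed

lemma is_iso_iff:
  assumes "X \<in> Ob D" "Y \<in> Ob D" "f \<in> Hom D X Y"
  shows "is_iso C (obmap F X) (obmap F Y) (mormap F f) \<longleftrightarrow> is_iso D X Y f"
proof
  assume "is_iso D X Y f"
  then show "is_iso C (obmap F X) (obmap F Y) (mormap F f)"
    using functor_iso[OF is_functor] assms by blast
next
  assume "is_iso C (obmap F X) (obmap F Y) (mormap F f)"
  then obtain v where v: "v \<in> Hom C (obmap F Y) (obmap F X)"
    "v \<cdot>\<^bsub>C\<^esub> mormap F f = Id C (obmap F X)" "mormap F f \<cdot>\<^bsub>C\<^esub> v = Id C (obmap F Y)"
    by (auto simp: is_iso_def)
  obtain g where g: "g \<in> Hom D Y X" "mormap F g = v" using full[OF assms(2,1) v(1)] .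
  have "g \<cdot>\<^bsub>D\<^esub> f = Id D X" "f \<cdot>\<^bsub>D\<^esub> g = Id D Y"
    using v g assms comp_eq_iff[of X Y X f g "Id D X"] comp_eq_iff[of Y X Y g f "Id D Y"]
      source.Id_in_Hom F_Id by simp_all
  then show "is_iso D X Y f"
    unfolding is_iso_def using assms g by blast
qed

lemma zero_object_iff:
  assumes "Z \<in> Ob D"
  shows "zero_object D Z \<longleftrightarrow> zero_object C (obmap F Z)"
proof -
  have "(\<exists>!f. f \<in> Hom D X Z) \<longleftrightarrow> (\<exists>!f. f \<in> Hom C (obmap F X) (obmap F Z))"
    "(\<exists>!f. f \<in> Hom D Z X) \<longleftrightarrow> (\<exists>!f. f \<in> Hom C (obmap F Z) (obmap F X))" if "X \<in> Ob D" for X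
    using unique_arrow_iff[OF that assms, of "\<lambda>_. True" "\<lambda>_. True"]
      unique_arrow_iff[OF assms that, of "\<lambda>_. True" "\<lambda>_. True"] by auto
  then show ?thesis
    unfolding zero_object_def all_Ob_iff using assms F_Ob by simp
qed

lemma zero_morphism_iff:
  assumes "X \<in> Ob D" "Y \<in> Ob D" "f \<in> Hom D X Y"
  shows "zero_morphism D X Y f \<longleftrightarrow> zero_morphism C (obmap F X) (obmap F Y) (mormap F f)"
proof
  assume "zero_morphism D X Y f"
  then obtain Z u v where "zero_object D Z" "u \<in> Hom D X Z" "v \<in> Hom D Z Y" "f = v \<cdot>\<^bsub>D\<^esub> u"
    by (auto simp: zero_morphism_def)
  moreover then have "Z \<in> Ob D" by (simp add: zero_object_def)
  ultimately show "zero_morphism C (obmap F X) (obmap F Y) (mormap F f)"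
    unfolding zero_morphism_def using assms F_Hom F_comp zero_object_iff by blast
next
  assume "zero_morphism C (obmap F X) (obmap F Y) (mormap F f)"
  then obtain Z' u' v' where z: "zero_object C Z'" "u' \<in> Hom C (obmap F X) Z'"
    "v' \<in> Hom C Z' (obmap F Y)" "mormap F f = v' \<cdot>\<^bsub>C\<^esub> u'"
    by (auto simp: zero_morphism_def)
  then obtain Z where Z: "Z \<in> Ob D" "obmap F Z = Z'"
    using surjective[of Z'] by (auto simp: zero_object_def)
  obtain u where u: "u \<in> Hom D X Z" "mormap F u = u'" using full[OF assms(1) Z(1)] z Z by metis
  obtain v where v: "v \<in> Hom D Z Y" "mormap F v = v'" using full[OF Z(1) assms(2)] z Z by metis
  have "f = v \<cdot>\<^bsub>D\<^esub> u"
    using assms Z u v z comp_eq_iff[of X Z Y u v f] by simp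
  then show "zero_morphism D X Y f"
    unfolding zero_morphism_def using Z z(1) u v zero_object_iff by blast
qed

text \<open>
  The reflection lemmas allow the data in \<open>C\<close> to agree with the images of the lifted data
  on the index set only, because a lift of a family is chosen on the index set only.
\<close>

lemma product_reflect:
  assumes prod: "is_product C I Y' (obmap F X) p'" and X: "X \<in> Ob D"
    and Y: "\<forall>i \<in> I. Y i \<in> Ob D \<and> obmap F (Y i) = Y' i"
    and p: "\<forall>i \<in> I. p i \<in> Hom D X (Y i) \<and> mormap F (p i) = p' i"
  shows "is_product D I Y X p"
  unfolding is_product_def
proof (intro conjI ballI allI impI)
  fix W f assume W: "W \<in> Ob D" and f: "\<forall>i \<in> I. f i \<in> Hom D W (Y i)"
  have "(\<exists>!u. u \<in> Hom C (obmap F W) (obmap F X) \<and> (\<forall>i \<in> I. p' i \<cdot>\<^bsub>C\<^esub> u = mormap F (f i)))"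
  proof -
    have "\<forall>i\<in>I. mormap F (f i) \<in> Hom C (obmap F W) (Y' i)"
      using F_Hom W f Y by metis
    then show ?thesis using prod F_Ob[OF W] by (auto simp: is_product_def)
  qed
  moreover have "(\<forall>i \<in> I. p i \<cdot>\<^bsub>D\<^esub> u = f i) \<longleftrightarrow> (\<forall>i \<in> I. p' i \<cdot>\<^bsub>C\<^esub> mormap F u = mormap F (f i))"
    if "u \<in> Hom D W X" for u
    using that W X Y p f comp_eq_iff[of W X _ u] by (metis (no_types))
  ultimately show "\<exists>!u. u \<in> Hom D W X \<and> (\<forall>i \<in> I. p i \<cdot>\<^bsub>D\<^esub> u = f i)"
    using unique_arrow_iff[OF W X] by simp
qed (use X Y p in auto)

lemma coproduct_reflect:
  assumes coprod: "is_coproduct C I Y' (obmap F X) j'" and X: "X \<in> Ob D"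
    and Y: "\<forall>i \<in> I. Y i \<in> Ob D \<and> obmap F (Y i) = Y' i"
    and j: "\<forall>i \<in> I. j i \<in> Hom D (Y i) X \<and> mormap F (j i) = j' i"
  shows "is_coproduct D I Y X j"
  unfolding is_coproduct_def
proof (intro conjI ballI allI impI)
  fix W f assume W: "W \<in> Ob D" and f: "\<forall>i \<in> I. f i \<in> Hom D (Y i) W"
  have "(\<exists>!u. u \<in> Hom C (obmap F X) (obmap F W) \<and> (\<forall>i \<in> I. u \<cdot>\<^bsub>C\<^esub> j' i = mormap F (f i)))"
  proof -
    have "\<forall>i\<in>I. mormap F (f i) \<in> Hom C (Y' i) (obmap F W)"
      using F_Hom W f Y by metis
    then show ?thesis using coprod F_Ob[OF W] by (auto simp: is_coproduct_def)
  qed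
  moreover have "(\<forall>i \<in> I. u \<cdot>\<^bsub>D\<^esub> j i = f i) \<longleftrightarrow> (\<forall>i \<in> I. mormap F u \<cdot>\<^bsub>C\<^esub> j' i = mormap F (f i))"
    if "u \<in> Hom D X W" for u
    using that W X Y j f comp_eq_iff[of _ X W _ u] by (metis (no_types))
  ultimately show "\<exists>!u. u \<in> Hom D X W \<and> (\<forall>i \<in> I. u \<cdot>\<^bsub>D\<^esub> j i = f i)"
    using unique_arrow_iff[OF X W] by simp
qed (use X Y j in auto)

lemma direct_sum_lift:
  assumes sum: "is_direct_sum C I Y' (obmap F X) p' j'" and X: "X \<in> Ob D"
    and Y: "\<forall>i \<in> I. Y i \<in> Ob D \<and> obmap F (Y i) = Y' i"
  shows "\<exists>p j. is_direct_sum D I Y X p j"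
proof -
  have prod: "is_product C I Y' (obmap F X) p'" and coprod: "is_coproduct C I Y' (obmap F X) j'"
    using sum by (simp_all add: is_direct_sum_def)
  obtain p where p: "\<forall>i \<in> I. p i \<in> Hom D X (Y i) \<and> mormap F (p i) = p' i"
    using lift_Hom_family[of I "\<lambda>_. X" Y p'] prod X Y by (auto simp: is_product_def)
  obtain j where j: "\<forall>i \<in> I. j i \<in> Hom D (Y i) X \<and> mormap F (j i) = j' i"
    using lift_Hom_family[of I Y "\<lambda>_. X" j'] coprod X Y by (auto simp: is_coproduct_def)
  have pj: "p i' \<cdot>\<^bsub>D\<^esub> j i \<in> Hom D (Y i) (Y i')" "mormap F (p i' \<cdot>\<^bsub>D\<^esub> j i) = p' i' \<cdot>\<^bsub>C\<^esub> j' i"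
    if "i \<in> I" "i' \<in> I" for i i'
    using that X Y p j F_comp source.comp_in_Hom by metis+
  have "p i \<cdot>\<^bsub>D\<^esub> j i = Id D (Y i)" if "i \<in> I" for i
    using that sum Y pj F_Id faithful source.Id_in_Hom unfolding is_direct_sum_def by metis
  moreover have "zero_morphism D (Y i) (Y i') (p i' \<cdot>\<^bsub>D\<^esub> j i)" if "i \<in> I" "i' \<in> I" "i \<noteq> i'" for i i'
    using that sum Y pj zero_morphism_iff unfolding is_direct_sum_def by metis
  ultimately show ?thesis
    unfolding is_direct_sum_def
    using product_reflect[OF prod X Y p] coproduct_reflect[OF coprod X Y j] by blast
qed

lemma kernel_reflect:
  assumes ker: "is_kernel C (obmap F X) (obmap F Y) (mormap F f) (obmap F K) (mormap F i)"
    and ob: "X \<in> Ob D" "Y \<in> Ob D" "K \<in> Ob D" and f: "f \<in> Hom D X Y" and i: "i \<in> Hom D K X"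
  shows "is_kernel D X Y f K i"
  unfolding is_kernel_def
proof (intro conjI ballI impI)
  show "zero_morphism D K Y (f \<cdot>\<^bsub>D\<^esub> i)"
    using ker ob f i zero_morphism_iff F_comp source.comp_in_Hom unfolding is_kernel_def by metis
  fix W t assume W: "W \<in> Ob D" and t: "t \<in> Hom D W X" and z: "zero_morphism D W Y (f \<cdot>\<^bsub>D\<^esub> t)"
  have "zero_morphism C (obmap F W) (obmap F Y) (mormap F f \<cdot>\<^bsub>C\<^esub> mormap F t)"
    using z ob f t W zero_morphism_iff F_comp source.comp_in_Hom by metis
  then have "\<exists>!u. u \<in> Hom C (obmap F W) (obmap F K) \<and> mormap F i \<cdot>\<^bsub>C\<^esub> u = mormap F t"
    using ker F_Hom ob t F_Ob W unfolding is_kernel_def by blast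
  moreover have "i \<cdot>\<^bsub>D\<^esub> u = t \<longleftrightarrow> mormap F i \<cdot>\<^bsub>C\<^esub> mormap F u = mormap F t" if "u \<in> Hom D W K" for u
    using comp_eq_iff[OF W ob(3,1) that i t] .
  ultimately show "\<exists>!u. u \<in> Hom D W K \<and> i \<cdot>\<^bsub>D\<^esub> u = t"
    using unique_arrow_iff[OF W ob(3)] by simp
qed (use ob i in auto)

lemma cokernel_reflect:
  assumes coker: "is_cokernel C (obmap F X) (obmap F Y) (mormap F f) (obmap F Q) (mormap F q)"
    and ob: "X \<in> Ob D" "Y \<in> Ob D" "Q \<in> Ob D" and f: "f \<in> Hom D X Y" and q: "q \<in> Hom D Y Q"
  shows "is_cokernel D X Y f Q q"
  unfolding is_cokernel_def
proof (intro conjI ballI impI)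
  show "zero_morphism D X Q (q \<cdot>\<^bsub>D\<^esub> f)"
    using coker ob f q zero_morphism_iff F_comp source.comp_in_Hom unfolding is_cokernel_def by metis
  fix W t assume W: "W \<in> Ob D" and t: "t \<in> Hom D Y W" and z: "zero_morphism D X W (t \<cdot>\<^bsub>D\<^esub> f)"
  have "zero_morphism C (obmap F X) (obmap F W) (mormap F t \<cdot>\<^bsub>C\<^esub> mormap F f)"
    using z ob f t W zero_morphism_iff F_comp source.comp_in_Hom by metis
  then have "\<exists>!u. u \<in> Hom C (obmap F Q) (obmap F W) \<and> u \<cdot>\<^bsub>C\<^esub> mormap F q = mormap F t"
    using coker F_Hom ob t F_Ob W unfolding is_cokernel_def by blast
  moreover have "u \<cdot>\<^bsub>D\<^esub> q = t \<longleftrightarrow> mormap F u \<cdot>\<^bsub>C\<^esub> mormap F q = mormap F t" if "u \<in> Hom D Q W" for u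
    using comp_eq_iff[OF ob(2,3) W q that t] .
  ultimately show "\<exists>!u. u \<in> Hom D Q W \<and> u \<cdot>\<^bsub>D\<^esub> q = t"
    using unique_arrow_iff[OF ob(3) W] by simp
qed (use ob q in auto)

lemma mono_image:
  assumes "is_mono D X Y f" "X \<in> Ob D" "Y \<in> Ob D"
  shows "is_mono C (obmap F X) (obmap F Y) (mormap F f)"
  unfolding is_mono_def
proof (intro conjI ballI impI)
  have f: "f \<in> Hom D X Y" using assms by (simp add: is_mono_def)
  then show "mormap F f \<in> Hom C (obmap F X) (obmap F Y)" using assms F_Hom by blast
  fix W' u' v' assume W': "W' \<in> Ob C" "u' \<in> Hom C W' (obmap F X)" "v' \<in> Hom C W' (obmap F X)"
    "mormap F f \<cdot>\<^bsub>C\<^esub> u' = mormap F f \<cdot>\<^bsub>C\<^esub> v'"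
  obtain W where W: "W \<in> Ob D" "obmap F W = W'" using surjective W'(1) by blast
  obtain u where u: "u \<in> Hom D W X" "mormap F u = u'" using full[OF W(1) assms(2)] W' W by metis
  obtain v where v: "v \<in> Hom D W X" "mormap F v = v'" using full[OF W(1) assms(2)] W' W by metis
  have "f \<cdot>\<^bsub>D\<^esub> u = f \<cdot>\<^bsub>D\<^esub> v"
    using comp_eq_iff[OF W(1) assms(2,3) u(1) f source.comp_in_Hom[OF W(1) assms(2,3) v(1) f]]
      F_comp[OF W(1) assms(2,3) v(1) f] u v W'(4) by simp
  then show "u' = v'" using assms(1) u v W by (auto simp: is_mono_def)
qed

lemma epi_image:
  assumes "is_epi D X Y f" "X \<in> Ob D" "Y \<in> Ob D"
  shows "is_epi C (obmap F X) (obmap F Y) (mormap F f)"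
  unfolding is_epi_def
proof (intro conjI ballI impI)
  have f: "f \<in> Hom D X Y" using assms by (simp add: is_epi_def)
  then show "mormap F f \<in> Hom C (obmap F X) (obmap F Y)" using assms F_Hom by blast
  fix W' u' v' assume W': "W' \<in> Ob C" "u' \<in> Hom C (obmap F Y) W'" "v' \<in> Hom C (obmap F Y) W'"
    "u' \<cdot>\<^bsub>C\<^esub> mormap F f = v' \<cdot>\<^bsub>C\<^esub> mormap F f"
  obtain W where W: "W \<in> Ob D" "obmap F W = W'" using surjective W'(1) by blast
  obtain u where u: "u \<in> Hom D Y W" "mormap F u = u'" using full[OF assms(3) W(1)] W' W by metis
  obtain v where v: "v \<in> Hom D Y W" "mormap F v = v'" using full[OF assms(3) W(1)] W' W by metis
  have "u \<cdot>\<^bsub>D\<^esub> f = v \<cdot>\<^bsub>D\<^esub> f"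
    using comp_eq_iff[OF assms(2,3) W(1) f u(1) source.comp_in_Hom[OF assms(2,3) W(1) f v(1)]]
      F_comp[OF assms(2,3) W(1) f v(1)] u v W'(4) by simp
  then show "u' = v'" using assms(1) u v W by (auto simp: is_epi_def)
qed

text \<open>
  Freyd's axioms only assert that objects and arrows with universal properties exist. Each
  is found by applying the axiom to the images in \<open>C\<close>, lifting the resulting objects and
  arrows to \<open>D\<close>, and reflecting the universal property. For the axioms on monomorphisms and
  epimorphisms, the hypothesis has to be pushed forward to \<open>C\<close> first.
\<close>
lemma abelian_lift:
  assumes "abelian_category C"
  shows "abelian_category D"
  unfolding abelian_category_def
proof (intro conjI ballI allI impI)
  show "category D" by (rule source.category_axioms)
  obtain Z' where Z': "zero_object C Z'" using assms by (auto simp: abelian_category_def)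
  then obtain Z where "Z \<in> Ob D" "obmap F Z = Z'" using surjective[of Z'] by (auto simp: zero_object_def)
  then show "\<exists>Z. zero_object D Z" using zero_object_iff Z' by blast
next
  fix X Y assume XY: "X \<in> Ob D" "Y \<in> Ob D"
  let ?Y = "\<lambda>b::bool. if b then X else Y"
    and ?Y' = "\<lambda>b::bool. if b then obmap F X else obmap F Y"
  have Y: "\<forall>b \<in> UNIV. ?Y b \<in> Ob D \<and> obmap F (?Y b) = ?Y' b" using XY by simp
  obtain P' p' where P': "is_product C UNIV ?Y' P' p'"
    using assms F_Ob[OF XY(1)] F_Ob[OF XY(2)] unfolding abelian_category_def by blast
  then obtain P where P: "P \<in> Ob D" "obmap F P = P'"
    using surjective[of P'] by (auto simp: is_product_def)
  have "\<forall>b \<in> UNIV. p' b \<in> Hom C (obmap F P) (obmap F (?Y b))"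
  proof
    fix b show "p' b \<in> Hom C (obmap F P) (obmap F (?Y b))"
      using P' P(2) by (cases b) (auto simp: is_product_def split: if_splits)
  qed
  then obtain p where "\<forall>b \<in> UNIV. p b \<in> Hom D P (?Y b) \<and> mormap F (p b) = p' b"
    using lift_Hom_family[of UNIV "\<lambda>_. P" ?Y p'] P Y by blast
  then show "\<exists>P p. is_product D UNIV ?Y P p"
    using product_reflect[of UNIV ?Y' P p' ?Y p] P' P Y by blast
  obtain S' j' where S': "is_coproduct C UNIV ?Y' S' j'"
    using assms F_Ob[OF XY(1)] F_Ob[OF XY(2)] unfolding abelian_category_def by blast
  then obtain S where S: "S \<in> Ob D" "obmap F S = S'"
    using surjective[of S'] by (auto simp: is_coproduct_def)
  have "\<forall>b \<in> UNIV. j' b \<in> Hom C (obmap F (?Y b)) (obmap F S)"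
  proof
    fix b show "j' b \<in> Hom C (obmap F (?Y b)) (obmap F S)"
      using S' S(2) by (cases b) (auto simp: is_coproduct_def split: if_splits)
  qed
  then obtain j where "\<forall>b \<in> UNIV. j b \<in> Hom D (?Y b) S \<and> mormap F (j b) = j' b"
    using lift_Hom_family[of UNIV ?Y "\<lambda>_. S" j'] S Y by blast
  then show "\<exists>S j. is_coproduct D UNIV ?Y S j"
    using coproduct_reflect[of UNIV ?Y' S j' ?Y j] S' S Y by blast
next
  fix X Y f assume XY: "X \<in> Ob D" "Y \<in> Ob D" and f: "f \<in> Hom D X Y"
  obtain K' i' where ker: "is_kernel C (obmap F X) (obmap F Y) (mormap F f) K' i'"
    using assms F_Ob[OF XY(1)] F_Ob[OF XY(2)] F_Hom[OF XY f] unfolding abelian_category_def by blast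
  then have K': "K' \<in> Ob C" "i' \<in> Hom C K' (obmap F X)" by (auto simp: is_kernel_def)
  obtain K where K: "K \<in> Ob D" "obmap F K = K'" using surjective K' by blast
  obtain i where i: "i \<in> Hom D K X" "mormap F i = i'" using full[OF K(1) XY(1)] K K' by metis
  show "\<exists>K i. is_kernel D X Y f K i"
    using kernel_reflect[OF _ XY K(1) f i(1)] ker K i by blast
  obtain Q' q' where coker: "is_cokernel C (obmap F X) (obmap F Y) (mormap F f) Q' q'"
    using assms F_Ob[OF XY(1)] F_Ob[OF XY(2)] F_Hom[OF XY f] unfolding abelian_category_def by blast
  then have Q': "Q' \<in> Ob C" "q' \<in> Hom C (obmap F Y) Q'" by (auto simp: is_cokernel_def)
  obtain Q where Q: "Q \<in> Ob D" "obmap F Q = Q'" using surjective Q' by blast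
  obtain q where q: "q \<in> Hom D Y Q" "mormap F q = q'" using full[OF XY(2) Q(1)] Q Q' by metis
  show "\<exists>Q q. is_cokernel D X Y f Q q"
    using cokernel_reflect[OF _ XY Q(1) f q(1)] coker Q q by blast
next
  fix X Y f assume XY: "X \<in> Ob D" "Y \<in> Ob D" and f: "is_mono D X Y f"
  obtain Z' g' where Z': "Z' \<in> Ob C" "g' \<in> Hom C (obmap F Y) Z'"
    "is_kernel C (obmap F Y) Z' g' (obmap F X) (mormap F f)"
    using assms F_Ob[OF XY(1)] F_Ob[OF XY(2)] mono_image[OF f XY] unfolding abelian_category_def
    by blast
  obtain Z where Z: "Z \<in> Ob D" "obmap F Z = Z'" using surjective Z' by blast
  obtain g where g: "g \<in> Hom D Y Z" "mormap F g = g'" using full[OF XY(2) Z(1)] Z Z' by metis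
  have "is_kernel D Y Z g X f"
    using kernel_reflect[OF _ XY(2) Z(1) XY(1) g(1)] Z' Z g f by (auto simp: is_mono_def)
  then show "\<exists>Z \<in> Ob D. \<exists>g \<in> Hom D Y Z. is_kernel D Y Z g X f" using Z g by blast
next
  fix X Y f assume XY: "X \<in> Ob D" "Y \<in> Ob D" and f: "is_epi D X Y f"
  obtain Z' g' where Z': "Z' \<in> Ob C" "g' \<in> Hom C Z' (obmap F X)"
    "is_cokernel C Z' (obmap F X) g' (obmap F Y) (mormap F f)"
    using assms F_Ob[OF XY(1)] F_Ob[OF XY(2)] epi_image[OF f XY] unfolding abelian_category_def
    by blast
  obtain Z where Z: "Z \<in> Ob D" "obmap F Z = Z'" using surjective Z' by blast
  obtain g where g: "g \<in> Hom D Z X" "mormap F g = g'" using full[OF Z(1) XY(1)] Z Z' by metis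
  have "is_cokernel D Z X g Y f"
    using cokernel_reflect[OF _ Z(1) XY g(1)] Z' Z g f by (auto simp: is_epi_def)
  then show "\<exists>Z \<in> Ob D. \<exists>g \<in> Hom D Z X. is_cokernel D Z X g Y f" using Z g by blast
qed

lemma coproduct_decomposition_lift:
  assumes "coproduct_decomposition I C A"
  shows "coproduct_decomposition I D (\<lambda>g. {X \<in> Ob D. obmap F X \<in> A g})"
proof -
  have "Ob D = (\<Union>g \<in> I. {X \<in> Ob D. obmap F X \<in> A g})"
  proof -
    have "Ob C = (\<Union>g \<in> I. A g)" using assms by (simp add: coproduct_decomposition_def)
    then have "\<exists>g \<in> I. obmap F X \<in> A g" if "X \<in> Ob D" for X using F_Ob[OF that] by simp
    then show ?thesis by auto
  qed
  moreover have "Hom D X Y = {}" if "X \<in> Ob D" "Y \<in> Ob D" "obmap F X \<in> A g" "obmap F Y \<in> A h"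
    "g \<in> I" "h \<in> I" "g \<noteq> h" for X Y g h
  proof -
    have "Hom C (obmap F X) (obmap F Y) = {}"
      using that assms by (simp add: coproduct_decomposition_def)
    then show ?thesis using F_Hom[OF that(1,2)] by blast
  qed
  moreover have "A g \<inter> A h = {}" if "g \<in> I" "h \<in> I" "g \<noteq> h" for g h
    using that assms by (simp add: coproduct_decomposition_def)
  ultimately show ?thesis
    unfolding coproduct_decomposition_def by fast
qed

text \<open>
  The restriction to a full subcategory and its preimage is again surjective and fully faithful;
  this gives the abelian structure on each component of a grading.
\<close>
lemma full_subcategory_lift:
  assumes "A \<subseteq> Ob C"
  shows "surjective_equivalence (full_subcategory D {X \<in> Ob D. obmap F X \<in> A})
    (full_subcategory C A) F"
proof -
  have C: "X \<in> Ob C" if "X \<in> A" for X using that assms by blast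
  have "category (full_subcategory C A)"
    using assms by (rule target.category_full_subcategory)
  moreover have "category (full_subcategory D {X \<in> Ob D. obmap F X \<in> A})"
    by (rule source.category_full_subcategory) auto
  moreover have "\<exists>X \<in> {X \<in> Ob D. obmap F X \<in> A}. obmap F X = Z" if "Z \<in> A" for Z
    using surjective[OF C[OF that]] that by auto
  ultimately show ?thesis
    unfolding surjective_equivalence_def surjective_equivalence_axioms_def
    using is_functor fully_faithful C
    by (auto simp: full_subcategory_def is_functor_def)
qed

lemma abelian_coproduct_decomposition_lift:
  assumes dec: "abelian_coproduct_decomposition I C A"
  shows "abelian_coproduct_decomposition I D (\<lambda>g. {X \<in> Ob D. obmap F X \<in> A g})"
  unfolding abelian_coproduct_decomposition_def
proof (intro conjI ballI allI impI)
  show "abelian_category D"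
    using abelian_lift dec by (simp add: abelian_coproduct_decomposition_def)
next
  fix g assume g: "g \<in> I"
  then have A: "A g \<subseteq> Ob C" "abelian_category (full_subcategory C (A g))"
    using dec by (auto simp: abelian_coproduct_decomposition_def)
  show "abelian_category (full_subcategory D {X \<in> Ob D. obmap F X \<in> A g})"
    using surjective_equivalence.abelian_lift[OF full_subcategory_lift] A by blast
next
  fix g X Y f assume g: "g \<in> I" and X: "X \<in> {X \<in> Ob D. obmap F X \<in> A g}" and Y: "Y \<in> Ob D"
    and f: "is_iso D X Y f"
  have "is_iso C (obmap F X) (obmap F Y) (mormap F f)"
    using functor_iso[OF is_functor f] X Y by simp
  moreover have "\<forall>X \<in> A g. \<forall>Y \<in> Ob C. \<forall>f. is_iso C X Y f \<longrightarrow> Y \<in> A g"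
    using dec g by (simp add: abelian_coproduct_decomposition_def)
  ultimately have "obmap F Y \<in> A g" using X F_Ob[OF Y] by blast
  then show "Y \<in> {X \<in> Ob D. obmap F X \<in> A g}" using Y by simp
next
  fix g h X Y f assume gh: "g \<in> I" "h \<in> I" "g \<noteq> h" and X: "X \<in> {X \<in> Ob D. obmap F X \<in> A g}"
    and Y: "Y \<in> {X \<in> Ob D. obmap F X \<in> A h}" and f: "f \<in> Hom D X Y"
  have "\<forall>X \<in> A g. \<forall>Y \<in> A h. \<forall>f \<in> Hom C X Y. zero_morphism C X Y f"
    using dec gh by (simp add: abelian_coproduct_decomposition_def)
  then have "zero_morphism C (obmap F X) (obmap F Y) (mormap F f)"
    using X Y F_Hom[OF _ _ f] by simp
  then show "zero_morphism D X Y f"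
    using zero_morphism_iff[OF _ _ f] X Y by simp
next
  fix X assume X: "X \<in> Ob D"
  obtain S Y' p' j' where S: "finite S" "S \<subseteq> I" "\<forall>g \<in> S. Y' g \<in> A g"
    "is_direct_sum C S Y' (obmap F X) p' j'"
  proof -
    have "\<exists>S Y p j. finite S \<and> S \<subseteq> I \<and> (\<forall>g \<in> S. Y g \<in> A g) \<and> is_direct_sum C S Y (obmap F X) p j"
      using dec F_Ob[OF X] by (simp add: abelian_coproduct_decomposition_def)
    then show thesis using that by blast
  qed
  have "\<forall>g \<in> S. Y' g \<in> Ob C"
    using S(4) by (simp add: is_direct_sum_def is_product_def)
  then obtain Y where Y: "\<forall>g \<in> S. Y g \<in> Ob D \<and> obmap F (Y g) = Y' g"
    by (rule lift_family)
  show "\<exists>S Y p j. finite S \<and> S \<subseteq> I \<and> (\<forall>g \<in> S. Y g \<in> {X \<in> Ob D. obmap F X \<in> A g}) \<and>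
    is_direct_sum D S Y X p j"
  proof -
    have "\<forall>g \<in> S. Y g \<in> {X \<in> Ob D. obmap F X \<in> A g}" using S(3) Y by simp
    then show ?thesis using direct_sum_lift[OF S(4) X Y] S(1,2) by blast
  qed
qed auto

end


section \<open>Consequences of the axioms of a monoidal \<open>G\<close>-category\<close>

context monoidal_G_category
begin

lemma act_Ob: "\<lbrakk>g \<in> carrier G; X \<in> Ob C\<rbrakk> \<Longrightarrow> act_ob C g X \<in> Ob C"
  using functor_Ob[OF act_functor] by (simp add: act_def)

lemma act_arr:
  "\<lbrakk>g \<in> carrier G; arr C X Y f\<rbrakk> \<Longrightarrow> arr C (act_ob C g X) (act_ob C g Y) (act_mor C g f)"
  using functor_arr[OF act_functor] by (simp add: act_def)

lemma act_Id: "\<lbrakk>g \<in> carrier G; X \<in> Ob C\<rbrakk> \<Longrightarrow> act_mor C g (Id C X) = Id C (act_ob C g X)"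
  using functor_Id[OF act_functor] by (simp add: act_def)

lemma act_comp:
  "\<lbrakk>g \<in> carrier G; arr C X Y f; arr C Y Z f'\<rbrakk>
    \<Longrightarrow> act_mor C g (f' \<cdot>\<^bsub>C\<^esub> f) = act_mor C g f' \<cdot>\<^bsub>C\<^esub> act_mor C g f"
  using functor_comp[OF act_functor] by (simp add: act_def)

lemma act_iso:
  "\<lbrakk>g \<in> carrier G; is_iso C X Y f; X \<in> Ob C; Y \<in> Ob C\<rbrakk>
    \<Longrightarrow> is_iso C (act_ob C g X) (act_ob C g Y) (act_mor C g f)"
  using functor_iso[OF act_functor] by (simp add: act_def)

lemma phi_iso:
  "\<lbrakk>g \<in> carrier G; h \<in> carrier G; X \<in> Ob C\<rbrakk>
    \<Longrightarrow> is_iso C (act_ob C (g \<otimes>\<^bsub>G\<^esub> h) X) (act_ob C g (act_ob C h X)) (phi C g h X)"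
  using phi_natural_iso by (simp add: natural_iso_def act_def comp_functor_def)

lemma phi_arr:
  "\<lbrakk>g \<in> carrier G; h \<in> carrier G; X \<in> Ob C\<rbrakk>
    \<Longrightarrow> arr C (act_ob C (g \<otimes>\<^bsub>G\<^esub> h) X) (act_ob C g (act_ob C h X)) (phi C g h X)"
  by (simp add: is_iso_arr phi_iso act_Ob)

lemma phi_natural:
  "\<lbrakk>g \<in> carrier G; h \<in> carrier G; arr C X Y f\<rbrakk>
    \<Longrightarrow> phi C g h Y \<cdot>\<^bsub>C\<^esub> act_mor C (g \<otimes>\<^bsub>G\<^esub> h) f = act_mor C g (act_mor C h f) \<cdot>\<^bsub>C\<^esub> phi C g h X"
  using phi_natural_iso by (simp add: natural_iso_def act_def comp_functor_def arr_def)

lemma psi_arr: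
  "\<lbrakk>g \<in> carrier G; X \<in> Ob C; Y \<in> Ob C\<rbrakk>
    \<Longrightarrow> arr C (act_ob C g (X \<otimes>\<^sub>o\<^bsub>C\<^esub> Y)) (act_ob C g X \<otimes>\<^sub>o\<^bsub>C\<^esub> act_ob C g Y) (psi C g X Y)"
  by (simp add: is_iso_arr psi_iso act_Ob tensor_Ob)

lemma psi_square:
  "\<lbrakk>g \<in> carrier G; arr C X X' f; arr C Y Y' f'\<rbrakk>
    \<Longrightarrow> (act_mor C g f \<otimes>\<^sub>m\<^bsub>C\<^esub> act_mor C g f') \<cdot>\<^bsub>C\<^esub> psi C g X Y
      = psi C g X' Y' \<cdot>\<^bsub>C\<^esub> act_mor C g (f \<otimes>\<^sub>m\<^bsub>C\<^esub> f')"
  unfolding arr_def using psi_natural by metis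

text \<open>
  That \<open>\<psi>\<^sup>e\<close> is trivial is not among the axioms. The compatibility of \<open>\<phi>\<close> with \<open>\<psi>\<close> at
  \<open>g = h = e\<close> says that \<open>\<psi>\<^sup>e(X, Y)\<close> is idempotent. Its triviality is needed for the normalization
  \<open>\<eta>\<^sub>e\<^sub>,\<^sub>g = id\<close> of a tensor product of families.
\<close>
lemma psi_one:
  assumes X: "X \<in> Ob C" and Y: "Y \<in> Ob C"
  shows "psi C \<one>\<^bsub>G\<^esub> X Y = Id C (X \<otimes>\<^sub>o\<^bsub>C\<^esub> Y)"
proof (rule idempotent_iso_is_Id)
  show iso: "is_iso C (X \<otimes>\<^sub>o\<^bsub>C\<^esub> Y) (X \<otimes>\<^sub>o\<^bsub>C\<^esub> Y) (psi C \<one>\<^bsub>G\<^esub> X Y)"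
    using psi_iso[of "\<one>\<^bsub>G\<^esub>" X Y] X Y by (simp add: act_one_ob tensor_Ob)
  show XY: "X \<otimes>\<^sub>o\<^bsub>C\<^esub> Y \<in> Ob C" using X Y by (rule tensor_Ob)
  note a = is_iso_arr[OF iso XY XY]
  have "psi C \<one>\<^bsub>G\<^esub> X Y = psi C \<one>\<^bsub>G\<^esub> X Y \<cdot>\<^bsub>C\<^esub> psi C \<one>\<^bsub>G\<^esub> X Y \<cdot>\<^bsub>C\<^esub> Id C (X \<otimes>\<^sub>o\<^bsub>C\<^esub> Y)"
    using phi_psi_coherence[of "\<one>\<^bsub>G\<^esub>" "\<one>\<^bsub>G\<^esub>" X Y] X Y Id_left[OF a] act_one_mor[OF XY XY arr_Hom[OF a]]
    by (simp add: act_one_ob phi_one_left tensor_Id XY)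
  then show "psi C \<one>\<^bsub>G\<^esub> X Y \<cdot>\<^bsub>C\<^esub> psi C \<one>\<^bsub>G\<^esub> X Y = psi C \<one>\<^bsub>G\<^esub> X Y"
    using Id_right[OF arr_comp[OF a a]] by simp
qed

text \<open>
  Likewise, the compatibility of \<open>\<phi>\<close> with \<open>\<psi>\<close> at the unit object says that
  \<open>\<phi>(g, h)\<close> is idempotent there, because tensoring endomorphisms of the unit object is composing
  them. It makes the constant family at the unit object satisfy the cocycle condition.
\<close>
lemma phi_unit:
  assumes g: "g \<in> carrier G" and h: "h \<in> carrier G"
  shows "phi C g h (unit_ob C) = Id C (unit_ob C)"
proof (rule idempotent_iso_is_Id)
  show iso: "is_iso C (unit_ob C) (unit_ob C) (phi C g h (unit_ob C))"
    using phi_iso[OF g h unit_Ob] g h by (simp add: act_unit)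
  note a = is_iso_arr[OF iso unit_Ob unit_Ob]
  have "(phi C g h (unit_ob C) \<otimes>\<^sub>m\<^bsub>C\<^esub> phi C g h (unit_ob C)) \<cdot>\<^bsub>C\<^esub> Id C (unit_ob C)
      = Id C (unit_ob C) \<cdot>\<^bsub>C\<^esub> Id C (unit_ob C) \<cdot>\<^bsub>C\<^esub> phi C g h (unit_ob C)"
    using phi_psi_coherence[OF g h unit_Ob unit_Ob] g h
    by (simp add: psi_unit_left unit_Ob act_unit act_Id tensor_ob_unit_left)
  then show "phi C g h (unit_ob C) \<cdot>\<^bsub>C\<^esub> phi C g h (unit_ob C) = phi C g h (unit_ob C)"
    using a by (simp add: tensor_endo_unit Id_left[OF a] Id_right[OF arr_comp[OF a a]]
        Id_left[OF arr_Id[OF unit_Ob]])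
qed (rule unit_Ob)

end


section \<open>The category of families\<close>

lemma family_category_simps [simp]:
  "Ob (family_category G C) = family_obs G C"
  "Hom (family_category G C) = family_hom G C"
  "f' \<cdot>\<^bsub>family_category G C\<^esub> f = (\<lambda>g \<in> carrier G. f' g \<cdot>\<^bsub>C\<^esub> f g)"
  "Id (family_category G C) = family_id G C"
  "X \<otimes>\<^sub>o\<^bsub>family_category G C\<^esub> Y = family_tensor G C X Y"
  "f \<otimes>\<^sub>m\<^bsub>family_category G C\<^esub> l = (\<lambda>g \<in> carrier G. f g \<otimes>\<^sub>m\<^bsub>C\<^esub> l g)"
  "unit_ob (family_category G C) =
    (\<lambda>g \<in> carrier G. unit_ob C, \<lambda>(g, h) \<in> carrier G \<times> carrier G. Id C (unit_ob C))"
  "act_ob (family_category G C) g = family_act G g"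
  "act_mor (family_category G C) g f = (\<lambda>h \<in> carrier G. f (h \<otimes>\<^bsub>G\<^esub> g))"
  "phi (family_category G C) g h X = family_id G C (family_act G (g \<otimes>\<^bsub>G\<^esub> h) X)"
  "psi (family_category G C) g X Y = family_id G C (family_act G g (family_tensor G C X Y))"
  "component (family_category G C) g = {X \<in> family_obs G C. fst X \<one>\<^bsub>G\<^esub> \<in> component C g}"
  by (auto simp: family_category_def)

lemma family_id_eq: "family_id G C X = (\<lambda>g \<in> carrier G. Id C (fst X g))"
  by (simp add: family_id_def case_prod_unfold)

lemma family_tensor_eq:
  "family_tensor G C X Y =
    (\<lambda>g \<in> carrier G. fst X g \<otimes>\<^sub>o\<^bsub>C\<^esub> fst Y g,
     \<lambda>(g, h) \<in> carrier G \<times> carrier G.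
       (snd X (g, h) \<otimes>\<^sub>m\<^bsub>C\<^esub> snd Y (g, h)) \<cdot>\<^bsub>C\<^esub> psi C g (fst X h) (fst Y h))"
  by (simp add: family_tensor_def case_prod_unfold)

lemma family_act_eq:
  "family_act G g X =
    (\<lambda>h \<in> carrier G. fst X (h \<otimes>\<^bsub>G\<^esub> g),
     \<lambda>(x, y) \<in> carrier G \<times> carrier G. snd X (x, y \<otimes>\<^bsub>G\<^esub> g))"
  by (simp add: family_act_def case_prod_unfold)

lemma family_obs_iff:
  "X \<in> family_obs G C \<longleftrightarrow>
    fst X \<in> carrier G \<rightarrow>\<^sub>E Ob C \<and> snd X \<in> extensional (carrier G \<times> carrier G) \<and>
    (\<forall>g \<in> carrier G. \<forall>h \<in> carrier G.
      is_iso C (act_ob C g (fst X h)) (fst X (g \<otimes>\<^bsub>G\<^esub> h)) (snd X (g, h))) \<and>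
    (\<forall>g \<in> carrier G. snd X (\<one>\<^bsub>G\<^esub>, g) = Id C (fst X g)) \<and>
    (\<forall>g \<in> carrier G. \<forall>h \<in> carrier G. \<forall>k \<in> carrier G.
      snd X (g \<otimes>\<^bsub>G\<^esub> h, k)
        = snd X (g, h \<otimes>\<^bsub>G\<^esub> k) \<cdot>\<^bsub>C\<^esub> act_mor C g (snd X (h, k)) \<cdot>\<^bsub>C\<^esub> phi C g h (fst X k))"
  by (simp add: family_obs_def case_prod_unfold)

lemma family_obsI:
  assumes "\<And>g. g \<in> carrier G \<Longrightarrow> L g \<in> Ob C"
    and "\<And>g h. \<lbrakk>g \<in> carrier G; h \<in> carrier G\<rbrakk>
      \<Longrightarrow> is_iso C (act_ob C g (L h)) (L (g \<otimes>\<^bsub>G\<^esub> h)) (\<eta> g h)"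
    and "\<And>g. g \<in> carrier G \<Longrightarrow> \<eta> \<one>\<^bsub>G\<^esub> g = Id C (L g)"
    and "\<And>g h k. \<lbrakk>g \<in> carrier G; h \<in> carrier G; k \<in> carrier G\<rbrakk>
      \<Longrightarrow> \<eta> (g \<otimes>\<^bsub>G\<^esub> h) k = \<eta> g (h \<otimes>\<^bsub>G\<^esub> k) \<cdot>\<^bsub>C\<^esub> act_mor C g (\<eta> h k) \<cdot>\<^bsub>C\<^esub> phi C g h (L k)"
    and "group G"
  shows "(\<lambda>g \<in> carrier G. L g, \<lambda>(g, h) \<in> carrier G \<times> carrier G. \<eta> g h) \<in> family_obs G C"
proof -
  interpret group G by fact
  show ?thesis unfolding family_obs_iff using assms(1-4) by simp
qed

lemma fam_Ob: "\<lbrakk>X \<in> family_obs G C; g \<in> carrier G\<rbrakk> \<Longrightarrow> fst X g \<in> Ob C"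
  by (auto simp: family_obs_iff)

lemma fam_iso:
  "\<lbrakk>X \<in> family_obs G C; g \<in> carrier G; h \<in> carrier G\<rbrakk>
    \<Longrightarrow> is_iso C (act_ob C g (fst X h)) (fst X (g \<otimes>\<^bsub>G\<^esub> h)) (snd X (g, h))"
  by (simp add: family_obs_iff)

lemma fam_one: "\<lbrakk>X \<in> family_obs G C; g \<in> carrier G\<rbrakk> \<Longrightarrow> snd X (\<one>\<^bsub>G\<^esub>, g) = Id C (fst X g)"
  by (simp add: family_obs_iff)

lemma fam_cocycle:
  "\<lbrakk>X \<in> family_obs G C; g \<in> carrier G; h \<in> carrier G; k \<in> carrier G\<rbrakk>
    \<Longrightarrow> snd X (g \<otimes>\<^bsub>G\<^esub> h, k)
      = snd X (g, h \<otimes>\<^bsub>G\<^esub> k) \<cdot>\<^bsub>C\<^esub> act_mor C g (snd X (h, k)) \<cdot>\<^bsub>C\<^esub> phi C g h (fst X k)"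
  by (simp add: family_obs_iff)

lemma family_ob_eqI:
  assumes "fst X \<in> extensional (carrier G)" "snd X \<in> extensional (carrier G \<times> carrier G)"
    and "fst Y \<in> extensional (carrier G)" "snd Y \<in> extensional (carrier G \<times> carrier G)"
    and "\<And>g. g \<in> carrier G \<Longrightarrow> fst X g = fst Y g"
    and "\<And>g h. \<lbrakk>g \<in> carrier G; h \<in> carrier G\<rbrakk> \<Longrightarrow> snd X (g, h) = snd Y (g, h)"
  shows "X = Y"
proof (rule prod_eqI)
  show "fst X = fst Y" using assms by (intro extensionalityI[of _ "carrier G"]) auto
  show "snd X = snd Y"
    using assms by (intro extensionalityI[of _ "carrier G \<times> carrier G"]) auto
qed

lemma family_obs_extensional:
  assumes "X \<in> family_obs G C"
  shows "fst X \<in> extensional (carrier G)" "snd X \<in> extensional (carrier G \<times> carrier G)"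
  using assms by (auto simp: family_obs_iff PiE_def)

lemma family_tensor_extensional:
  "fst (family_tensor G C X Y) \<in> extensional (carrier G)"
  "snd (family_tensor G C X Y) \<in> extensional (carrier G \<times> carrier G)"
  by (simp_all add: family_tensor_eq)

lemma family_act_extensional:
  "fst (family_act G g X) \<in> extensional (carrier G)"
  "snd (family_act G g X) \<in> extensional (carrier G \<times> carrier G)"
  by (simp_all add: family_act_eq)

lemma family_hom_iff:
  "f \<in> family_hom G C X Y \<longleftrightarrow>
    f \<in> extensional (carrier G) \<and> (\<forall>g \<in> carrier G. f g \<in> Hom C (fst X g) (fst Y g)) \<and>
    (\<forall>g \<in> carrier G. \<forall>h \<in> carrier G.
      f (g \<otimes>\<^bsub>G\<^esub> h) \<cdot>\<^bsub>C\<^esub> snd X (g, h) = snd Y (g, h) \<cdot>\<^bsub>C\<^esub> act_mor C g (f h))"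
  by (auto simp: family_hom_def case_prod_unfold PiE_iff)

lemma family_hom_eqI:
  assumes "f \<in> family_hom G C X Y" "f' \<in> family_hom G C X' Y'" "\<And>g. g \<in> carrier G \<Longrightarrow> f g = f' g"
  shows "f = f'"
  using assms by (intro extensionalityI[of f "carrier G" f']) (auto simp: family_hom_iff)

lemma fam_hom_arr:
  "\<lbrakk>X \<in> family_obs G C; Y \<in> family_obs G C; f \<in> family_hom G C X Y; g \<in> carrier G\<rbrakk>
    \<Longrightarrow> arr C (fst X g) (fst Y g) (f g)"
  by (simp add: arr_def fam_Ob family_hom_iff)

lemma fam_hom_square:
  "\<lbrakk>f \<in> family_hom G C X Y; g \<in> carrier G; h \<in> carrier G\<rbrakk>
    \<Longrightarrow> f (g \<otimes>\<^bsub>G\<^esub> h) \<cdot>\<^bsub>C\<^esub> snd X (g, h) = snd Y (g, h) \<cdot>\<^bsub>C\<^esub> act_mor C g (f h)"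
  by (simp add: family_hom_iff)

context monoidal_G_category
begin

lemma fam_iso_arr:
  "\<lbrakk>X \<in> family_obs G C; g \<in> carrier G; h \<in> carrier G\<rbrakk>
    \<Longrightarrow> arr C (act_ob C g (fst X h)) (fst X (g \<otimes>\<^bsub>G\<^esub> h)) (snd X (g, h))"
  by (simp add: is_iso_arr fam_iso fam_Ob act_Ob)

lemma family_comp:
  assumes X: "X \<in> family_obs G C" and Y: "Y \<in> family_obs G C" and Z: "Z \<in> family_obs G C"
    and f: "f \<in> family_hom G C X Y" and f': "f' \<in> family_hom G C Y Z"
  shows "(\<lambda>g \<in> carrier G. f' g \<cdot>\<^bsub>C\<^esub> f g) \<in> family_hom G C X Z"
  unfolding family_hom_iff
proof (intro conjI ballI)
  fix g assume g: "g \<in> carrier G"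
  show "(\<lambda>g \<in> carrier G. f' g \<cdot>\<^bsub>C\<^esub> f g) g \<in> Hom C (fst X g) (fst Z g)"
    using arr_comp[OF fam_hom_arr[OF X Y f g] fam_hom_arr[OF Y Z f' g]] g by (simp add: arr_Hom)
  fix h assume h: "h \<in> carrier G"
  note gh = m_closed[OF g h]
  note fh = fam_hom_arr[OF X Y f h] and f'h = fam_hom_arr[OF Y Z f' h]
  have "snd Z (g, h) \<cdot>\<^bsub>C\<^esub> (act_mor C g (f' h) \<cdot>\<^bsub>C\<^esub> act_mor C g (f h))
      = (f' (g \<otimes>\<^bsub>G\<^esub> h) \<cdot>\<^bsub>C\<^esub> f (g \<otimes>\<^bsub>G\<^esub> h)) \<cdot>\<^bsub>C\<^esub> snd X (g, h)"
    by (rule paste_squares[OF act_arr[OF g fh] act_arr[OF g f'h] fam_iso_arr[OF X g h]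
          fam_iso_arr[OF Y g h] fam_iso_arr[OF Z g h] fam_hom_arr[OF X Y f gh]
          fam_hom_arr[OF Y Z f' gh]])
      (simp_all add: fam_hom_square[OF f g h] fam_hom_square[OF f' g h])
  then show "(\<lambda>g \<in> carrier G. f' g \<cdot>\<^bsub>C\<^esub> f g) (g \<otimes>\<^bsub>G\<^esub> h) \<cdot>\<^bsub>C\<^esub> snd X (g, h)
      = snd Z (g, h) \<cdot>\<^bsub>C\<^esub> act_mor C g ((\<lambda>g \<in> carrier G. f' g \<cdot>\<^bsub>C\<^esub> f g) h)"
    using g h by (simp add: act_comp[OF g fh f'h])
qed simp

lemma family_id_hom: "X \<in> family_obs G C \<Longrightarrow> family_id G C X \<in> family_hom G C X X"
  by (simp add: family_hom_iff family_id_eq Id_in_Hom fam_Ob act_Id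
      Id_left[OF fam_iso_arr] Id_right[OF fam_iso_arr])

lemma category_family: "category (family_category G C)"
proof (unfold_locales, simp_all only: family_category_simps)
  fix W X Y Z f g h
  assume ob: "W \<in> family_obs G C" "X \<in> family_obs G C" "Y \<in> family_obs G C" "Z \<in> family_obs G C"
    and f: "f \<in> family_hom G C W X" and g: "g \<in> family_hom G C X Y" and h: "h \<in> family_hom G C Y Z"
  show "(\<lambda>x \<in> carrier G. (\<lambda>x \<in> carrier G. h x \<cdot>\<^bsub>C\<^esub> g x) x \<cdot>\<^bsub>C\<^esub> f x)
      = (\<lambda>x \<in> carrier G. h x \<cdot>\<^bsub>C\<^esub> (\<lambda>x \<in> carrier G. g x \<cdot>\<^bsub>C\<^esub> f x) x)"
    using assoc[OF fam_hom_arr[OF ob(1,2) f] fam_hom_arr[OF ob(2,3) g] fam_hom_arr[OF ob(3,4) h]]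
    by (intro restrict_ext) simp
next
  fix X Y f assume ob: "X \<in> family_obs G C" "Y \<in> family_obs G C" and f: "f \<in> family_hom G C X Y"
  note fg = fam_hom_arr[OF ob f]
  have "f = restrict f (carrier G)" using f by (simp add: family_hom_iff extensional_restrict)
  then show "(\<lambda>g \<in> carrier G. f g \<cdot>\<^bsub>C\<^esub> family_id G C X g) = f"
    "(\<lambda>g \<in> carrier G. family_id G C Y g \<cdot>\<^bsub>C\<^esub> f g) = f"
    by (auto simp: family_id_eq Id_right[OF fg] Id_left[OF fg] cong: restrict_cong)
qed (auto intro: family_comp family_id_hom)

text \<open>
  The point is the cocycle condition, which reduces to those of the two factors: the compatibility
  of \<open>\<phi>\<close> with \<open>\<psi>\<close> splits \<open>\<psi>\<^sup>g\<^sup>h\<close>, and naturality of \<open>\<psi>\<^sup>g\<close> moves its half past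
  the structure arrows.
\<close>
lemma family_tensor_obs:
  assumes X: "X \<in> family_obs G C" and Y: "Y \<in> family_obs G C"
  shows "family_tensor G C X Y \<in> family_obs G C"
  unfolding family_tensor_eq
proof (rule family_obsI)
  show "fst X g \<otimes>\<^sub>o\<^bsub>C\<^esub> fst Y g \<in> Ob C" if "g \<in> carrier G" for g
    using that X Y by (simp add: fam_Ob tensor_Ob)
  show "is_iso C (act_ob C g (fst X h \<otimes>\<^sub>o\<^bsub>C\<^esub> fst Y h)) (fst X (g \<otimes>\<^bsub>G\<^esub> h) \<otimes>\<^sub>o\<^bsub>C\<^esub> fst Y (g \<otimes>\<^bsub>G\<^esub> h))
      ((snd X (g, h) \<otimes>\<^sub>m\<^bsub>C\<^esub> snd Y (g, h)) \<cdot>\<^bsub>C\<^esub> psi C g (fst X h) (fst Y h))"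
    if "g \<in> carrier G" "h \<in> carrier G" for g h
    by (rule is_iso_comp[OF psi_iso is_iso_tensor[OF fam_iso[OF X] _ _ fam_iso[OF Y]]])
      (use that X Y in \<open>auto simp: fam_Ob act_Ob tensor_Ob\<close>)
  show "(snd X (\<one>\<^bsub>G\<^esub>, g) \<otimes>\<^sub>m\<^bsub>C\<^esub> snd Y (\<one>\<^bsub>G\<^esub>, g)) \<cdot>\<^bsub>C\<^esub> psi C \<one>\<^bsub>G\<^esub> (fst X g) (fst Y g)
      = Id C (fst X g \<otimes>\<^sub>o\<^bsub>C\<^esub> fst Y g)" if "g \<in> carrier G" for g
    using that X Y Id_left[OF arr_Id]
    by (simp add: fam_one psi_one fam_Ob tensor_Id tensor_Ob)
next
  fix g h k assume g: "g \<in> carrier G" and h: "h \<in> carrier G" and k: "k \<in> carrier G"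
  note gh = m_closed[OF g h] and hk = m_closed[OF h k]
  let ?L = "fst X k" and ?L' = "fst Y k"
  have L: "?L \<in> Ob C" "?L' \<in> Ob C" using X Y k by (auto simp: fam_Ob)
  let ?A = "snd X (g, h \<otimes>\<^bsub>G\<^esub> k)" and ?A' = "snd Y (g, h \<otimes>\<^bsub>G\<^esub> k)"
    and ?b = "snd X (h, k)" and ?b' = "snd Y (h, k)"
    and ?P = "phi C g h ?L" and ?P' = "phi C g h ?L'"
  note A = fam_iso_arr[OF X g hk] and A' = fam_iso_arr[OF Y g hk]
    and b = fam_iso_arr[OF X h k] and b' = fam_iso_arr[OF Y h k]
    and P = phi_arr[OF g h L(1)] and P' = phi_arr[OF g h L(2)]
  note B = act_arr[OF g b] and B' = act_arr[OF g b']
  let ?p = "psi C h ?L ?L'" and ?q = "psi C g (act_ob C h ?L) (act_ob C h ?L')"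
    and ?r = "psi C g (fst X (h \<otimes>\<^bsub>G\<^esub> k)) (fst Y (h \<otimes>\<^bsub>G\<^esub> k))"
    and ?s = "psi C (g \<otimes>\<^bsub>G\<^esub> h) ?L ?L'" and ?R = "phi C g h (?L \<otimes>\<^sub>o\<^bsub>C\<^esub> ?L')"
  note p = psi_arr[OF h L] and q = psi_arr[OF g act_Ob[OF h L(1)] act_Ob[OF h L(2)]]
    and r = psi_arr[OF g fam_Ob[OF X hk] fam_Ob[OF Y hk]] and s = psi_arr[OF gh L]
    and R = phi_arr[OF g h tensor_Ob[OF L]]
  note AA = arr_tensor[OF A A'] and BB = arr_tensor[OF B B'] and PP = arr_tensor[OF P P']
    and bb = arr_tensor[OF b b']
  note gp = act_arr[OF g p] and gbb = act_arr[OF g bb]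
  \<comment> \<open>Expand both cocycles and collect the factors of equal kind by the interchange law.\<close>
  have "(snd X (g \<otimes>\<^bsub>G\<^esub> h, k) \<otimes>\<^sub>m\<^bsub>C\<^esub> snd Y (g \<otimes>\<^bsub>G\<^esub> h, k)) \<cdot>\<^bsub>C\<^esub> ?s
      = ((?A \<otimes>\<^sub>m\<^bsub>C\<^esub> ?A') \<cdot>\<^bsub>C\<^esub> (act_mor C g ?b \<otimes>\<^sub>m\<^bsub>C\<^esub> act_mor C g ?b')) \<cdot>\<^bsub>C\<^esub> ((?P \<otimes>\<^sub>m\<^bsub>C\<^esub> ?P') \<cdot>\<^bsub>C\<^esub> ?s)"
    using interchange[OF P arr_comp[OF B A] P' arr_comp[OF B' A']] interchange[OF B A B' A']
      assoc[OF s PP arr_comp[OF BB AA]]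
    by (simp add: fam_cocycle[OF X g h k] fam_cocycle[OF Y g h k])
  also have "\<dots> = ((?A \<otimes>\<^sub>m\<^bsub>C\<^esub> ?A') \<cdot>\<^bsub>C\<^esub> (act_mor C g ?b \<otimes>\<^sub>m\<^bsub>C\<^esub> act_mor C g ?b'))
      \<cdot>\<^bsub>C\<^esub> (?q \<cdot>\<^bsub>C\<^esub> act_mor C g ?p \<cdot>\<^bsub>C\<^esub> ?R)"
    by (simp add: phi_psi_coherence[OF g h L])
  also have "\<dots> = (?A \<otimes>\<^sub>m\<^bsub>C\<^esub> ?A') \<cdot>\<^bsub>C\<^esub>
      (((act_mor C g ?b \<otimes>\<^sub>m\<^bsub>C\<^esub> act_mor C g ?b') \<cdot>\<^bsub>C\<^esub> ?q) \<cdot>\<^bsub>C\<^esub> (act_mor C g ?p \<cdot>\<^bsub>C\<^esub> ?R))"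
    using assoc[OF arr_comp[OF R arr_comp[OF gp q]] BB AA] assoc[OF R gp q]
      assoc[OF arr_comp[OF R gp] q BB] by simp
  also have "\<dots> = (?A \<otimes>\<^sub>m\<^bsub>C\<^esub> ?A') \<cdot>\<^bsub>C\<^esub>
      ((?r \<cdot>\<^bsub>C\<^esub> act_mor C g (?b \<otimes>\<^sub>m\<^bsub>C\<^esub> ?b')) \<cdot>\<^bsub>C\<^esub> (act_mor C g ?p \<cdot>\<^bsub>C\<^esub> ?R))"
    by (simp add: psi_square[OF g b b'])
  also have "\<dots> = ((?A \<otimes>\<^sub>m\<^bsub>C\<^esub> ?A') \<cdot>\<^bsub>C\<^esub> ?r) \<cdot>\<^bsub>C\<^esub> (act_mor C g (?b \<otimes>\<^sub>m\<^bsub>C\<^esub> ?b') \<cdot>\<^bsub>C\<^esub> act_mor C g ?p) \<cdot>\<^bsub>C\<^esub> ?R"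
    using assoc[OF arr_comp[OF R gp] gbb r] assoc[OF R gp gbb]
      assoc[OF arr_comp[OF R arr_comp[OF gp gbb]] r AA]
      assoc[OF R arr_comp[OF gp gbb] arr_comp[OF r AA]] by simp
  also have "\<dots> = ((?A \<otimes>\<^sub>m\<^bsub>C\<^esub> ?A') \<cdot>\<^bsub>C\<^esub> ?r) \<cdot>\<^bsub>C\<^esub> act_mor C g ((?b \<otimes>\<^sub>m\<^bsub>C\<^esub> ?b') \<cdot>\<^bsub>C\<^esub> ?p) \<cdot>\<^bsub>C\<^esub> ?R"
    by (simp add: act_comp[OF g p bb])
  finally show "(snd X (g \<otimes>\<^bsub>G\<^esub> h, k) \<otimes>\<^sub>m\<^bsub>C\<^esub> snd Y (g \<otimes>\<^bsub>G\<^esub> h, k)) \<cdot>\<^bsub>C\<^esub> ?s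
      = ((?A \<otimes>\<^sub>m\<^bsub>C\<^esub> ?A') \<cdot>\<^bsub>C\<^esub> ?r) \<cdot>\<^bsub>C\<^esub> act_mor C g ((?b \<otimes>\<^sub>m\<^bsub>C\<^esub> ?b') \<cdot>\<^bsub>C\<^esub> ?p) \<cdot>\<^bsub>C\<^esub> ?R" .
qed (rule is_group)

lemma family_tensor_hom:
  assumes X: "X \<in> family_obs G C" and Y: "Y \<in> family_obs G C" and f: "f \<in> family_hom G C X Y"
    and X': "X' \<in> family_obs G C" and Y': "Y' \<in> family_obs G C" and f': "f' \<in> family_hom G C X' Y'"
  shows "(\<lambda>g \<in> carrier G. f g \<otimes>\<^sub>m\<^bsub>C\<^esub> f' g)
    \<in> family_hom G C (family_tensor G C X X') (family_tensor G C Y Y')"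
  unfolding family_hom_iff
proof (intro conjI ballI)
  fix g assume g: "g \<in> carrier G"
  show "(\<lambda>g \<in> carrier G. f g \<otimes>\<^sub>m\<^bsub>C\<^esub> f' g) g
      \<in> Hom C (fst (family_tensor G C X X') g) (fst (family_tensor G C Y Y') g)"
    using arr_tensor[OF fam_hom_arr[OF X Y f g] fam_hom_arr[OF X' Y' f' g]] g
    by (simp add: arr_Hom family_tensor_eq)
  fix h assume h: "h \<in> carrier G"
  note gh = m_closed[OF g h]
  note fh = fam_hom_arr[OF X Y f h] and f'h = fam_hom_arr[OF X' Y' f' h]
    and fgh = fam_hom_arr[OF X Y f gh] and f'gh = fam_hom_arr[OF X' Y' f' gh]
    and x = fam_iso_arr[OF X g h] and x' = fam_iso_arr[OF X' g h]
    and y = fam_iso_arr[OF Y g h] and y' = fam_iso_arr[OF Y' g h]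
  have "(f (g \<otimes>\<^bsub>G\<^esub> h) \<otimes>\<^sub>m\<^bsub>C\<^esub> f' (g \<otimes>\<^bsub>G\<^esub> h))
        \<cdot>\<^bsub>C\<^esub> ((snd X (g, h) \<otimes>\<^sub>m\<^bsub>C\<^esub> snd X' (g, h)) \<cdot>\<^bsub>C\<^esub> psi C g (fst X h) (fst X' h))
      = ((snd Y (g, h) \<otimes>\<^sub>m\<^bsub>C\<^esub> snd Y' (g, h)) \<cdot>\<^bsub>C\<^esub> psi C g (fst Y h) (fst Y' h))
        \<cdot>\<^bsub>C\<^esub> act_mor C g (f h \<otimes>\<^sub>m\<^bsub>C\<^esub> f' h)"
  proof (rule paste_squares[OF psi_arr[OF g fam_Ob[OF X h] fam_Ob[OF X' h]] arr_tensor[OF x x']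
        act_arr[OF g arr_tensor[OF fh f'h]] arr_tensor[OF act_arr[OF g fh] act_arr[OF g f'h]]
        arr_tensor[OF fgh f'gh] psi_arr[OF g fam_Ob[OF Y h] fam_Ob[OF Y' h]] arr_tensor[OF y y']])
    show "(f (g \<otimes>\<^bsub>G\<^esub> h) \<otimes>\<^sub>m\<^bsub>C\<^esub> f' (g \<otimes>\<^bsub>G\<^esub> h)) \<cdot>\<^bsub>C\<^esub> (snd X (g, h) \<otimes>\<^sub>m\<^bsub>C\<^esub> snd X' (g, h))
      = (snd Y (g, h) \<otimes>\<^sub>m\<^bsub>C\<^esub> snd Y' (g, h)) \<cdot>\<^bsub>C\<^esub> (act_mor C g (f h) \<otimes>\<^sub>m\<^bsub>C\<^esub> act_mor C g (f' h))"
      using interchange[OF x fgh x' f'gh] interchange[OF act_arr[OF g fh] y act_arr[OF g f'h] y']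
      by (simp add: fam_hom_square[OF f g h] fam_hom_square[OF f' g h])
  qed (rule psi_square[OF g fh f'h])
  then show "(\<lambda>g \<in> carrier G. f g \<otimes>\<^sub>m\<^bsub>C\<^esub> f' g) (g \<otimes>\<^bsub>G\<^esub> h) \<cdot>\<^bsub>C\<^esub> snd (family_tensor G C X X') (g, h)
      = snd (family_tensor G C Y Y') (g, h) \<cdot>\<^bsub>C\<^esub> act_mor C g ((\<lambda>g \<in> carrier G. f g \<otimes>\<^sub>m\<^bsub>C\<^esub> f' g) h)"
    using g h by (simp add: family_tensor_eq)
qed simp

text \<open>
  The structure isomorphisms of the two bracketings agree by the coherence axiom for \<open>\<psi>\<^sup>g\<close>.
  Thus \<open>\<psi>\<close> is absorbed into the objects, and the tensor product stays strictly associative.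
\<close>
lemma family_tensor_assoc:
  assumes X: "X \<in> family_obs G C" and Y: "Y \<in> family_obs G C" and Z: "Z \<in> family_obs G C"
  shows "family_tensor G C (family_tensor G C X Y) Z = family_tensor G C X (family_tensor G C Y Z)"
proof (rule family_ob_eqI[OF family_tensor_extensional family_tensor_extensional])
  show "fst (family_tensor G C (family_tensor G C X Y) Z) g
      = fst (family_tensor G C X (family_tensor G C Y Z)) g" if "g \<in> carrier G" for g
    using that X Y Z by (simp add: family_tensor_eq fam_Ob tensor_ob_assoc)
  fix g h assume g: "g \<in> carrier G" and h: "h \<in> carrier G"
  let ?x = "snd X (g, h)" and ?y = "snd Y (g, h)" and ?z = "snd Z (g, h)"
  note x = fam_iso_arr[OF X g h] and y = fam_iso_arr[OF Y g h] and z = fam_iso_arr[OF Z g h]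
    and L = fam_Ob[OF X h] and M = fam_Ob[OF Y h] and N = fam_Ob[OF Z h]
  let ?I = "\<lambda>U. Id C (act_ob C g U)" and ?psi = "psi C g"
  note IL = arr_Id[OF act_Ob[OF g L]] and IN = arr_Id[OF act_Ob[OF g N]]
  note xy = arr_tensor[OF x y] and yz = arr_tensor[OF y z]
  have t: "?x \<otimes>\<^sub>m\<^bsub>C\<^esub> ?y \<otimes>\<^sub>m\<^bsub>C\<^esub> ?z = ?x \<otimes>\<^sub>m\<^bsub>C\<^esub> (?y \<otimes>\<^sub>m\<^bsub>C\<^esub> ?z)"
    by (rule tensor_assoc[OF x y z])
  have "(((?x \<otimes>\<^sub>m\<^bsub>C\<^esub> ?y) \<cdot>\<^bsub>C\<^esub> ?psi (fst X h) (fst Y h)) \<otimes>\<^sub>m\<^bsub>C\<^esub> ?z)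
        \<cdot>\<^bsub>C\<^esub> ?psi (fst X h \<otimes>\<^sub>o\<^bsub>C\<^esub> fst Y h) (fst Z h)
      = (?x \<otimes>\<^sub>m\<^bsub>C\<^esub> ?y \<otimes>\<^sub>m\<^bsub>C\<^esub> ?z) \<cdot>\<^bsub>C\<^esub>
        ((?psi (fst X h) (fst Y h) \<otimes>\<^sub>m\<^bsub>C\<^esub> ?I (fst Z h)) \<cdot>\<^bsub>C\<^esub> ?psi (fst X h \<otimes>\<^sub>o\<^bsub>C\<^esub> fst Y h) (fst Z h))"
    using interchange[OF psi_arr[OF g L M] xy IN z]
      assoc[OF psi_arr[OF g tensor_Ob[OF L M] N] arr_tensor[OF psi_arr[OF g L M] IN]
        arr_tensor[OF xy z]]
    by (simp add: Id_right[OF z])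
  also have "\<dots> = (?x \<otimes>\<^sub>m\<^bsub>C\<^esub> (?y \<otimes>\<^sub>m\<^bsub>C\<^esub> ?z)) \<cdot>\<^bsub>C\<^esub>
        ((?I (fst X h) \<otimes>\<^sub>m\<^bsub>C\<^esub> ?psi (fst Y h) (fst Z h)) \<cdot>\<^bsub>C\<^esub> ?psi (fst X h) (fst Y h \<otimes>\<^sub>o\<^bsub>C\<^esub> fst Z h))"
    by (simp add: t psi_coherence[OF g L M N])
  also have "\<dots> = (?x \<otimes>\<^sub>m\<^bsub>C\<^esub> ((?y \<otimes>\<^sub>m\<^bsub>C\<^esub> ?z) \<cdot>\<^bsub>C\<^esub> ?psi (fst Y h) (fst Z h)))
        \<cdot>\<^bsub>C\<^esub> ?psi (fst X h) (fst Y h \<otimes>\<^sub>o\<^bsub>C\<^esub> fst Z h)"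
    using interchange[OF IL x psi_arr[OF g M N] yz]
      assoc[OF psi_arr[OF g L tensor_Ob[OF M N]] arr_tensor[OF IL psi_arr[OF g M N]]
        arr_tensor[OF x yz]]
    by (simp add: Id_right[OF x])
  finally show "snd (family_tensor G C (family_tensor G C X Y) Z) (g, h)
      = snd (family_tensor G C X (family_tensor G C Y Z)) (g, h)"
    using g h by (simp add: family_tensor_eq)
qed

lemma family_unit_obs: "unit_ob (family_category G C) \<in> family_obs G C"
  unfolding family_category_simps
proof (rule family_obsI)
  fix g h k assume "g \<in> carrier G" "h \<in> carrier G" "k \<in> carrier G"
  then show "Id C (unit_ob C) = Id C (unit_ob C) \<cdot>\<^bsub>C\<^esub> act_mor C g (Id C (unit_ob C)) \<cdot>\<^bsub>C\<^esub> phi C g h (unit_ob C)"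
    by (simp add: phi_unit act_Id unit_Ob act_unit Id_left[OF arr_Id])
qed (auto simp: unit_Ob act_unit is_iso_Id is_group)

lemma family_tensor_unit:
  assumes X: "X \<in> family_obs G C"
  shows "family_tensor G C (unit_ob (family_category G C)) X = X"
    and "family_tensor G C X (unit_ob (family_category G C)) = X"
proof -
  note s = Id_right[OF fam_iso_arr[OF X]] tensor_unit_left[OF fam_iso_arr[OF X]]
    tensor_unit_right[OF fam_iso_arr[OF X]]
  show "family_tensor G C (unit_ob (family_category G C)) X = X"
    by (rule family_ob_eqI[OF family_tensor_extensional family_obs_extensional[OF X]])
      (simp_all add: family_tensor_eq fam_Ob[OF X] tensor_ob_unit_left psi_unit_left s)
  show "family_tensor G C X (unit_ob (family_category G C)) = X"
    by (rule family_ob_eqI[OF family_tensor_extensional family_obs_extensional[OF X]])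
      (simp_all add: family_tensor_eq fam_Ob[OF X] tensor_ob_unit_right psi_unit_right s)
qed

lemma monoidal_category_family: "monoidal_category (family_category G C)"
proof (intro monoidal_category.intro category_family, unfold_locales,
    simp_all only: family_category_simps(1-6))
  show "unit_ob (family_category G C) \<in> family_obs G C" by (rule family_unit_obs)
next
  fix X Y assume "X \<in> family_obs G C" "Y \<in> family_obs G C"
  then show "(\<lambda>g \<in> carrier G. family_id G C X g \<otimes>\<^sub>m\<^bsub>C\<^esub> family_id G C Y g)
      = family_id G C (family_tensor G C X Y)"
    by (auto simp: family_id_eq family_tensor_eq fam_Ob tensor_Id intro!: restrict_ext)
next
  fix X Y Z X' Y' Z' f g f' g'
  assume ob: "X \<in> family_obs G C" "Y \<in> family_obs G C" "Z \<in> family_obs G C"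
      "X' \<in> family_obs G C" "Y' \<in> family_obs G C" "Z' \<in> family_obs G C"
    and f: "f \<in> family_hom G C X Y" and g: "g \<in> family_hom G C Y Z"
    and f': "f' \<in> family_hom G C X' Y'" and g': "g' \<in> family_hom G C Y' Z'"
  show "(\<lambda>x \<in> carrier G. (\<lambda>x \<in> carrier G. g x \<cdot>\<^bsub>C\<^esub> f x) x \<otimes>\<^sub>m\<^bsub>C\<^esub> (\<lambda>x \<in> carrier G. g' x \<cdot>\<^bsub>C\<^esub> f' x) x)
      = (\<lambda>x \<in> carrier G. (\<lambda>x \<in> carrier G. g x \<otimes>\<^sub>m\<^bsub>C\<^esub> g' x) x \<cdot>\<^bsub>C\<^esub> (\<lambda>x \<in> carrier G. f x \<otimes>\<^sub>m\<^bsub>C\<^esub> f' x) x)"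
    by (intro restrict_ext)
      (simp add: interchange[OF fam_hom_arr[OF ob(1,2) f] fam_hom_arr[OF ob(2,3) g]
        fam_hom_arr[OF ob(4,5) f'] fam_hom_arr[OF ob(5,6) g']])
next
  fix X Y X' Y' X'' Y'' f f' f''
  assume ob: "X \<in> family_obs G C" "Y \<in> family_obs G C" "X' \<in> family_obs G C" "Y' \<in> family_obs G C"
      "X'' \<in> family_obs G C" "Y'' \<in> family_obs G C"
    and f: "f \<in> family_hom G C X Y" and f': "f' \<in> family_hom G C X' Y'"
    and f'': "f'' \<in> family_hom G C X'' Y''"
  show "(\<lambda>x \<in> carrier G. (\<lambda>x \<in> carrier G. f x \<otimes>\<^sub>m\<^bsub>C\<^esub> f' x) x \<otimes>\<^sub>m\<^bsub>C\<^esub> f'' x)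
      = (\<lambda>x \<in> carrier G. f x \<otimes>\<^sub>m\<^bsub>C\<^esub> (\<lambda>x \<in> carrier G. f' x \<otimes>\<^sub>m\<^bsub>C\<^esub> f'' x) x)"
    by (intro restrict_ext)
      (simp add: tensor_assoc[OF fam_hom_arr[OF ob(1,2) f] fam_hom_arr[OF ob(3,4) f']
        fam_hom_arr[OF ob(5,6) f'']])
next
  fix X Y f assume ob: "X \<in> family_obs G C" "Y \<in> family_obs G C" and f: "f \<in> family_hom G C X Y"
  have "f = restrict f (carrier G)" using f by (simp add: family_hom_iff extensional_restrict)
  then show "(\<lambda>g \<in> carrier G. family_id G C (unit_ob (family_category G C)) g \<otimes>\<^sub>m\<^bsub>C\<^esub> f g) = f"
    "(\<lambda>g \<in> carrier G. f g \<otimes>\<^sub>m\<^bsub>C\<^esub> family_id G C (unit_ob (family_category G C)) g) = f"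
    by (auto simp: family_id_eq tensor_unit_left[OF fam_hom_arr[OF ob f]]
        tensor_unit_right[OF fam_hom_arr[OF ob f]] cong: restrict_cong)
qed (auto intro: family_tensor_obs family_tensor_hom simp: family_tensor_assoc
    simp del: family_category_simps(7) simp: family_tensor_unit)

end


section \<open>The strict action and evaluation at the unit of the group\<close>

text \<open>
  If the action preserves everything on the nose and \<open>\<phi>\<close>, \<open>\<psi>\<close> are identities, then all
  coherence axioms compare composites of identities.
\<close>
lemma strict_monoidal_G_category:
  fixes D :: "('o, 'm, 'g, 'z) crossed_data_scheme"
  assumes "group G" and "monoidal_category D"
    and act: "\<And>g. g \<in> carrier G \<Longrightarrow> is_functor D D (act D g)"
    and act_tensor_ob: "\<And>g X Y. \<lbrakk>g \<in> carrier G; X \<in> Ob D; Y \<in> Ob D\<rbrakk>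
      \<Longrightarrow> act_ob D g (X \<otimes>\<^sub>o\<^bsub>D\<^esub> Y) = act_ob D g X \<otimes>\<^sub>o\<^bsub>D\<^esub> act_ob D g Y"
    and act_tensor_mor: "\<And>g X Y X' Y' f f'. \<lbrakk>g \<in> carrier G; arr D X Y f; arr D X' Y' f'\<rbrakk>
      \<Longrightarrow> act_mor D g (f \<otimes>\<^sub>m\<^bsub>D\<^esub> f') = act_mor D g f \<otimes>\<^sub>m\<^bsub>D\<^esub> act_mor D g f'"
    and act_unit: "\<And>g. g \<in> carrier G \<Longrightarrow> act_ob D g (unit_ob D) = unit_ob D"
    and act_one_ob: "\<And>X. X \<in> Ob D \<Longrightarrow> act_ob D \<one>\<^bsub>G\<^esub> X = X"
    and act_one_mor: "\<And>X Y f. arr D X Y f \<Longrightarrow> act_mor D \<one>\<^bsub>G\<^esub> f = f"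
    and act_mult_ob: "\<And>g h X. \<lbrakk>g \<in> carrier G; h \<in> carrier G; X \<in> Ob D\<rbrakk>
      \<Longrightarrow> act_ob D (g \<otimes>\<^bsub>G\<^esub> h) X = act_ob D g (act_ob D h X)"
    and act_mult_mor: "\<And>g h X Y f. \<lbrakk>g \<in> carrier G; h \<in> carrier G; arr D X Y f\<rbrakk>
      \<Longrightarrow> act_mor D (g \<otimes>\<^bsub>G\<^esub> h) f = act_mor D g (act_mor D h f)"
    and phi: "\<And>g h X. \<lbrakk>g \<in> carrier G; h \<in> carrier G; X \<in> Ob D\<rbrakk>
      \<Longrightarrow> phi D g h X = Id D (act_ob D (g \<otimes>\<^bsub>G\<^esub> h) X)"
    and psi: "\<And>g X Y. \<lbrakk>g \<in> carrier G; X \<in> Ob D; Y \<in> Ob D\<rbrakk>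
      \<Longrightarrow> psi D g X Y = Id D (act_ob D g (X \<otimes>\<^sub>o\<^bsub>D\<^esub> Y))"
  shows "monoidal_G_category G D" and "strict_action G D"
proof -
  interpret group G by fact
  interpret monoidal_category D by fact
  have act_Ob: "act_ob D g X \<in> Ob D" if "g \<in> carrier G" "X \<in> Ob D" for g X
    using functor_Ob[OF act] that by (simp add: act_def)
  have act_Id: "act_mor D g (Id D X) = Id D (act_ob D g X)" if "g \<in> carrier G" "X \<in> Ob D" for g X
    using functor_Id[OF act] that by (simp add: act_def)
  have act_arr: "arr D (act_ob D g X) (act_ob D g Y) (act_mor D g f)"
    if "g \<in> carrier G" "arr D X Y f" for g X Y f
    using functor_arr[OF act] that by (simp add: act_def)
  note Id_Id = Id_left[OF arr_Id]
  show "strict_action G D"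
    by (simp add: strict_action_def act_tensor_ob act_mult_ob phi psi)
  show "monoidal_G_category G D"
  proof (intro monoidal_G_category.intro monoidal_G_category_axioms.intro)
    fix g h assume g: "g \<in> carrier G" and h: "h \<in> carrier G"
    show "natural_iso D D (act D (g \<otimes>\<^bsub>G\<^esub> h)) (comp_functor (act D g) (act D h)) (phi D g h)"
      unfolding natural_iso_def
    proof (intro conjI ballI)
      fix X assume X: "X \<in> Ob D"
      then show "is_iso D (obmap (act D (g \<otimes>\<^bsub>G\<^esub> h)) X)
          (obmap (comp_functor (act D g) (act D h)) X) (phi D g h X)"
        using g h by (simp add: act_def comp_functor_def phi act_mult_ob is_iso_Id act_Ob)
      fix Y f assume "Y \<in> Ob D" "f \<in> Hom D X Y"
      then have f: "arr D X Y f" using X by (simp add: arr_def)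
      note gf = act_arr[OF m_closed[OF g h] f]
      show "phi D g h Y \<cdot>\<^bsub>D\<^esub> mormap (act D (g \<otimes>\<^bsub>G\<^esub> h)) f
          = mormap (comp_functor (act D g) (act D h)) f \<cdot>\<^bsub>D\<^esub> phi D g h X"
        using g h Id_left[OF gf] Id_right[OF gf] arr_source[OF f] arr_target[OF f]
        by (simp add: act_def comp_functor_def phi act_mult_mor[OF g h f])
    qed
  next
    fix g X Y assume "g \<in> carrier G" "X \<in> Ob D" "Y \<in> Ob D"
    then show "is_iso D (act_ob D g (X \<otimes>\<^sub>o\<^bsub>D\<^esub> Y)) (act_ob D g X \<otimes>\<^sub>o\<^bsub>D\<^esub> act_ob D g Y) (psi D g X Y)"
      by (simp add: psi act_tensor_ob tensor_Ob act_Ob is_iso_Id)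
  next
    fix g X X' Y Y' f f'
    assume g: "g \<in> carrier G" and ob: "X \<in> Ob D" "X' \<in> Ob D" "Y \<in> Ob D" "Y' \<in> Ob D"
      and f: "f \<in> Hom D X X'" and f': "f' \<in> Hom D Y Y'"
    have a: "arr D X X' f" "arr D Y Y' f'" using ob f f' by (simp_all add: arr_def)
    note gf = act_arr[OF g arr_tensor[OF a]]
    show "psi D g X' Y' \<cdot>\<^bsub>D\<^esub> act_mor D g (f \<otimes>\<^sub>m\<^bsub>D\<^esub> f')
        = (act_mor D g f \<otimes>\<^sub>m\<^bsub>D\<^esub> act_mor D g f') \<cdot>\<^bsub>D\<^esub> psi D g X Y"
      using Id_left[OF gf] Id_right[OF gf] by (simp add: psi g ob act_tensor_mor[OF g a])
  next
    fix X Y f assume "X \<in> Ob D" "Y \<in> Ob D" "f \<in> Hom D X Y"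
    then show "act_mor D \<one>\<^bsub>G\<^esub> f = f" using act_one_mor by (simp add: arr_def)
  qed (simp_all add: act act_unit act_one_ob act_mult_ob act_tensor_ob phi psi act_Ob act_Id
      tensor_Ob unit_Ob tensor_Id tensor_ob_assoc tensor_ob_unit_left tensor_ob_unit_right Id_Id
      m_assoc is_group monoidal_category_axioms)
qed

text \<open>
  The monoidal structure can be trivial since the tensor product of families is formed
  componentwise; the compatibility with the actions is carried by the components
  \<open>\<eta>\<^sub>g\<^sub>,\<^sub>e : g\<^sub>*(L\<^sub>e) \<rightarrow> L\<^sub>g\<close> instead.
\<close>
definition eval_functor ::
  "('g, 'b) monoid_scheme \<Rightarrow> ('o, 'm, 'z) monoidal_data_scheme
    \<Rightarrow> (('g, 'o, 'm) family_ob, 'g \<Rightarrow> 'm, 'o, 'm) monoidal_functor_data" where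
  "eval_functor G C =
    \<lparr>obmap = (\<lambda>X. fst X \<one>\<^bsub>G\<^esub>),
     mormap = (\<lambda>f. f \<one>\<^bsub>G\<^esub>),
     mult_iso = (\<lambda>X Y. Id C (fst X \<one>\<^bsub>G\<^esub> \<otimes>\<^sub>o\<^bsub>C\<^esub> fst Y \<one>\<^bsub>G\<^esub>)),
     unit_iso = Id C (unit_ob C)\<rparr>"

lemma eval_functor_simps [simp]:
  "obmap (eval_functor G C) X = fst X \<one>\<^bsub>G\<^esub>"
  "mormap (eval_functor G C) f = f \<one>\<^bsub>G\<^esub>"
  "mult_iso (eval_functor G C) X Y = Id C (fst X \<one>\<^bsub>G\<^esub> \<otimes>\<^sub>o\<^bsub>C\<^esub> fst Y \<one>\<^bsub>G\<^esub>)"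
  "unit_iso (eval_functor G C) = Id C (unit_ob C)"
  by (simp_all add: eval_functor_def)

text \<open>
  The free family on an object: \<open>L\<^sub>g = g\<^sub>*(X)\<close> with \<open>\<eta>\<^sub>g\<^sub>,\<^sub>h = \<phi>(g, h)\<^sup>-\<^sup>1\<close>. Its value at \<open>e\<close>
  is \<open>X\<close> itself because \<open>e\<^sub>*\<close> is the identity.
\<close>
definition orbit_functor ::
  "('g, 'b) monoid_scheme \<Rightarrow> ('o, 'm, 'g, 'z) crossed_data_scheme
    \<Rightarrow> ('o, 'm, ('g, 'o, 'm) family_ob, 'g \<Rightarrow> 'm) functor_data" where
  "orbit_functor G C =
    \<lparr>obmap = (\<lambda>X.
       (\<lambda>g \<in> carrier G. act_ob C g X,
        \<lambda>(g, h) \<in> carrier G \<times> carrier G.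
          inverse_arrow C (act_ob C (g \<otimes>\<^bsub>G\<^esub> h) X) (act_ob C g (act_ob C h X)) (phi C g h X))),
     mormap = (\<lambda>f. \<lambda>g \<in> carrier G. act_mor C g f)\<rparr>"

context monoidal_G_category
begin

lemma family_act_obs:
  assumes g: "g \<in> carrier G" and X: "X \<in> family_obs G C"
  shows "family_act G g X \<in> family_obs G C"
  unfolding family_act_eq
  by (rule family_obsI)
    (use g X in \<open>simp_all add: fam_Ob fam_one m_assoc fam_cocycle is_group\<close>,
      use fam_iso[OF X] g m_assoc in \<open>metis m_closed\<close>)

lemma family_act_hom:
  assumes g: "g \<in> carrier G" and f: "f \<in> family_hom G C X Y"
  shows "(\<lambda>h \<in> carrier G. f (h \<otimes>\<^bsub>G\<^esub> g)) \<in> family_hom G C (family_act G g X) (family_act G g Y)"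
  using g f by (simp add: family_hom_iff family_act_eq m_assoc)

text \<open>
  The action is by right translation of the index, which is strictly associative and commutes with
  everything that is done componentwise. This is where the strictness comes from.
\<close>
lemma
  shows monoidal_G_category_family: "monoidal_G_category G (family_category G C)"
    and strict_action_family: "strict_action G (family_category G C)"
proof -
  have act_is_functor: "is_functor (family_category G C) (family_category G C) (act (family_category G C) g)"
    if g: "g \<in> carrier G" for g
    unfolding is_functor_def
  proof (intro conjI ballI)
    show "mormap (act (family_category G C) g) (Id (family_category G C) X)
        = Id (family_category G C) (obmap (act (family_category G C) g) X)" for X
      using g by (auto simp: act_def family_id_eq family_act_eq intro!: restrict_ext)
    show "mormap (act (family_category G C) g) (f' \<cdot>\<^bsub>family_category G C\<^esub> f)
        = mormap (act (family_category G C) g) f'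
          \<cdot>\<^bsub>family_category G C\<^esub> mormap (act (family_category G C) g) f" for f f'
      using g by (auto simp: act_def intro!: restrict_ext)
  qed (simp_all add: act_def family_act_obs[OF g] family_act_hom[OF g])
  have tensor: "family_act G g (family_tensor G C X Y)
      = family_tensor G C (family_act G g X) (family_act G g Y)"
    if "g \<in> carrier G" for g X Y
    using that
    by (intro family_ob_eqI[OF family_act_extensional family_tensor_extensional])
      (simp_all add: family_act_eq family_tensor_eq m_assoc)
  have one: "family_act G \<one>\<^bsub>G\<^esub> X = X" if "X \<in> family_obs G C" for X
    by (rule family_ob_eqI[OF family_act_extensional family_obs_extensional[OF that]])
      (simp_all add: family_act_eq)
  have mult: "family_act G (g \<otimes>\<^bsub>G\<^esub> h) X = family_act G g (family_act G h X)"
    if "g \<in> carrier G" "h \<in> carrier G" for g h X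
    using that
    by (intro family_ob_eqI[OF family_act_extensional family_act_extensional]) (simp_all add: family_act_eq m_assoc)
  have unit: "family_act G g (unit_ob (family_category G C)) = unit_ob (family_category G C)"
    if "g \<in> carrier G" for g
    using that
    by (intro family_ob_eqI[OF family_act_extensional family_obs_extensional[OF family_unit_obs]])
      (simp_all add: family_act_eq)
  have hom_ext: "(\<lambda>h \<in> carrier G. f h) = f" if "arr (family_category G C) X Y f" for X Y f
    using that by (simp add: arr_def family_hom_iff extensional_restrict)
  note * = strict_monoidal_G_category[OF is_group monoidal_category_family act_is_functor]
  show "monoidal_G_category G (family_category G C)"
    by (rule *) (simp_all add: tensor one mult unit hom_ext m_assoc del: family_category_simps(7)
        cong: restrict_cong)
  show "strict_action G (family_category G C)"
    by (rule *) (simp_all add: tensor one mult unit hom_ext m_assoc del: family_category_simps(7)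
        cong: restrict_cong)
qed

lemma eval_is_functor: "is_functor (family_category G C) C (eval_functor G C)"
  unfolding is_functor_def by (auto simp: fam_Ob family_hom_iff family_id_eq)

text \<open>
  The condition on an arrow of families at \<open>(g, e)\<close> reads
  \<open>f\<^sub>g \<cdot> \<eta>\<^sub>g\<^sub>,\<^sub>e = \<chi>\<^sub>g\<^sub>,\<^sub>e \<cdot> g\<^sub>*(f\<^sub>e)\<close>, and \<open>\<eta>\<^sub>g\<^sub>,\<^sub>e\<close> is invertible, so \<open>f\<^sub>e\<close> determines \<open>f\<close>.
\<close>
lemma eval_faithful:
  assumes X: "X \<in> family_obs G C" and Y: "Y \<in> family_obs G C"
    and f: "f \<in> family_hom G C X Y" and f': "f' \<in> family_hom G C X Y"
    and eq: "f \<one>\<^bsub>G\<^esub> = f' \<one>\<^bsub>G\<^esub>"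
  shows "f = f'"
proof (rule family_hom_eqI[OF f f'])
  fix g assume g: "g \<in> carrier G"
  show "f g = f' g"
    using fam_iso[OF X g one_closed] fam_hom_square[OF f g one_closed]
      fam_hom_square[OF f' g one_closed] g eq
    by (auto intro: iso_cancel_right[OF _ act_Ob[OF g fam_Ob[OF X one_closed]]
          fam_hom_arr[OF X Y f g] fam_hom_arr[OF X Y f' g]])
qed

text \<open>
  The same formula defines \<open>f\<close> from \<open>u\<close>. That the result satisfies the remaining conditions at
  \<open>(g, h)\<close> follows from the cocycle conditions of both families at \<open>(g, h, e)\<close> and the naturality
  of \<open>\<phi>(g, h)\<close>.
\<close>
lemma eval_full:
  assumes X: "X \<in> family_obs G C" and Y: "Y \<in> family_obs G C"
    and u: "u \<in> Hom C (fst X \<one>\<^bsub>G\<^esub>) (fst Y \<one>\<^bsub>G\<^esub>)"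
  shows "\<exists>f \<in> family_hom G C X Y. f \<one>\<^bsub>G\<^esub> = u"
proof -
  let ?x = "\<lambda>g. snd X (g, \<one>\<^bsub>G\<^esub>)" and ?y = "\<lambda>g. snd Y (g, \<one>\<^bsub>G\<^esub>)"
  have u: "arr C (fst X \<one>\<^bsub>G\<^esub>) (fst Y \<one>\<^bsub>G\<^esub>) u"
    using u X Y by (simp add: arr_def fam_Ob)
  define i where "i g = inverse_arrow C (act_ob C g (fst X \<one>\<^bsub>G\<^esub>)) (fst X g) (?x g)" for g
  define f where "f = (\<lambda>g \<in> carrier G. ?y g \<cdot>\<^bsub>C\<^esub> act_mor C g u \<cdot>\<^bsub>C\<^esub> i g)"
  have x_iso: "is_iso C (act_ob C g (fst X \<one>\<^bsub>G\<^esub>)) (fst X g) (?x g)"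
    and x: "arr C (act_ob C g (fst X \<one>\<^bsub>G\<^esub>)) (fst X g) (?x g)"
    and y: "arr C (act_ob C g (fst Y \<one>\<^bsub>G\<^esub>)) (fst Y g) (?y g)" if "g \<in> carrier G" for g
    using fam_iso[OF X that one_closed] fam_iso_arr[OF X that one_closed]
      fam_iso_arr[OF Y that one_closed] that by simp_all
  have i: "arr C (fst X g) (act_ob C g (fst X \<one>\<^bsub>G\<^esub>)) (i g)" and ix: "i g \<cdot>\<^bsub>C\<^esub> ?x g = Id C (act_ob C g (fst X \<one>\<^bsub>G\<^esub>))"
    if "g \<in> carrier G" for g
    unfolding i_def using inverse_arrow_arr[OF x_iso] inverse_arrow_left[OF x_iso] that X
    by (simp_all add: act_Ob fam_Ob)
  have f_arr: "arr C (fst X g) (fst Y g) (f g)" if "g \<in> carrier G" for g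
    unfolding f_def using arr_comp[OF i[OF that] arr_comp[OF act_arr[OF that u] y[OF that]]] that
    by simp
  have fx: "f g \<cdot>\<^bsub>C\<^esub> ?x g = ?y g \<cdot>\<^bsub>C\<^esub> act_mor C g u" if g: "g \<in> carrier G" for g
    using assoc[OF x[OF g] i[OF g] arr_comp[OF act_arr[OF g u] y[OF g]]] ix[OF g]
      Id_right[OF arr_comp[OF act_arr[OF g u] y[OF g]]] g
    by (simp add: f_def)
  have "f (g \<otimes>\<^bsub>G\<^esub> h) \<cdot>\<^bsub>C\<^esub> snd X (g, h) = snd Y (g, h) \<cdot>\<^bsub>C\<^esub> act_mor C g (f h)"
    if g: "g \<in> carrier G" and h: "h \<in> carrier G" for g h
  proof -
    note gh = m_closed[OF g h]
    let ?X = "fst X \<one>\<^bsub>G\<^esub>" and ?Y = "fst Y \<one>\<^bsub>G\<^esub>"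
    have ob: "?X \<in> Ob C" "?Y \<in> Ob C" using X Y by (simp_all add: fam_Ob)
    let ?p = "phi C g h ?X" and ?q = "phi C g h ?Y"
    note p = phi_arr[OF g h ob(1)] and q = phi_arr[OF g h ob(2)]
    note gx = act_arr[OF g x[OF h]] and gy = act_arr[OF g y[OF h]] and gf = act_arr[OF g f_arr[OF h]]
    note ghu = act_arr[OF g act_arr[OF h u]]
    note X_gh = fam_iso_arr[OF X g h] and Y_gh = fam_iso_arr[OF Y g h]
    have e: "is_iso C (act_ob C (g \<otimes>\<^bsub>G\<^esub> h) ?X) (act_ob C g (fst X h)) (act_mor C g (?x h) \<cdot>\<^bsub>C\<^esub> ?p)"
      by (rule is_iso_comp[OF phi_iso act_iso[OF g x_iso]])
        (use g h X in \<open>simp_all add: act_Ob fam_Ob\<close>)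
    \<comment> \<open>By the cocycle condition, precomposing with this isomorphism completes \<open>\<eta>\<^sub>g\<^sub>,\<^sub>h\<close> to
      \<open>\<eta>\<^sub>g\<^sub>h\<^sub>,\<^sub>e\<close>, to which the definition of \<open>f\<close> applies.\<close>
    have "(f (g \<otimes>\<^bsub>G\<^esub> h) \<cdot>\<^bsub>C\<^esub> snd X (g, h)) \<cdot>\<^bsub>C\<^esub> (act_mor C g (?x h) \<cdot>\<^bsub>C\<^esub> ?p)
        = f (g \<otimes>\<^bsub>G\<^esub> h) \<cdot>\<^bsub>C\<^esub> (snd X (g, h) \<cdot>\<^bsub>C\<^esub> act_mor C g (?x h) \<cdot>\<^bsub>C\<^esub> ?p)"
      using assoc[OF arr_comp[OF p gx] X_gh f_arr[OF gh]] assoc[OF p gx X_gh] by simp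
    also have "\<dots> = ?y (g \<otimes>\<^bsub>G\<^esub> h) \<cdot>\<^bsub>C\<^esub> act_mor C (g \<otimes>\<^bsub>G\<^esub> h) u"
      using fx[OF gh] fam_cocycle[OF X g h one_closed] h by simp
    also have "\<dots> = (snd Y (g, h) \<cdot>\<^bsub>C\<^esub> act_mor C g (?y h)) \<cdot>\<^bsub>C\<^esub> (?q \<cdot>\<^bsub>C\<^esub> act_mor C (g \<otimes>\<^bsub>G\<^esub> h) u)"
      using fam_cocycle[OF Y g h one_closed] h assoc[OF act_arr[OF gh u] q arr_comp[OF gy Y_gh]]
      by simp
    also have "\<dots> = snd Y (g, h) \<cdot>\<^bsub>C\<^esub> (act_mor C g (?y h \<cdot>\<^bsub>C\<^esub> act_mor C h u) \<cdot>\<^bsub>C\<^esub> ?p)"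
      using assoc[OF arr_comp[OF p ghu] gy Y_gh] assoc[OF p ghu gy]
      by (simp add: phi_natural[OF g h u] act_comp[OF g act_arr[OF h u] y[OF h]])
    also have "\<dots> = (snd Y (g, h) \<cdot>\<^bsub>C\<^esub> act_mor C g (f h)) \<cdot>\<^bsub>C\<^esub> (act_mor C g (?x h) \<cdot>\<^bsub>C\<^esub> ?p)"
      using assoc[OF arr_comp[OF p gx] gf Y_gh] assoc[OF p gx gf]
      by (simp add: fx[OF h, symmetric] act_comp[OF g x[OF h] f_arr[OF h]])
    finally show ?thesis
      by (rule iso_cancel_right[OF e act_Ob[OF gh ob(1)] arr_comp[OF X_gh f_arr[OF gh]]
            arr_comp[OF gf Y_gh]])
  qed
  then have "f \<in> family_hom G C X Y"
    unfolding family_hom_iff using arr_Hom[OF f_arr] by (auto simp: f_def)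
  moreover have "f \<one>\<^bsub>G\<^esub> = u"
  proof -
    have "f \<one>\<^bsub>G\<^esub> \<cdot>\<^bsub>C\<^esub> Id C (fst X \<one>\<^bsub>G\<^esub>) = Id C (fst Y \<one>\<^bsub>G\<^esub>) \<cdot>\<^bsub>C\<^esub> u"
      using fx[OF one_closed] act_one_mor[OF arr_source[OF u] arr_target[OF u] arr_Hom[OF u]]
      by (simp add: fam_one[OF X] fam_one[OF Y])
    then show ?thesis using Id_right[OF f_arr[OF one_closed]] Id_left[OF u] by simp
  qed
  ultimately show ?thesis by blast
qed

text \<open>
  The cocycle condition is the inverse of the coherence axiom for \<open>\<phi>\<close>.
\<close>
lemma orbit_obs:
  assumes X: "X \<in> Ob C"
  shows "obmap (orbit_functor G C) X \<in> family_obs G C"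
proof -
  define i where "i g h = inverse_arrow C (act_ob C (g \<otimes>\<^bsub>G\<^esub> h) X) (act_ob C g (act_ob C h X)) (phi C g h X)" for g h
  have iso: "is_iso C (act_ob C g (act_ob C h X)) (act_ob C (g \<otimes>\<^bsub>G\<^esub> h) X) (i g h)"
    and arr_i: "arr C (act_ob C g (act_ob C h X)) (act_ob C (g \<otimes>\<^bsub>G\<^esub> h) X) (i g h)"
    and i_phi: "i g h \<cdot>\<^bsub>C\<^esub> phi C g h X = Id C (act_ob C (g \<otimes>\<^bsub>G\<^esub> h) X)"
    if "g \<in> carrier G" "h \<in> carrier G" for g h
    unfolding i_def using that X phi_iso[OF that X]
    by (simp_all add: is_iso_inverse_arrow inverse_arrow_arr inverse_arrow_left act_Ob)
  have "(\<lambda>g \<in> carrier G. act_ob C g X, \<lambda>(g, h) \<in> carrier G \<times> carrier G. i g h) \<in> family_obs G C"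
  proof (rule family_obsI)
    fix g assume g: "g \<in> carrier G"
    have a: "arr C (act_ob C g X) (act_ob C g X) (i \<one>\<^bsub>G\<^esub> g)"
      using arr_i[OF one_closed g] g X by (simp add: act_one_ob act_Ob)
    show "i \<one>\<^bsub>G\<^esub> g = Id C (act_ob C g X)"
      using i_phi[OF one_closed g] Id_right[OF a] g X by (simp add: phi_one_left)
  next
    fix g h k assume g: "g \<in> carrier G" and h: "h \<in> carrier G" and k: "k \<in> carrier G"
    note gh = m_closed[OF g h] and hk = m_closed[OF h k] and kX = act_Ob[OF k X]
    note ghk = act_Ob[OF m_closed[OF gh k] X]
    note p = phi_arr[OF gh k X] and q = phi_arr[OF g h kX]
      and r = act_arr[OF g phi_arr[OF h k X]] and s = phi_arr[OF g hk X]
    note gi = act_arr[OF g arr_i[OF h k]] and gi' = arr_i[OF g hk]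
    have gi_r: "act_mor C g (i h k) \<cdot>\<^bsub>C\<^esub> act_mor C g (phi C h k X) = Id C (act_ob C g (act_ob C (h \<otimes>\<^bsub>G\<^esub> k) X))"
      using act_comp[OF g phi_arr[OF h k X] arr_i[OF h k]] i_phi[OF h k] act_Id[OF g act_Ob[OF hk X]]
      by simp
    have "(i g (h \<otimes>\<^bsub>G\<^esub> k) \<cdot>\<^bsub>C\<^esub> act_mor C g (i h k) \<cdot>\<^bsub>C\<^esub> phi C g h (act_ob C k X)) \<cdot>\<^bsub>C\<^esub> phi C (g \<otimes>\<^bsub>G\<^esub> h) k X
        = (i g (h \<otimes>\<^bsub>G\<^esub> k) \<cdot>\<^bsub>C\<^esub> act_mor C g (i h k))
          \<cdot>\<^bsub>C\<^esub> (act_mor C g (phi C h k X) \<cdot>\<^bsub>C\<^esub> phi C g (h \<otimes>\<^bsub>G\<^esub> k) X)"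
      using assoc[OF p q arr_comp[OF gi gi']] by (simp add: phi_coherence[OF g h k X])
    also have "\<dots> = i g (h \<otimes>\<^bsub>G\<^esub> k) \<cdot>\<^bsub>C\<^esub>
        ((act_mor C g (i h k) \<cdot>\<^bsub>C\<^esub> act_mor C g (phi C h k X)) \<cdot>\<^bsub>C\<^esub> phi C g (h \<otimes>\<^bsub>G\<^esub> k) X)"
      using assoc[OF arr_comp[OF s r] gi gi'] assoc[OF s r gi] by simp
    also have "\<dots> = Id C (act_ob C (g \<otimes>\<^bsub>G\<^esub> h \<otimes>\<^bsub>G\<^esub> k) X)"
      using i_phi[OF g hk] Id_left[OF s] g h k by (simp add: gi_r m_assoc)
    also have "\<dots> = i (g \<otimes>\<^bsub>G\<^esub> h) k \<cdot>\<^bsub>C\<^esub> phi C (g \<otimes>\<^bsub>G\<^esub> h) k X"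
      by (simp add: i_phi[OF gh k])
    finally show "i (g \<otimes>\<^bsub>G\<^esub> h) k
        = i g (h \<otimes>\<^bsub>G\<^esub> k) \<cdot>\<^bsub>C\<^esub> act_mor C g (i h k) \<cdot>\<^bsub>C\<^esub> phi C g h (act_ob C k X)"
      by (intro iso_cancel_right[OF phi_iso[OF gh k X] ghk arr_i[OF gh k]])
        (use arr_comp[OF q arr_comp[OF gi gi']] g h k in \<open>simp_all add: m_assoc\<close>)
  qed (use X iso in \<open>simp_all add: act_Ob is_group\<close>)
  then show ?thesis by (simp add: orbit_functor_def i_def)
qed

text \<open>
  The condition on arrows of families is here the naturality of \<open>\<phi>(g, h)\<^sup>-\<^sup>1\<close>.
\<close>
lemma orbit_hom:
  assumes f: "arr C X Y f"
  shows "mormap (orbit_functor G C) f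
    \<in> family_hom G C (obmap (orbit_functor G C) X) (obmap (orbit_functor G C) Y)"
proof -
  have X: "X \<in> Ob C" and Y: "Y \<in> Ob C" using f by (simp_all add: arr_def)
  let ?i = "\<lambda>X g h. inverse_arrow C (act_ob C (g \<otimes>\<^bsub>G\<^esub> h) X) (act_ob C g (act_ob C h X)) (phi C g h X)"
  have "act_mor C (g \<otimes>\<^bsub>G\<^esub> h) f \<cdot>\<^bsub>C\<^esub> ?i X g h = ?i Y g h \<cdot>\<^bsub>C\<^esub> act_mor C g (act_mor C h f)"
    if g: "g \<in> carrier G" and h: "h \<in> carrier G" for g h
  proof -
    note gh = m_closed[OF g h]
    note p = phi_arr[OF g h X] and q = phi_arr[OF g h Y]
    have i: "arr C (act_ob C g (act_ob C h X)) (act_ob C (g \<otimes>\<^bsub>G\<^esub> h) X) (?i X g h)"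
      and j: "arr C (act_ob C g (act_ob C h Y)) (act_ob C (g \<otimes>\<^bsub>G\<^esub> h) Y) (?i Y g h)"
      using phi_iso[OF g h X] phi_iso[OF g h Y] X Y g h
      by (simp_all add: inverse_arrow_arr act_Ob)
    note ghf = act_arr[OF g act_arr[OF h f]] and gh_f = act_arr[OF gh f]
    have "(?i Y g h \<cdot>\<^bsub>C\<^esub> act_mor C g (act_mor C h f)) \<cdot>\<^bsub>C\<^esub> phi C g h X = act_mor C (g \<otimes>\<^bsub>G\<^esub> h) f"
      using assoc[OF p ghf j] assoc[OF gh_f q j] Id_left[OF gh_f]
      by (simp add: phi_natural[OF g h f, symmetric] inverse_arrow_left[OF phi_iso[OF g h Y]])
    also have "\<dots> = (act_mor C (g \<otimes>\<^bsub>G\<^esub> h) f \<cdot>\<^bsub>C\<^esub> ?i X g h) \<cdot>\<^bsub>C\<^esub> phi C g h X"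
      using assoc[OF p i gh_f] Id_right[OF gh_f] by (simp add: inverse_arrow_left[OF phi_iso[OF g h X]])
    finally show ?thesis
      using iso_cancel_right[OF phi_iso[OF g h X] act_Ob[OF gh X] arr_comp[OF i gh_f]
          arr_comp[OF ghf j]] by simp
  qed
  then show ?thesis
    using arr_Hom[OF act_arr[OF _ f]] by (simp add: family_hom_iff orbit_functor_def)
qed

lemma orbit_is_functor: "is_functor C (family_category G C) (orbit_functor G C)"
  unfolding is_functor_def
proof (intro conjI ballI)
  fix X Y Z f g assume "X \<in> Ob C" "Y \<in> Ob C" "Z \<in> Ob C" "f \<in> Hom C X Y" "g \<in> Hom C Y Z"
  then have "arr C X Y f" "arr C Y Z g" by (simp_all add: arr_def)
  then show "mormap (orbit_functor G C) (g \<cdot>\<^bsub>C\<^esub> f)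
      = mormap (orbit_functor G C) g \<cdot>\<^bsub>family_category G C\<^esub> mormap (orbit_functor G C) f"
    by (auto simp: orbit_functor_def act_comp intro!: restrict_ext)
next
  fix X assume "X \<in> Ob C"
  then show "mormap (orbit_functor G C) (Id C X)
      = Id (family_category G C) (obmap (orbit_functor G C) X)"
    by (auto simp: orbit_functor_def family_id_eq act_Id intro!: restrict_ext)
qed (simp_all add: orbit_obs orbit_hom arr_def)

lemma eval_orbit: "X \<in> Ob C \<Longrightarrow> fst (obmap (orbit_functor G C) X) \<one>\<^bsub>G\<^esub> = X"
  by (simp add: orbit_functor_def act_one_ob)

lemma surjective_equivalence_eval: "surjective_equivalence (family_category G C) C (eval_functor G C)"
proof (intro surjective_equivalence.intro surjective_equivalence_axioms.intro category_family
    category_axioms eval_is_functor)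
  show "\<exists>X \<in> Ob (family_category G C). obmap (eval_functor G C) X = Z" if "Z \<in> Ob C" for Z
    using orbit_obs[OF that] eval_orbit[OF that] by auto
  fix X Y assume XY: "X \<in> Ob (family_category G C)" "Y \<in> Ob (family_category G C)"
  show "bij_betw (mormap (eval_functor G C)) (Hom (family_category G C) X Y)
      (Hom C (obmap (eval_functor G C) X) (obmap (eval_functor G C) Y))"
    unfolding bij_betw_def
  proof
    show "inj_on (mormap (eval_functor G C)) (Hom (family_category G C) X Y)"
      using XY eval_faithful[of X Y] by (auto intro!: inj_onI)
    show "mormap (eval_functor G C) ` Hom (family_category G C) X Y
        = Hom C (obmap (eval_functor G C) X) (obmap (eval_functor G C) Y)"
    proof
      show "mormap (eval_functor G C) ` Hom (family_category G C) X Y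
          \<subseteq> Hom C (obmap (eval_functor G C) X) (obmap (eval_functor G C) Y)"
        by (auto simp: family_hom_iff)
      show "Hom C (obmap (eval_functor G C) X) (obmap (eval_functor G C) Y)
          \<subseteq> mormap (eval_functor G C) ` Hom (family_category G C) X Y"
        using eval_full XY by (fastforce simp: image_iff)
    qed
  qed
qed

text \<open>
  Evaluating the orbit of \<open>X\<close> gives back \<open>X\<close>. In the other direction, the comparison from a
  family to the orbit of its value at \<open>e\<close> is the unique lift of an identity, and its naturality
  may be checked after evaluation, where it is trivial.
\<close>
lemma category_equivalence_eval: "category_equivalence (family_category G C) C (eval_functor G C)"
proof -
  interpret F: surjective_equivalence "family_category G C" C "eval_functor G C"
    by (rule surjective_equivalence_eval)
  let ?H = "orbit_functor G C" and ?D = "family_category G C"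
  have HF: "obmap ?H (fst X \<one>\<^bsub>G\<^esub>) \<in> family_obs G C"
    "fst (obmap ?H (fst X \<one>\<^bsub>G\<^esub>)) \<one>\<^bsub>G\<^esub> = fst X \<one>\<^bsub>G\<^esub>" if "X \<in> family_obs G C" for X
    using that by (simp_all add: orbit_obs eval_orbit fam_Ob)
  have "\<forall>X \<in> family_obs G C. \<exists>t. t \<in> family_hom G C X (obmap ?H (fst X \<one>\<^bsub>G\<^esub>)) \<and> t \<one>\<^bsub>G\<^esub> = Id C (fst X \<one>\<^bsub>G\<^esub>)"
  proof
    fix X assume X: "X \<in> family_obs G C"
    show "\<exists>t. t \<in> family_hom G C X (obmap ?H (fst X \<one>\<^bsub>G\<^esub>)) \<and> t \<one>\<^bsub>G\<^esub> = Id C (fst X \<one>\<^bsub>G\<^esub>)"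
      using eval_full[OF X HF(1)[OF X], of "Id C (fst X \<one>\<^bsub>G\<^esub>)"] HF(2)[OF X] X
      by (auto simp: Id_in_Hom fam_Ob)
  qed
  from bchoice[OF this] obtain \<tau> where \<tau>: "\<And>X. X \<in> family_obs G C \<Longrightarrow> \<tau> X \<in> family_hom G C X (obmap ?H (fst X \<one>\<^bsub>G\<^esub>))"
    and \<tau>1: "\<And>X. X \<in> family_obs G C \<Longrightarrow> \<tau> X \<one>\<^bsub>G\<^esub> = Id C (fst X \<one>\<^bsub>G\<^esub>)"
    by blast
  have "natural_iso ?D ?D id_functor (comp_functor ?H (eval_functor G C)) \<tau>"
    unfolding natural_iso_def
  proof (intro conjI ballI)
    fix X assume "X \<in> Ob ?D"
    then have X: "X \<in> family_obs G C" by simp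
    have "is_iso C (fst X \<one>\<^bsub>G\<^esub>) (fst (obmap ?H (fst X \<one>\<^bsub>G\<^esub>)) \<one>\<^bsub>G\<^esub>) (\<tau> X \<one>\<^bsub>G\<^esub>)"
      using X by (simp add: HF(2) \<tau>1 is_iso_Id fam_Ob)
    then show "is_iso ?D (obmap id_functor X) (obmap (comp_functor ?H (eval_functor G C)) X) (\<tau> X)"
      using F.is_iso_iff[of X "obmap ?H (fst X \<one>\<^bsub>G\<^esub>)" "\<tau> X"] X HF(1)[OF X] \<tau>[OF X]
      by (simp add: id_functor_def comp_functor_def)
    fix Y f assume "Y \<in> Ob ?D" "f \<in> Hom ?D X Y"
    then have Y: "Y \<in> family_obs G C" and f: "f \<in> family_hom G C X Y" by simp_all
    note f1 = fam_hom_arr[OF X Y f one_closed]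
    note Hf = orbit_hom[OF f1]
    have "\<tau> Y \<cdot>\<^bsub>?D\<^esub> f = mormap ?H (f \<one>\<^bsub>G\<^esub>) \<cdot>\<^bsub>?D\<^esub> \<tau> X"
      unfolding family_category_simps
    proof (rule eval_faithful[OF X HF(1)[OF Y]])
      show "(\<lambda>g \<in> carrier G. \<tau> Y g \<cdot>\<^bsub>C\<^esub> f g) \<in> family_hom G C X (obmap ?H (fst Y \<one>\<^bsub>G\<^esub>))"
        by (rule family_comp[OF X Y HF(1)[OF Y] f \<tau>[OF Y]])
      show "(\<lambda>g \<in> carrier G. mormap ?H (f \<one>\<^bsub>G\<^esub>) g \<cdot>\<^bsub>C\<^esub> \<tau> X g) \<in> family_hom G C X (obmap ?H (fst Y \<one>\<^bsub>G\<^esub>))"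
        by (rule family_comp[OF X HF(1)[OF X] HF(1)[OF Y] \<tau>[OF X] Hf])
      show "(\<lambda>g \<in> carrier G. \<tau> Y g \<cdot>\<^bsub>C\<^esub> f g) \<one>\<^bsub>G\<^esub>
          = (\<lambda>g \<in> carrier G. mormap ?H (f \<one>\<^bsub>G\<^esub>) g \<cdot>\<^bsub>C\<^esub> \<tau> X g) \<one>\<^bsub>G\<^esub>"
        using act_one_mor[OF arr_source[OF f1] arr_target[OF f1] arr_Hom[OF f1]]
        by (simp add: \<tau>1 X Y Id_left[OF f1] Id_right[OF f1] orbit_functor_def)
    qed
    then show "\<tau> Y \<cdot>\<^bsub>?D\<^esub> mormap id_functor f
        = mormap (comp_functor ?H (eval_functor G C)) f \<cdot>\<^bsub>?D\<^esub> \<tau> X"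
      by (simp add: id_functor_def comp_functor_def)
  qed
  moreover have "natural_iso C C (comp_functor (eval_functor G C) ?H) id_functor (Id C)"
    unfolding natural_iso_def
  proof (intro conjI ballI)
    fix X assume X: "X \<in> Ob C"
    then show "is_iso C (obmap (comp_functor (eval_functor G C) ?H) X) (obmap id_functor X) (Id C X)"
      by (simp add: id_functor_def comp_functor_def eval_orbit is_iso_Id)
    fix Y f assume Y: "Y \<in> Ob C" and f: "f \<in> Hom C X Y"
    then have "arr C X Y f" using X by (simp add: arr_def)
    then show "Id C Y \<cdot>\<^bsub>C\<^esub> mormap (comp_functor (eval_functor G C) ?H) f = mormap id_functor f \<cdot>\<^bsub>C\<^esub> Id C X"
      by (simp add: id_functor_def comp_functor_def orbit_functor_def act_one_mor[OF X Y f]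
          Id_left Id_right)
  qed
  ultimately show ?thesis
    unfolding category_equivalence_def using eval_is_functor orbit_is_functor by blast
qed

lemma eval_monoidal_functor: "monoidal_functor (family_category G C) C (eval_functor G C)"
  unfolding monoidal_functor_def
proof (intro conjI ballI)
  fix X X' Y Y' f g
  assume "X \<in> Ob (family_category G C)" "X' \<in> Ob (family_category G C)"
    "Y \<in> Ob (family_category G C)" "Y' \<in> Ob (family_category G C)"
    "f \<in> Hom (family_category G C) X X'" "g \<in> Hom (family_category G C) Y Y'"
  then have "arr C (fst X \<one>\<^bsub>G\<^esub>) (fst X' \<one>\<^bsub>G\<^esub>) (f \<one>\<^bsub>G\<^esub>)"
    "arr C (fst Y \<one>\<^bsub>G\<^esub>) (fst Y' \<one>\<^bsub>G\<^esub>) (g \<one>\<^bsub>G\<^esub>)"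
    by (simp_all add: fam_hom_arr)
  note a = arr_tensor[OF this]
  show "mult_iso (eval_functor G C) X' Y' \<cdot>\<^bsub>C\<^esub> mormap (eval_functor G C) (f \<otimes>\<^sub>m\<^bsub>family_category G C\<^esub> g)
      = (mormap (eval_functor G C) f \<otimes>\<^sub>m\<^bsub>C\<^esub> mormap (eval_functor G C) g)
        \<cdot>\<^bsub>C\<^esub> mult_iso (eval_functor G C) X Y"
    by (simp add: Id_left[OF a] Id_right[OF a])
qed (simp_all add: eval_is_functor family_tensor_eq fam_Ob tensor_Ob unit_Ob is_iso_Id tensor_Id
    tensor_ob_assoc tensor_ob_unit_left tensor_ob_unit_right Id_left[OF arr_Id])

text \<open>
  The axioms for the comparison \<open>\<eta>\<^sub>g\<^sub>,\<^sub>e\<close> are the definitions of the category of families read at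
  \<open>e\<close>: naturality is the condition on arrows, monoidality is the formula for the tensor product,
  and the compatibility with \<open>\<phi>\<close> is the cocycle condition.
\<close>
lemma eval_monoidal_G_functor:
  "monoidal_G_functor G (family_category G C) C (eval_functor G C) (\<lambda>g X. snd X (g, \<one>\<^bsub>G\<^esub>))"
  unfolding monoidal_G_functor_def
proof (intro conjI ballI eval_monoidal_functor)
  let ?D = "family_category G C" and ?F = "eval_functor G C"
  fix g assume g: "g \<in> carrier G"
  show "monoidal_natural_iso ?D C (comp_monoidal_functor C (monoidal_act C g) ?F)
      (comp_monoidal_functor C ?F (monoidal_act ?D g)) (\<lambda>X. snd X (g, \<one>\<^bsub>G\<^esub>))"
    unfolding monoidal_natural_iso_def natural_iso_def
  proof (intro conjI ballI)
    fix X assume "X \<in> Ob ?D"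
    then have X: "X \<in> family_obs G C" by simp
    show "is_iso C (obmap (comp_monoidal_functor C (monoidal_act C g) ?F) X)
        (obmap (comp_monoidal_functor C ?F (monoidal_act ?D g)) X) (snd X (g, \<one>\<^bsub>G\<^esub>))"
      using fam_iso[OF X g one_closed] g
      by (simp add: comp_monoidal_functor_def monoidal_act_def family_act_eq)
    fix Y assume "Y \<in> Ob ?D"
    then have Y: "Y \<in> family_obs G C" by simp
    show "snd Y (g, \<one>\<^bsub>G\<^esub>) \<cdot>\<^bsub>C\<^esub> mormap (comp_monoidal_functor C (monoidal_act C g) ?F) f
        = mormap (comp_monoidal_functor C ?F (monoidal_act ?D g)) f \<cdot>\<^bsub>C\<^esub> snd X (g, \<one>\<^bsub>G\<^esub>)"
      if "f \<in> Hom ?D X Y" for f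
      using fam_hom_square[of f G C X Y g "\<one>\<^bsub>G\<^esub>"] that g
      by (simp add: comp_monoidal_functor_def monoidal_act_def)
    have ob: "fst X \<one>\<^bsub>G\<^esub> \<in> Ob C" "fst Y \<one>\<^bsub>G\<^esub> \<in> Ob C" using X Y by (simp_all add: fam_Ob)
    have a: "arr C (act_ob C g (fst X \<one>\<^bsub>G\<^esub>) \<otimes>\<^sub>o\<^bsub>C\<^esub> act_ob C g (fst Y \<one>\<^bsub>G\<^esub>)) (fst X g \<otimes>\<^sub>o\<^bsub>C\<^esub> fst Y g)
        (snd X (g, \<one>\<^bsub>G\<^esub>) \<otimes>\<^sub>m\<^bsub>C\<^esub> snd Y (g, \<one>\<^bsub>G\<^esub>))"
      using arr_tensor[OF fam_iso_arr[OF X g one_closed] fam_iso_arr[OF Y g one_closed]] g by simp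
    note p = psi_arr[OF g ob]
    show "(snd X (g, \<one>\<^bsub>G\<^esub>) \<otimes>\<^sub>m\<^bsub>C\<^esub> snd Y (g, \<one>\<^bsub>G\<^esub>))
          \<cdot>\<^bsub>C\<^esub> mult_iso (comp_monoidal_functor C (monoidal_act C g) ?F) X Y
        = mult_iso (comp_monoidal_functor C ?F (monoidal_act ?D g)) X Y
          \<cdot>\<^bsub>C\<^esub> snd (X \<otimes>\<^sub>o\<^bsub>?D\<^esub> Y) (g, \<one>\<^bsub>G\<^esub>)"
      using g ob Id_right[OF p] Id_left[OF arr_comp[OF p a]] X Y
      by (simp add: comp_monoidal_functor_def monoidal_act_def family_act_eq family_id_eq
          family_tensor_eq act_Id tensor_Ob fam_Ob Id_left[OF arr_Id])
  next
    show "unit_iso (comp_monoidal_functor C ?F (monoidal_act ?D g)) \<cdot>\<^bsub>C\<^esub> snd (unit_ob ?D) (g, \<one>\<^bsub>G\<^esub>)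
        = unit_iso (comp_monoidal_functor C (monoidal_act C g) ?F)"
      using g by (simp add: comp_monoidal_functor_def monoidal_act_def family_id_eq act_Id unit_Ob
          act_unit Id_left[OF arr_Id])
  qed
next
  fix X assume "X \<in> Ob (family_category G C)"
  then show "snd X (\<one>\<^bsub>G\<^esub>, \<one>\<^bsub>G\<^esub>) = Id C (obmap (eval_functor G C) X)"
    by (simp add: fam_one)
next
  fix g h X assume g: "g \<in> carrier G" and h: "h \<in> carrier G" and "X \<in> Ob (family_category G C)"
  then have X: "X \<in> family_obs G C" by simp
  have a: "arr C (act_ob C (g \<otimes>\<^bsub>G\<^esub> h) (fst X \<one>\<^bsub>G\<^esub>)) (fst X (g \<otimes>\<^bsub>G\<^esub> h)) (snd X (g \<otimes>\<^bsub>G\<^esub> h, \<one>\<^bsub>G\<^esub>))"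
    using fam_iso_arr[OF X m_closed[OF g h] one_closed] g h by simp
  show "mormap (eval_functor G C) (phi (family_category G C) g h X) \<cdot>\<^bsub>C\<^esub> snd X (g \<otimes>\<^bsub>G\<^esub> h, \<one>\<^bsub>G\<^esub>)
      = snd (act_ob (family_category G C) h X) (g, \<one>\<^bsub>G\<^esub>) \<cdot>\<^bsub>C\<^esub> act_mor C g (snd X (h, \<one>\<^bsub>G\<^esub>))
        \<cdot>\<^bsub>C\<^esub> phi C g h (obmap (eval_functor G C) X)"
    using fam_cocycle[OF X g h one_closed] Id_left[OF a] g h
    by (simp add: family_id_eq family_act_eq)
qed

end

section \<open>The grading\<close>

text \<open>
  For a coproduct of plain categories this holds because there are no arrows at all between
  different components; for a coproduct of abelian categories it is part of the definition.
\<close>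
lemma (in graded_monoidal_category) component_iso_closed:
  assumes g: "g \<in> carrier G" and X: "X \<in> component C g" and Y: "Y \<in> Ob C" and f: "is_iso C X Y f"
  shows "Y \<in> component C g"
proof (cases ab)
  case True
  then have "\<forall>X \<in> component C g. \<forall>Y \<in> Ob C. \<forall>f. is_iso C X Y f \<longrightarrow> Y \<in> component C g"
    using decomposition g by (simp add: abelian_coproduct_decomposition_def)
  then show ?thesis using X Y f by blast
next
  case False
  then have dec: "coproduct_decomposition (carrier G) C (component C)" using decomposition by simp
  then obtain h where h: "h \<in> carrier G" "Y \<in> component C h"
    using Y by (auto simp: coproduct_decomposition_def)
  have "Hom C X Y = {}" if "g \<noteq> h"
    using dec g h X that by (simp add: coproduct_decomposition_def)
  then have "g = h" using is_iso_Hom[OF f] by blast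
  then show ?thesis using h by simp
qed

context crossed_monoidal_category
begin

text \<open>
  The grading is pulled back along evaluation. For the crossed condition, the family \<open>g\<^sub>*(L)\<close> has
  the value \<open>L\<^sub>g\<close> at \<open>e\<close>, which is only isomorphic to \<open>g\<^sub>*(L\<^sub>e)\<close>;
  so the components have to be closed under isomorphism.
\<close>
lemma crossed_monoidal_category_family: "crossed_monoidal_category ab G (family_category G C)"
proof -
  interpret F: surjective_equivalence "family_category G C" C "eval_functor G C"
    by (rule surjective_equivalence_eval)
  show ?thesis
  proof (intro crossed_monoidal_category.intro graded_monoidal_category.intro
      graded_monoidal_category_axioms.intro crossed_monoidal_category_axioms.intro
      is_group monoidal_category_family monoidal_G_category_family)
    show "if ab then abelian_coproduct_decomposition (carrier G) (family_category G C)
          (component (family_category G C))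
        else coproduct_decomposition (carrier G) (family_category G C)
          (component (family_category G C))"
    proof -
      have "component (family_category G C)
          = (\<lambda>g. {X \<in> Ob (family_category G C). obmap (eval_functor G C) X \<in> component C g})"
        by (rule ext) simp
      then show ?thesis
        using decomposition F.abelian_coproduct_decomposition_lift F.coproduct_decomposition_lift
        by (simp split: if_splits)
    qed
    show "unit_ob (family_category G C) \<in> component (family_category G C) \<one>\<^bsub>G\<^esub>"
      using family_unit_obs unit_component by simp
    fix g h X assume g: "g \<in> carrier G" and h: "h \<in> carrier G"
    show "X \<otimes>\<^sub>o\<^bsub>family_category G C\<^esub> Y \<in> component (family_category G C) (g \<otimes>\<^bsub>G\<^esub> h)"
      if "X \<in> component (family_category G C) g" "Y \<in> component (family_category G C) h" for Y
      using that g h tensor_component family_tensor_obs by (simp add: family_tensor_eq)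
    assume "X \<in> component (family_category G C) h"
    then have X: "X \<in> family_obs G C" "fst X \<one>\<^bsub>G\<^esub> \<in> component C h" by simp_all
    have "fst X g \<in> component C (g \<otimes>\<^bsub>G\<^esub> h \<otimes>\<^bsub>G\<^esub> inv\<^bsub>G\<^esub> g)"
      by (rule component_iso_closed[OF _ act_component[OF g h X(2)] fam_Ob[OF X(1) g]])
        (use fam_iso[OF X(1) g one_closed] g h in simp_all)
    then show "act_ob (family_category G C) g X
        \<in> component (family_category G C) (g \<otimes>\<^bsub>G\<^esub> h \<otimes>\<^bsub>G\<^esub> inv\<^bsub>G\<^esub> g)"
      using family_act_obs[OF g X(1)] g by (simp add: family_act_eq)
  qed
qed

lemma crossed_equivalence_eval:
  "crossed_equivalence G (family_category G C) C (eval_functor G C) (\<lambda>g X. snd X (g, \<one>\<^bsub>G\<^esub>))"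
  by (simp add: crossed_equivalence_def crossed_functor_def eval_monoidal_G_functor
      category_equivalence_eval)

end


section \<open>Linear structures\<close>

lemma family_linear_simps [simp]:
  "carrier (family_linear G V C X Y) = family_hom G C X Y"
  "\<zero>\<^bsub>family_linear G V C X Y\<^esub> = (\<lambda>g \<in> carrier G. \<zero>\<^bsub>V (fst X g) (fst Y g)\<^esub>)"
  "f \<oplus>\<^bsub>family_linear G V C X Y\<^esub> f' = (\<lambda>g \<in> carrier G. f g \<oplus>\<^bsub>V (fst X g) (fst Y g)\<^esub> f' g)"
  "a \<odot>\<^bsub>family_linear G V C X Y\<^esub> f = (\<lambda>g \<in> carrier G. a \<odot>\<^bsub>V (fst X g) (fst Y g)\<^esub> f g)"
  by (simp_all add: family_linear_def case_prod_unfold)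

context k_linear_category
begin

lemma module_Hom: "\<lbrakk>X \<in> Ob C; Y \<in> Ob C\<rbrakk> \<Longrightarrow> module K (V X Y)"
  using Hom_module by blast

lemma carrier_Hom: "\<lbrakk>X \<in> Ob C; Y \<in> Ob C\<rbrakk> \<Longrightarrow> carrier (V X Y) = Hom C X Y"
  using Hom_module by blast

lemma Hom_abelian_group: "\<lbrakk>X \<in> Ob C; Y \<in> Ob C\<rbrakk> \<Longrightarrow> abelian_group (V X Y)"
  using module_Hom by (rule module.axioms)

lemma arr_zero: "\<lbrakk>X \<in> Ob C; Y \<in> Ob C\<rbrakk> \<Longrightarrow> arr C X Y \<zero>\<^bsub>V X Y\<^esub>"
  using abelian_monoid.zero_closed[OF abelian_group.axioms(1)[OF Hom_abelian_group]]
  by (simp add: arr_def carrier_Hom)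

lemma arr_add: "\<lbrakk>arr C X Y f; arr C X Y f'\<rbrakk> \<Longrightarrow> arr C X Y (f \<oplus>\<^bsub>V X Y\<^esub> f')"
  using abelian_monoid.a_closed[OF abelian_group.axioms(1)[OF Hom_abelian_group]]
  by (simp add: arr_def carrier_Hom)

lemma arr_smult: "\<lbrakk>a \<in> carrier K; arr C X Y f\<rbrakk> \<Longrightarrow> arr C X Y (a \<odot>\<^bsub>V X Y\<^esub> f)"
  using module.smult_closed[OF module_Hom] by (simp add: arr_def carrier_Hom)

lemma zero_smult: "arr C X Y f \<Longrightarrow> \<zero>\<^bsub>K\<^esub> \<odot>\<^bsub>V X Y\<^esub> f = \<zero>\<^bsub>V X Y\<^esub>"
  using module.smult_l_null[OF module_Hom] by (simp add: arr_def carrier_Hom)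

lemma add_comp:
  "\<lbrakk>arr C X Y f; arr C Y Z g; arr C Y Z g'\<rbrakk>
    \<Longrightarrow> (g \<oplus>\<^bsub>V Y Z\<^esub> g') \<cdot>\<^bsub>C\<^esub> f = (g \<cdot>\<^bsub>C\<^esub> f) \<oplus>\<^bsub>V X Z\<^esub> (g' \<cdot>\<^bsub>C\<^esub> f)"
  by (simp add: arr_def comp_add_left)

lemma comp_add:
  "\<lbrakk>arr C X Y f; arr C X Y f'; arr C Y Z g\<rbrakk>
    \<Longrightarrow> g \<cdot>\<^bsub>C\<^esub> (f \<oplus>\<^bsub>V X Y\<^esub> f') = (g \<cdot>\<^bsub>C\<^esub> f) \<oplus>\<^bsub>V X Z\<^esub> (g \<cdot>\<^bsub>C\<^esub> f')"
  by (simp add: arr_def comp_add_right)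

lemma smult_comp:
  "\<lbrakk>a \<in> carrier K; arr C X Y f; arr C Y Z g\<rbrakk>
    \<Longrightarrow> (a \<odot>\<^bsub>V Y Z\<^esub> g) \<cdot>\<^bsub>C\<^esub> f = a \<odot>\<^bsub>V X Z\<^esub> (g \<cdot>\<^bsub>C\<^esub> f)"
  unfolding arr_def using comp_smult_left by blast

lemma comp_smult:
  "\<lbrakk>a \<in> carrier K; arr C X Y f; arr C Y Z g\<rbrakk>
    \<Longrightarrow> g \<cdot>\<^bsub>C\<^esub> (a \<odot>\<^bsub>V X Y\<^esub> f) = a \<odot>\<^bsub>V X Z\<^esub> (g \<cdot>\<^bsub>C\<^esub> f)"
  unfolding arr_def using comp_smult_right by blast

end

locale linear_monoidal_G_category = monoidal_G_category G C + k: k_linear_category K V C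
  for G :: "('g, 'b) monoid_scheme" and C :: "('o, 'm, 'g, 'z) crossed_data_scheme"
    and K :: "('k, 'c) ring_scheme" and V :: "'o \<Rightarrow> 'o \<Rightarrow> ('k, 'm, 'v) module_scheme" +
  assumes act_linear: "g \<in> carrier G \<Longrightarrow> k_linear_functor K V C V C (act C g)"
begin

lemma act_add:
  "\<lbrakk>g \<in> carrier G; arr C X Y f; arr C X Y f'\<rbrakk>
    \<Longrightarrow> act_mor C g (f \<oplus>\<^bsub>V X Y\<^esub> f')
      = act_mor C g f \<oplus>\<^bsub>V (act_ob C g X) (act_ob C g Y)\<^esub> act_mor C g f'"
  using act_linear by (simp add: k_linear_functor_def act_def arr_def)

lemma act_smult:
  "\<lbrakk>g \<in> carrier G; a \<in> carrier K; arr C X Y f\<rbrakk>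
    \<Longrightarrow> act_mor C g (a \<odot>\<^bsub>V X Y\<^esub> f) = a \<odot>\<^bsub>V (act_ob C g X) (act_ob C g Y)\<^esub> act_mor C g f"
  using act_linear by (simp add: k_linear_functor_def act_def arr_def)

lemma family_add_hom:
  assumes X: "X \<in> family_obs G C" and Y: "Y \<in> family_obs G C"
    and f: "f \<in> family_hom G C X Y" and f': "f' \<in> family_hom G C X Y"
  shows "(\<lambda>g \<in> carrier G. f g \<oplus>\<^bsub>V (fst X g) (fst Y g)\<^esub> f' g) \<in> family_hom G C X Y"
  unfolding family_hom_iff
proof (intro conjI ballI)
  fix g assume g: "g \<in> carrier G"
  show "(\<lambda>g \<in> carrier G. f g \<oplus>\<^bsub>V (fst X g) (fst Y g)\<^esub> f' g) g \<in> Hom C (fst X g) (fst Y g)"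
    using k.arr_add[OF fam_hom_arr[OF X Y f g] fam_hom_arr[OF X Y f' g]] g by (simp add: arr_Hom)
  fix h assume h: "h \<in> carrier G"
  note gh = m_closed[OF g h]
  note a = fam_hom_arr[OF X Y f h] and a' = fam_hom_arr[OF X Y f' h]
  show "(\<lambda>g \<in> carrier G. f g \<oplus>\<^bsub>V (fst X g) (fst Y g)\<^esub> f' g) (g \<otimes>\<^bsub>G\<^esub> h) \<cdot>\<^bsub>C\<^esub> snd X (g, h)
      = snd Y (g, h) \<cdot>\<^bsub>C\<^esub> act_mor C g ((\<lambda>g \<in> carrier G. f g \<oplus>\<^bsub>V (fst X g) (fst Y g)\<^esub> f' g) h)"
    using g h
      k.add_comp[OF fam_iso_arr[OF X g h] fam_hom_arr[OF X Y f gh] fam_hom_arr[OF X Y f' gh]]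
      k.comp_add[OF act_arr[OF g a] act_arr[OF g a'] fam_iso_arr[OF Y g h]]
    by (simp add: act_add[OF g a a'] fam_hom_square[OF f] fam_hom_square[OF f'])
qed simp

lemma family_smult_hom:
  assumes X: "X \<in> family_obs G C" and Y: "Y \<in> family_obs G C"
    and f: "f \<in> family_hom G C X Y" and c: "c \<in> carrier K"
  shows "(\<lambda>g \<in> carrier G. c \<odot>\<^bsub>V (fst X g) (fst Y g)\<^esub> f g) \<in> family_hom G C X Y"
  unfolding family_hom_iff
proof (intro conjI ballI)
  fix g assume g: "g \<in> carrier G"
  show "(\<lambda>g \<in> carrier G. c \<odot>\<^bsub>V (fst X g) (fst Y g)\<^esub> f g) g \<in> Hom C (fst X g) (fst Y g)"
    using k.arr_smult[OF c fam_hom_arr[OF X Y f g]] g by (simp add: arr_Hom)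
  fix h assume h: "h \<in> carrier G"
  note gh = m_closed[OF g h]
  note a = fam_hom_arr[OF X Y f h]
  show "(\<lambda>g \<in> carrier G. c \<odot>\<^bsub>V (fst X g) (fst Y g)\<^esub> f g) (g \<otimes>\<^bsub>G\<^esub> h) \<cdot>\<^bsub>C\<^esub> snd X (g, h)
      = snd Y (g, h) \<cdot>\<^bsub>C\<^esub> act_mor C g ((\<lambda>g \<in> carrier G. c \<odot>\<^bsub>V (fst X g) (fst Y g)\<^esub> f g) h)"
    using g h
      k.smult_comp[OF c fam_iso_arr[OF X g h] fam_hom_arr[OF X Y f gh]]
      k.comp_smult[OF c act_arr[OF g a] fam_iso_arr[OF Y g h]]
    by (simp add: act_smult[OF g c a] fam_hom_square[OF f])
qed simp

text \<open>
  Linearity of \<open>g\<^sub>*\<close> and of composition is stated for sums and scalar multiples only, hence zero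
  is treated as the multiple of an arrow by the scalar zero.
\<close>
lemma family_zero_hom:
  assumes X: "X \<in> family_obs G C" and Y: "Y \<in> family_obs G C"
  shows "(\<lambda>g \<in> carrier G. \<zero>\<^bsub>V (fst X g) (fst Y g)\<^esub>) \<in> family_hom G C X Y"
  unfolding family_hom_iff
proof (intro conjI ballI)
  have z: "arr C (fst X g) (fst Y g) \<zero>\<^bsub>V (fst X g) (fst Y g)\<^esub>" if "g \<in> carrier G" for g
    using that X Y by (simp add: k.arr_zero fam_Ob)
  fix g assume g: "g \<in> carrier G"
  show "(\<lambda>g \<in> carrier G. \<zero>\<^bsub>V (fst X g) (fst Y g)\<^esub>) g \<in> Hom C (fst X g) (fst Y g)"
    using z[OF g] g by (simp add: arr_Hom)
  fix h assume h: "h \<in> carrier G"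
  note gh = m_closed[OF g h]
  note x = fam_iso_arr[OF X g h] and y = fam_iso_arr[OF Y g h]
  let ?W = "V (act_ob C g (fst X h)) (fst Y (g \<otimes>\<^bsub>G\<^esub> h))"
  have "\<zero>\<^bsub>V (fst X (g \<otimes>\<^bsub>G\<^esub> h)) (fst Y (g \<otimes>\<^bsub>G\<^esub> h))\<^esub> \<cdot>\<^bsub>C\<^esub> snd X (g, h) = \<zero>\<^bsub>?W\<^esub>"
    using k.smult_comp[OF k.zero_closed x z[OF gh]] k.zero_smult[OF z[OF gh]]
      k.zero_smult[OF arr_comp[OF x z[OF gh]]] by simp
  moreover have "snd Y (g, h) \<cdot>\<^bsub>C\<^esub> act_mor C g \<zero>\<^bsub>V (fst X h) (fst Y h)\<^esub> = \<zero>\<^bsub>?W\<^esub>"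
    using k.comp_smult[OF k.zero_closed act_arr[OF g z[OF h]] y] k.zero_smult[OF z[OF h]]
      act_smult[OF g k.zero_closed z[OF h]] k.zero_smult[OF arr_comp[OF act_arr[OF g z[OF h]] y]]
    by simp
  ultimately show "(\<lambda>g \<in> carrier G. \<zero>\<^bsub>V (fst X g) (fst Y g)\<^esub>) (g \<otimes>\<^bsub>G\<^esub> h) \<cdot>\<^bsub>C\<^esub> snd X (g, h)
      = snd Y (g, h) \<cdot>\<^bsub>C\<^esub> act_mor C g ((\<lambda>g \<in> carrier G. \<zero>\<^bsub>V (fst X g) (fst Y g)\<^esub>) h)"
    using g h by simp
qed simp

lemma family_linear_module:
  assumes X: "X \<in> family_obs G C" and Y: "Y \<in> family_obs G C"
  shows "module K (family_linear G V C X Y)"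
proof -
  let ?V = "\<lambda>g. V (fst X g) (fst Y g)"
  have mod: "module K (?V g)" and grp: "abelian_group (?V g)" if "g \<in> carrier G" for g
    using that X Y by (simp_all add: fam_Ob k.module_Hom k.Hom_abelian_group)
  have mon: "abelian_monoid (?V g)" if "g \<in> carrier G" for g
    using grp[OF that] by (rule abelian_group.axioms)
  have mem: "f g \<in> carrier (?V g)" if "f \<in> family_hom G C X Y" "g \<in> carrier G" for f g
    using that X Y by (simp add: k.carrier_Hom fam_Ob family_hom_iff)
  have ext: "(\<lambda>g \<in> carrier G. f g) = f" if "f \<in> family_hom G C X Y" for f
    using that by (simp add: family_hom_iff extensional_restrict)
  show ?thesis
  proof (intro moduleI abelian_groupI, simp_all only: family_linear_simps)
    fix f f' assume f: "f \<in> family_hom G C X Y" and f': "f' \<in> family_hom G C X Y"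
    show "(\<lambda>g \<in> carrier G. f g \<oplus>\<^bsub>?V g\<^esub> f' g) \<in> family_hom G C X Y"
      by (rule family_add_hom[OF X Y f f'])
    show "(\<lambda>g \<in> carrier G. f g \<oplus>\<^bsub>?V g\<^esub> f' g) = (\<lambda>g \<in> carrier G. f' g \<oplus>\<^bsub>?V g\<^esub> f g)"
      by (intro restrict_ext) (simp add: abelian_monoid.a_comm[OF mon] mem f f')
    show "(\<lambda>g \<in> carrier G. (\<lambda>g \<in> carrier G. f g \<oplus>\<^bsub>?V g\<^esub> f' g) g \<oplus>\<^bsub>?V g\<^esub> f'' g)
        = (\<lambda>g \<in> carrier G. f g \<oplus>\<^bsub>?V g\<^esub> (\<lambda>g \<in> carrier G. f' g \<oplus>\<^bsub>?V g\<^esub> f'' g) g)"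
      if f'': "f'' \<in> family_hom G C X Y" for f''
      by (intro restrict_ext) (simp add: abelian_monoid.a_assoc[OF mon] mem f f' f'')
    fix a assume a: "a \<in> carrier K"
    show "(\<lambda>g \<in> carrier G. a \<odot>\<^bsub>?V g\<^esub> (\<lambda>g \<in> carrier G. f g \<oplus>\<^bsub>?V g\<^esub> f' g) g)
        = (\<lambda>g \<in> carrier G. (\<lambda>g \<in> carrier G. a \<odot>\<^bsub>?V g\<^esub> f g) g \<oplus>\<^bsub>?V g\<^esub> (\<lambda>g \<in> carrier G. a \<odot>\<^bsub>?V g\<^esub> f' g) g)"
      by (intro restrict_ext) (simp add: module.smult_r_distr[OF mod] mem f f' a)
  next
    fix f assume f: "f \<in> family_hom G C X Y"
    show "(\<lambda>g \<in> carrier G. (\<lambda>g \<in> carrier G. \<zero>\<^bsub>?V g\<^esub>) g \<oplus>\<^bsub>?V g\<^esub> f g) = f"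
    proof -
      have "(\<lambda>g \<in> carrier G. (\<lambda>g \<in> carrier G. \<zero>\<^bsub>?V g\<^esub>) g \<oplus>\<^bsub>?V g\<^esub> f g) = (\<lambda>g \<in> carrier G. f g)"
        by (intro restrict_ext) (simp add: abelian_monoid.l_zero[OF mon] mem f)
      then show ?thesis by (simp add: ext f)
    qed
    show "(\<lambda>g \<in> carrier G. \<one>\<^bsub>K\<^esub> \<odot>\<^bsub>?V g\<^esub> f g) = f"
    proof -
      have "(\<lambda>g \<in> carrier G. \<one>\<^bsub>K\<^esub> \<odot>\<^bsub>?V g\<^esub> f g) = (\<lambda>g \<in> carrier G. f g)"
        by (intro restrict_ext) (simp add: module.smult_one[OF mod] mem f)
      then show ?thesis by (simp add: ext f)
    qed
    \<comment> \<open>Negatives are multiples by \<open>-1\<close>, so that closure under scalar multiples applies.\<close>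
    let ?n = "\<ominus>\<^bsub>K\<^esub> \<one>\<^bsub>K\<^esub>"
    have n: "?n \<in> carrier K" by simp
    have inv: "?n \<odot>\<^bsub>?V g\<^esub> f g \<oplus>\<^bsub>?V g\<^esub> f g = \<zero>\<^bsub>?V g\<^esub>" if g: "g \<in> carrier G" for g
    proof -
      have "?n \<odot>\<^bsub>?V g\<^esub> f g \<oplus>\<^bsub>?V g\<^esub> f g = (?n \<oplus>\<^bsub>K\<^esub> \<one>\<^bsub>K\<^esub>) \<odot>\<^bsub>?V g\<^esub> f g"
        using module.smult_l_distr[OF mod[OF g] n k.one_closed mem[OF f g]]
          module.smult_one[OF mod[OF g] mem[OF f g]] by simp
      then show ?thesis
        using module.smult_l_null[OF mod[OF g] mem[OF f g]] by (simp add: k.l_neg)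
    qed
    show "\<exists>f' \<in> family_hom G C X Y.
        (\<lambda>g \<in> carrier G. f' g \<oplus>\<^bsub>?V g\<^esub> f g) = (\<lambda>g \<in> carrier G. \<zero>\<^bsub>?V g\<^esub>)"
    proof
      show "(\<lambda>g \<in> carrier G. ?n \<odot>\<^bsub>?V g\<^esub> f g) \<in> family_hom G C X Y"
        by (rule family_smult_hom[OF X Y f n])
      show "(\<lambda>g \<in> carrier G. (\<lambda>g \<in> carrier G. ?n \<odot>\<^bsub>?V g\<^esub> f g) g \<oplus>\<^bsub>?V g\<^esub> f g)
          = (\<lambda>g \<in> carrier G. \<zero>\<^bsub>?V g\<^esub>)"
        by (intro restrict_ext) (simp add: inv)
    qed
    fix a assume a: "a \<in> carrier K"
    show "(\<lambda>g \<in> carrier G. a \<odot>\<^bsub>?V g\<^esub> f g) \<in> family_hom G C X Y"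
      by (rule family_smult_hom[OF X Y f a])
    fix b assume b: "b \<in> carrier K"
    show "(\<lambda>g \<in> carrier G. (a \<oplus>\<^bsub>K\<^esub> b) \<odot>\<^bsub>?V g\<^esub> f g)
        = (\<lambda>g \<in> carrier G. (\<lambda>g \<in> carrier G. a \<odot>\<^bsub>?V g\<^esub> f g) g \<oplus>\<^bsub>?V g\<^esub> (\<lambda>g \<in> carrier G. b \<odot>\<^bsub>?V g\<^esub> f g) g)"
      by (intro restrict_ext) (simp add: module.smult_l_distr[OF mod] mem f a b)
    show "(\<lambda>g \<in> carrier G. (a \<otimes>\<^bsub>K\<^esub> b) \<odot>\<^bsub>?V g\<^esub> f g)
        = (\<lambda>g \<in> carrier G. a \<odot>\<^bsub>?V g\<^esub> (\<lambda>g \<in> carrier G. b \<odot>\<^bsub>?V g\<^esub> f g) g)"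
      by (intro restrict_ext) (simp add: module.smult_assoc1[OF mod] mem f a b)
  qed (rule k.is_cring family_zero_hom[OF X Y])+
qed

lemma k_linear_category_family: "k_linear_category K (family_linear G V C) (family_category G C)"
proof (intro k_linear_category.intro k_linear_category_axioms.intro category_family k.is_cring,
    simp_all only: family_category_simps(1-4) family_linear_simps)
  fix X Y assume "X \<in> family_obs G C" "Y \<in> family_obs G C"
  then show "module K (family_linear G V C X Y) \<and> family_hom G C X Y = family_hom G C X Y"
    by (simp add: family_linear_module)
next
  fix X Y Z f f' f''
  assume X: "X \<in> family_obs G C" and Y: "Y \<in> family_obs G C" and Z: "Z \<in> family_obs G C"
    and f: "f \<in> family_hom G C X Y" and f': "f' \<in> family_hom G C Y Z" and f'': "f'' \<in> family_hom G C Y Z"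
  show "(\<lambda>g \<in> carrier G. (\<lambda>g \<in> carrier G. f' g \<oplus>\<^bsub>V (fst Y g) (fst Z g)\<^esub> f'' g) g \<cdot>\<^bsub>C\<^esub> f g)
      = (\<lambda>g \<in> carrier G. (\<lambda>g \<in> carrier G. f' g \<cdot>\<^bsub>C\<^esub> f g) g \<oplus>\<^bsub>V (fst X g) (fst Z g)\<^esub>
          (\<lambda>g \<in> carrier G. f'' g \<cdot>\<^bsub>C\<^esub> f g) g)"
    by (intro restrict_ext)
      (simp add: k.add_comp[OF fam_hom_arr[OF X Y f] fam_hom_arr[OF Y Z f'] fam_hom_arr[OF Y Z f'']])
next
  fix X Y Z f f' f''
  assume X: "X \<in> family_obs G C" and Y: "Y \<in> family_obs G C" and Z: "Z \<in> family_obs G C"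
    and f: "f \<in> family_hom G C X Y" and f': "f' \<in> family_hom G C X Y" and f'': "f'' \<in> family_hom G C Y Z"
  show "(\<lambda>g \<in> carrier G. f'' g \<cdot>\<^bsub>C\<^esub> (\<lambda>g \<in> carrier G. f g \<oplus>\<^bsub>V (fst X g) (fst Y g)\<^esub> f' g) g)
      = (\<lambda>g \<in> carrier G. (\<lambda>g \<in> carrier G. f'' g \<cdot>\<^bsub>C\<^esub> f g) g \<oplus>\<^bsub>V (fst X g) (fst Z g)\<^esub>
          (\<lambda>g \<in> carrier G. f'' g \<cdot>\<^bsub>C\<^esub> f' g) g)"
    by (intro restrict_ext)
      (simp add: k.comp_add[OF fam_hom_arr[OF X Y f] fam_hom_arr[OF X Y f'] fam_hom_arr[OF Y Z f'']])
next
  fix a X Y Z f f'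
  assume a: "a \<in> carrier K"
    and X: "X \<in> family_obs G C" and Y: "Y \<in> family_obs G C" and Z: "Z \<in> family_obs G C"
    and f: "f \<in> family_hom G C X Y" and f': "f' \<in> family_hom G C Y Z"
  note c = k.smult_comp[OF a fam_hom_arr[OF X Y f] fam_hom_arr[OF Y Z f']]
    k.comp_smult[OF a fam_hom_arr[OF X Y f] fam_hom_arr[OF Y Z f']]
  show "(\<lambda>g \<in> carrier G. (\<lambda>g \<in> carrier G. a \<odot>\<^bsub>V (fst Y g) (fst Z g)\<^esub> f' g) g \<cdot>\<^bsub>C\<^esub> f g)
      = (\<lambda>g \<in> carrier G. a \<odot>\<^bsub>V (fst X g) (fst Z g)\<^esub> (\<lambda>g \<in> carrier G. f' g \<cdot>\<^bsub>C\<^esub> f g) g)"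
    by (intro restrict_ext) (simp add: c)
  show "(\<lambda>g \<in> carrier G. f' g \<cdot>\<^bsub>C\<^esub> (\<lambda>g \<in> carrier G. a \<odot>\<^bsub>V (fst X g) (fst Y g)\<^esub> f g) g)
      = (\<lambda>g \<in> carrier G. a \<odot>\<^bsub>V (fst X g) (fst Z g)\<^esub> (\<lambda>g \<in> carrier G. f' g \<cdot>\<^bsub>C\<^esub> f g) g)"
    by (intro restrict_ext) (simp add: c)
qed

text \<open>
  Translating the index of a family commutes with componentwise operations, so the action is
  linear by definition.
\<close>
lemma k_linear_action_family: "k_linear_action K (family_linear G V C) G (family_category G C)"
  unfolding k_linear_action_def k_linear_functor_def
  using monoidal_G_category.act_functor[OF monoidal_G_category_family]
  by (auto simp: k_linear_category_family act_def family_act_eq intro!: restrict_ext)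

lemma eval_k_linear:
  "k_linear_functor K (family_linear G V C) (family_category G C) V C (eval_functor G C)"
  by (simp add: k_linear_functor_def eval_is_functor)

end

theorem corollary5p3:
  fixes G :: "('g, 'a) monoid_scheme"
    and K :: "('k, 'b) ring_scheme"
    and C :: "('o, 'm, 'g) crossed_data"
    and ab :: bool
  assumes "group G" and "cring K"
    and "crossed_monoidal_category ab G C"
  shows "strict_crossed_monoidal_category ab G (family_category G C) \<and>
    crossed_equivalent G (family_category G C) C \<and>
    (\<forall>V :: 'o \<Rightarrow> 'o \<Rightarrow> ('k, 'm) module. k_linear_action K V G C \<longrightarrow>
      k_linear_action K (family_linear G V C) G (family_category G C) \<and>
      k_linear_crossed_equivalent K G (family_linear G V C) (family_category G C) V C)"
proof -
  interpret crossed_monoidal_category ab G C by fact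
  have "k_linear_action K (family_linear G V C) G (family_category G C) \<and>
      k_linear_crossed_equivalent K G (family_linear G V C) (family_category G C) V C"
    if "k_linear_action K V G C" for V :: "'o \<Rightarrow> 'o \<Rightarrow> ('k, 'm) module"
  proof -
    interpret linear_monoidal_G_category G C K V
      using that
      by (intro linear_monoidal_G_category.intro linear_monoidal_G_category_axioms.intro
          monoidal_G_category_axioms) (auto simp: k_linear_action_def)
    show ?thesis
      unfolding k_linear_crossed_equivalent_def
      using k_linear_action_family crossed_equivalence_eval eval_k_linear by blast
  qed
  then show ?thesis
    unfolding strict_crossed_monoidal_category_def crossed_equivalent_def
    using crossed_monoidal_category_family strict_action_family crossed_equivalence_eval by blast
qed

end
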